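(* Let $\bar E>1$, $\varepsilon<0.005$ and $n\ge10$. Any algorithm that learns an unknown zero-mean $n$-mode Gaussian state $\rho(0,\Sigma)$, promised to satisfy $\|\Sigma\|_{\mathrm{op}}\le\bar E$, to trace distance $\varepsilon$ with probability at least $2/3$, using only heterodyne measurements (each copy measured individually by heterodyne, followed by arbitrary classical processing), must use $N=\Omega(\bar E^2n^3/\varepsilon^2)$ copies.
   Context: $n$ bosonic modes have quadrature vector $\hat R=(\hat x_1,\dots,\hat x_n,\hat p_1,\dots,\hat p_n)$ with $[\hat R_j,\hat R_k]=i\Omega_{jk}$, $\Omega=\begin{pmatrix}0_n&I_n\\-I_n&0_n\end{pmatrix}$. Mean $\mu_j=\mathrm{Tr}(\rho\hat R_j)$, covariance $\Sigma_{jk}=\tfrac12\mathrm{Tr}(\rho\{\hat R_j-\mu_j,\hat R_k-\mu_k\})$ (vacuum: $\tfrac12I_{2n}$). A Gaussian state $\rho(\mu,\Sigma)$ has Wigner function $\mathcal N(\mu,\Sigma)$. With $\hat D(\xi)=\exp(i\xi^T\Omega\hat R)$, heterodyne measurement is the POVM $\{(2\pi)^{-n}\hat D(\xi)\rho(0,\tfrac12I_{2n})\hat D(\xi)^\dagger\}_{\xi\in\mathbb R^{2n}}$, whose outcome on $\rho(\mu,\Sigma)$ is distributed as $\mathcal N(\mu,\Sigma+\tfrac12I_{2n})$. $D_{\mathrm{tr}}(\rho,\sigma)=\tfrac12\|\rho-\sigma\|_1$. *)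

theory Defs
  imports "HOL-Probability.Probability" "Jordan_Normal_Form.Gauss_Jordan_Elimination"
    "Jordan_Normal_Form.Determinant"
begin

text \<open>Conventions. A vector of R^m is a function nat => real whose entries with index < m
  are the coordinates (elements of the product measure space Rn m are extensional).
  Quadrature ordering (x_1..x_n,p_1..p_n). Matrices are Jordan_Normal_Form matrices.\<close>

definition Rn :: "nat \<Rightarrow> (nat \<Rightarrow> real) measure" where
  "Rn m = PiM {..<m} (\<lambda>_. lborel)"

definition qform :: "real mat \<Rightarrow> (nat \<Rightarrow> real) \<Rightarrow> real" where
  "qform S x = (\<Sum>i<dim_row S. \<Sum>j<dim_col S. x i * S $$ (i,j) * x j)"

definition gauss_density :: "nat \<Rightarrow> real mat \<Rightarrow> (nat \<Rightarrow> real) \<Rightarrow> real" where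
  "gauss_density m S x =
     exp (- qform (the (mat_inverse S)) x / 2) / sqrt ((2 * pi) ^ m * Determinant.det S)"

definition gauss_measure :: "nat \<Rightarrow> real mat \<Rightarrow> (nat \<Rightarrow> real) measure" where
  "gauss_measure m S = density (Rn m) (\<lambda>x. ennreal (gauss_density m S x))"

definition Omega :: "nat \<Rightarrow> real mat" where
  "Omega n = Matrix.mat (2*n) (2*n)
     (\<lambda>(j,k). if j < n \<and> k = j + n then 1 else if k < n \<and> j = k + n then -1 else 0)"

definition quantum_cov :: "nat \<Rightarrow> real mat \<Rightarrow> bool" where
  "quantum_cov n \<Sigma> \<longleftrightarrow> \<Sigma> \<in> carrier_mat (2*n) (2*n) \<and> transpose_mat \<Sigma> = \<Sigma> \<and>
     (\<forall>v :: nat \<Rightarrow> complex. 0 \<le> Re (\<Sum>j<2*n. \<Sum>k<2*n.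
        cnj (v j) * (complex_of_real (\<Sigma> $$ (j,k)) + \<i> / 2 * complex_of_real (Omega n $$ (j,k))) * v k))"

definition op_norm_le :: "nat \<Rightarrow> real mat \<Rightarrow> real \<Rightarrow> bool" where
  "op_norm_le n \<Sigma> E \<longleftrightarrow> (\<forall>x :: nat \<Rightarrow> real.
     sqrt (\<Sum>j<2*n. (\<Sum>k<2*n. \<Sigma> $$ (j,k) * x k)\<^sup>2) \<le> E * sqrt (\<Sum>k<2*n. (x k)\<^sup>2))"

text \<open>Operators on L^2(R^n) are represented by integral kernels K x y (position representation).\<close>
type_synonym kernel = "(nat \<Rightarrow> real) \<Rightarrow> (nat \<Rightarrow> real) \<Rightarrow> complex"

definition join_xp :: "nat \<Rightarrow> (nat \<Rightarrow> real) \<Rightarrow> (nat \<Rightarrow> real) \<Rightarrow> (nat \<Rightarrow> real)" where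
  "join_xp n x p = (\<lambda>i. if i < n then x i else p (i - n))"

definition wigner_gauss :: "nat \<Rightarrow> real mat \<Rightarrow> (nat \<Rightarrow> real) \<Rightarrow> (nat \<Rightarrow> real) \<Rightarrow> real" where
  "wigner_gauss n \<Sigma> x p = gauss_density (2*n) \<Sigma> (join_xp n x p)"

text \<open>Position-representation kernel obtained from the Wigner function by the inverse
  Weyl transform: rho(a,b) = int W((a+b)/2, p) exp(i p.(a-b)) dp.\<close>
definition gauss_state_kernel :: "nat \<Rightarrow> real mat \<Rightarrow> kernel" where
  "gauss_state_kernel n \<Sigma> a b =
     integral\<^sup>L (Rn n) (\<lambda>p. complex_of_real (wigner_gauss n \<Sigma> (\<lambda>i. (a i + b i) / 2) p) *
        exp (\<i> * complex_of_real (\<Sum>i<n. p i * (a i - b i))))"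

definition L2 :: "nat \<Rightarrow> ((nat \<Rightarrow> real) \<Rightarrow> complex) \<Rightarrow> bool" where
  "L2 n f \<longleftrightarrow> f \<in> borel_measurable (Rn n) \<and> integrable (Rn n) (\<lambda>x. (cmod (f x))\<^sup>2)"

definition l2_inner :: "nat \<Rightarrow> ((nat \<Rightarrow> real) \<Rightarrow> complex) \<Rightarrow> ((nat \<Rightarrow> real) \<Rightarrow> complex) \<Rightarrow> complex" where
  "l2_inner n f g = integral\<^sup>L (Rn n) (\<lambda>x. cnj (f x) * g x)"

definition orthonormal :: "nat \<Rightarrow> nat \<Rightarrow> (nat \<Rightarrow> (nat \<Rightarrow> real) \<Rightarrow> complex) \<Rightarrow> bool" where
  "orthonormal n k e \<longleftrightarrow> (\<forall>i<k. L2 n (e i)) \<and>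
     (\<forall>i<k. \<forall>j<k. l2_inner n (e i) (e j) = (if i = j then 1 else 0))"

definition kform :: "nat \<Rightarrow> kernel \<Rightarrow> ((nat \<Rightarrow> real) \<Rightarrow> complex) \<Rightarrow> ((nat \<Rightarrow> real) \<Rightarrow> complex) \<Rightarrow> complex" where
  "kform n K f g = integral\<^sup>L (Rn n \<Otimes>\<^sub>M Rn n) (\<lambda>(x,y). cnj (f x) * K x y * g y)"

definition trace_norm :: "nat \<Rightarrow> kernel \<Rightarrow> ereal" where
  "trace_norm n K = (SUP (k, e, f) \<in> {(k, e, f). orthonormal n k e \<and> orthonormal n k f}.
      ereal (\<Sum>i<k. cmod (kform n K (f i) (e i))))"

definition trace_dist :: "nat \<Rightarrow> kernel \<Rightarrow> kernel \<Rightarrow> ereal" where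
  "trace_dist n K L = trace_norm n (\<lambda>x y. K x y - L x y) / 2"

text \<open>K is the kernel of a density operator on L^2(R^n): square integrable (Hilbert-Schmidt),
  positive semidefinite and of trace one (trace = sup over finite orthonormal families).\<close>
definition density_kernel :: "nat \<Rightarrow> kernel \<Rightarrow> bool" where
  "density_kernel n K \<longleftrightarrow>
     (\<lambda>(x,y). K x y) \<in> borel_measurable (Rn n \<Otimes>\<^sub>M Rn n) \<and>
     integrable (Rn n \<Otimes>\<^sub>M Rn n) (\<lambda>(x,y). (cmod (K x y))\<^sup>2) \<and>
     (\<forall>f. L2 n f \<longrightarrow> Im (kform n K f f) = 0 \<and> 0 \<le> Re (kform n K f f)) \<and>
     (SUP (k, e) \<in> {(k, e). orthonormal n k e}. ereal (\<Sum>i<k. Re (kform n K (e i) (e i)))) = 1"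

text \<open>Outcomes of N independent heterodyne measurements on rho(0,Sigma): N i.i.d. samples of
  N(0, Sigma + I/2), together with an independent uniform random seed in [0,1]
  for the (possibly randomized) classical post-processing.\<close>
definition hetero_samples :: "nat \<Rightarrow> nat \<Rightarrow> real mat \<Rightarrow> ((nat \<Rightarrow> nat \<Rightarrow> real) \<times> real) measure" where
  "hetero_samples n N \<Sigma> =
     PiM {..<N} (\<lambda>_. gauss_measure (2*n) (\<Sigma> + (1/2) \<cdot>\<^sub>m 1\<^sub>m (2*n)))
       \<Otimes>\<^sub>M uniform_measure lborel {0..1}"

text \<open>A learns every zero-mean n-mode Gaussian state with ||Sigma||_op <= E to trace distance
  eps with probability >= 2/3 from N heterodyne samples (inner probability of success).\<close>
definition heterodyne_learns ::
  "nat \<Rightarrow> nat \<Rightarrow> real \<Rightarrow> real \<Rightarrow> ((nat \<Rightarrow> nat \<Rightarrow> real) \<times> real \<Rightarrow> kernel) \<Rightarrow> bool" where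
  "heterodyne_learns n N E \<epsilon> A \<longleftrightarrow>
     (\<forall>\<Sigma>. quantum_cov n \<Sigma> \<and> op_norm_le n \<Sigma> E \<longrightarrow>
        (\<exists>S \<in> sets (hetero_samples n N \<Sigma>). measure (hetero_samples n N \<Sigma>) S \<ge> 2/3 \<and>
           (\<forall>\<omega>\<in>S. density_kernel n (A \<omega>) \<and>
              trace_dist n (A \<omega>) (gauss_state_kernel n \<Sigma>) \<le> ereal \<epsilon>)))"

end

theory Submission
  imports Defs
begin

text \<open>
  For a sign matrix \<open>B\<close> of size \<open>m = n div 2\<close> put \<open>T = ((0, B), (B\<^sup>T, 0))\<close>, \<open>Z = 1 + T / sqrt m\<close>,
  \<open>G = g Z\<^sup>2\<close> with \<open>g = 25 \<epsilon> / m\<close>, and consider the state with momentum covariance \<open>E\<close> and position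
  covariance \<open>(1 + G) / (1 - G) / (4 E)\<close>: a squeezed vacuum with a little extra noise in the squeezed
  quadratures. In the basis of single excitations of the squeezed vacuum it has the matrix
  \<open>sqrt (det (1 - G)) G / 2\<close>, whose off-diagonal block is proportional to \<open>B\<close>. So the trace distance of
  two such states is controlled from below by the trace norm of (nearly) the difference of their sign
  matrices. A unitary \<open>P + i S\<close>, the Cayley transform of a multiple of that difference, bounds this
  norm from below by second and fourth moments: about \<open>\<epsilon>\<close> for sign matrices that differ in a quarter of the entries
  and have typical fourth moments.

  Heterodyne detection adds noise \<open>1/2\<close>, so relative to the measured covariance the signal is
  smaller by a factor \<open>E\<close>, and its square in Frobenius norm is only \<open>\<epsilon>\<^sup>2 / (n E\<^sup>2)\<close>. This bounds the chi-square
  divergence of one outcome from a fixed Gaussian. The success events of a learner overlap only for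
  sign matrices inside a Hamming ball of radius \<open>m\<^sup>2 / 4\<close>, an exponentially small fraction of the cube,
  hence \<open>N \<epsilon>\<^sup>2 / (n E\<^sup>2)\<close> must be at least of order \<open>n\<^sup>2\<close>.
\<close>

text \<open>Two sizes of \<open>G\<close> compete: its trace, and with it the weight of the single
  excitations, is of order \<epsilon>, while its Frobenius norm is only of order \<epsilon> / sqrt
  m. States are told apart by the former and detected by the latter. \<open>G\<close> must be
  positive, or the squeezed quadrature would violate the uncertainty relation, yet sign matrices are
  indefinite. The square \<open>Z * Z\<close> is positive whatever the spectrum of \<open>T\<close>,
  and since \<open>T * T\<close> stays in the diagonal blocks, the off-diagonal block remains
  exactly linear in \<open>B\<close>. The test unitary is therefore built with an imaginary part
  that lives off the diagonal blocks. Two hypotheses have different vacuum weights a and b, so a B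
  is compared with b B'; where the signs differ the weights add up and cannot cancel. Spectral
  theory is avoided throughout: Frobenius norms replace operator norms, Schur complements replace
  diagonalisation, and a rational Cayley transform replaces the sign function of the difference. No
  code is selected from the cube. All typical sign matrices are kept, and the overlap of their
  success events is counted pointwise and averaged.\<close>

section \<open>Matrices acting on coordinate functions, and their quadratic forms\<close>

definition mapp :: "real mat \<Rightarrow> (nat \<Rightarrow> real) \<Rightarrow> nat \<Rightarrow> real" where
  "mapp A x i = (\<Sum>j<dim_col A. A $$ (i,j) * x j)"

definition mip :: "real mat \<Rightarrow> real mat \<Rightarrow> real" where
  "mip A B = (\<Sum>i<dim_row A. \<Sum>j<dim_col A. A $$ (i,j) * B $$ (i,j))"

definition frob :: "real mat \<Rightarrow> real" where
  "frob A = sqrt (mip A A)"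

definition mtr :: "real mat \<Rightarrow> real" where
  "mtr A = (\<Sum>i<dim_row A. A $$ (i,i))"

definition nsq :: "nat \<Rightarrow> (nat \<Rightarrow> real) \<Rightarrow> real" where
  "nsq n x = (\<Sum>i<n. (x i)\<^sup>2)"

definition symm :: "nat \<Rightarrow> real mat \<Rightarrow> bool" where
  "symm n A \<longleftrightarrow> A \<in> carrier_mat n n \<and> transpose_mat A = A"

text \<open>Positivity is stated with a uniform constant \<open>l\<close>, equivalent to strict
  positivity in finite dimension. The constant survives Schur complements and congruences, and a
  slice of it pays for polynomial factors in Gaussian integrals.\<close>

definition pd :: "nat \<Rightarrow> real mat \<Rightarrow> bool" where
  "pd n A \<longleftrightarrow> symm n A \<and> (\<exists>l>0. \<forall>x. l * nsq n x \<le> qform A x)"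

lemma symm_carrier: "symm n A \<Longrightarrow> A \<in> carrier_mat n n"
  by (simp add: symm_def)

lemma symm_index: "symm n A \<Longrightarrow> i < n \<Longrightarrow> j < n \<Longrightarrow> A $$ (i,j) = A $$ (j,i)"
  unfolding symm_def by (metis carrier_matD index_transpose_mat(1))

lemma symmI: "A \<in> carrier_mat n n \<Longrightarrow> (\<And>i j. i < n \<Longrightarrow> j < n \<Longrightarrow> A $$ (i,j) = A $$ (j,i)) \<Longrightarrow> symm n A"
  unfolding symm_def by (auto intro!: eq_matI)

lemma mult_index:
  fixes A B :: "'a :: comm_semiring_0 mat"
  assumes "A \<in> carrier_mat n k" "B \<in> carrier_mat k m" "i < n" "j < m"
  shows "(A * B) $$ (i,j) = (\<Sum>l<k. A $$ (i,l) * B $$ (l,j))"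
  using assms by (auto simp: index_mult_mat(1) scalar_prod_def lessThan_atLeast0 intro!: sum.cong)

declare index_mult_mat(1) [simp del]

lemma symm_add:
  assumes "symm n A" "symm n B" shows "symm n (A + B)"
  using assms[THEN symm_carrier] symm_index[OF assms(1)] symm_index[OF assms(2)]
  by (intro symmI) auto

lemma symm_minus:
  assumes "symm n A" "symm n B" shows "symm n (A - B)"
  using assms[THEN symm_carrier] symm_index[OF assms(1)] symm_index[OF assms(2)]
  by (intro symmI) auto

lemma symm_smult:
  assumes "symm n A" shows "symm n (c \<cdot>\<^sub>m A)"
  using assms[THEN symm_carrier] symm_index[OF assms] by (intro symmI) auto

lemma symm_one: "symm n (1\<^sub>m n)"
  by (rule symmI) auto

lemma symm_mult:
  assumes "symm n A" "symm n B" "A * B = B * A"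
  shows "symm n (A * B)"
  using assms unfolding symm_def by (metis mult_carrier_mat transpose_mult)

lemma mapp_eq: "A \<in> carrier_mat n k \<Longrightarrow> mapp A x i = (\<Sum>j<k. A $$ (i,j) * x j)"
  by (simp add: mapp_def)

lemma qform_eq: "A \<in> carrier_mat n n \<Longrightarrow> qform A x = (\<Sum>i<n. \<Sum>j<n. x i * A $$ (i,j) * x j)"
  by (simp add: qform_def)

lemma qform_mapp: "A \<in> carrier_mat n n \<Longrightarrow> qform A x = (\<Sum>i<n. x i * mapp A x i)"
  by (simp add: qform_def mapp_def sum_distrib_left mult.assoc)

lemma mapp_mult:
  assumes "A \<in> carrier_mat n k" "B \<in> carrier_mat k m" "i < n"
  shows "mapp (A * B) x i = mapp A (mapp B x) i"
proof -
  have "mapp (A * B) x i = (\<Sum>j<m. \<Sum>l<k. A $$ (i,l) * B $$ (l,j) * x j)"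
    using assms by (simp add: mapp_def mult_index[OF assms(1,2,3)] sum_distrib_right)
  also have "\<dots> = (\<Sum>l<k. \<Sum>j<m. A $$ (i,l) * B $$ (l,j) * x j)"
    by (rule sum.swap)
  finally show ?thesis
    using assms by (simp add: mapp_def sum_distrib_left mult.assoc)
qed

lemma mapp_one: "i < n \<Longrightarrow> mapp (1\<^sub>m n) x i = x i"
  by (simp add: mapp_def if_distrib[of "\<lambda>t. t * _"] cong: if_cong)

lemma mapp_add: "A \<in> carrier_mat n k \<Longrightarrow> B \<in> carrier_mat n k \<Longrightarrow> i < n \<Longrightarrow>
   mapp (A + B) x i = mapp A x i + mapp B x i"
  by (auto simp: mapp_def sum.distrib[symmetric] algebra_simps intro!: sum.cong)

lemma mapp_minus: "A \<in> carrier_mat n k \<Longrightarrow> B \<in> carrier_mat n k \<Longrightarrow> i < n \<Longrightarrow>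
   mapp (A - B) x i = mapp A x i - mapp B x i"
  by (auto simp: mapp_def sum_subtractf[symmetric] algebra_simps intro!: sum.cong)

lemma mapp_smult: "A \<in> carrier_mat n k \<Longrightarrow> i < n \<Longrightarrow> mapp (c \<cdot>\<^sub>m A) x i = c * mapp A x i"
  by (auto simp: mapp_def sum_distrib_left mult.assoc intro!: sum.cong)

lemma qform_one: "qform (1\<^sub>m n) x = nsq n x"
  by (simp add: qform_mapp[of _ n] mapp_one nsq_def power2_eq_square)

lemma qform_add: "A \<in> carrier_mat n n \<Longrightarrow> B \<in> carrier_mat n n \<Longrightarrow> qform (A + B) x = qform A x + qform B x"
  by (simp add: qform_mapp[of _ n] mapp_add[of _ n n] sum.distrib algebra_simps)

lemma qform_minus: "A \<in> carrier_mat n n \<Longrightarrow> B \<in> carrier_mat n n \<Longrightarrow> qform (A - B) x = qform A x - qform B x"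
  by (simp add: qform_mapp[of _ n] minus_carrier_mat mapp_minus[of _ n n] sum_subtractf right_diff_distrib)

lemma qform_smult: "A \<in> carrier_mat n n \<Longrightarrow> qform (c \<cdot>\<^sub>m A) x = c * qform A x"
  by (simp add: qform_mapp[of _ n] mapp_smult[of _ n n] sum_distrib_left algebra_simps)

lemma mapp_symm_swap:
  assumes "symm n A"
  shows "(\<Sum>i<n. x i * mapp A y i) = (\<Sum>i<n. mapp A x i * y i)"
proof -
  have "(\<Sum>i<n. x i * mapp A y i) = (\<Sum>i<n. \<Sum>j<n. x i * (A $$ (i,j) * y j))"
    using symm_carrier[OF assms] by (simp add: mapp_def sum_distrib_left)
  also have "\<dots> = (\<Sum>j<n. \<Sum>i<n. x i * (A $$ (i,j) * y j))"
    by (rule sum.swap)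
  also have "\<dots> = (\<Sum>j<n. \<Sum>i<n. A $$ (j,i) * x i * y j)"
    by (intro sum.cong refl) (use symm_index[OF assms] in \<open>simp add: mult.commute\<close>)
  also have "\<dots> = (\<Sum>i<n. mapp A x i * y i)"
    using symm_carrier[OF assms] by (simp add: mapp_def sum_distrib_right)
  finally show ?thesis .
qed

lemma nsq_nonneg [simp]: "0 \<le> nsq n x"
  by (simp add: nsq_def sum_nonneg)

lemma qform_sandwich:
  assumes "symm n A" "B \<in> carrier_mat n n"
  shows "qform (A * B * A) x = qform B (mapp A x)"
proof -
  note A = symm_carrier[OF assms(1)]
  have "qform (A * B * A) x = (\<Sum>i<n. x i * mapp A (mapp (B * A) x) i)"
    using A assms(2) by (simp add: qform_mapp[of _ n] assoc_mult_mat[of A n n B n A n] mapp_mult[of A n n _ n])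
  also have "\<dots> = (\<Sum>i<n. mapp A x i * mapp (B * A) x i)"
    by (rule mapp_symm_swap[OF assms(1)])
  also have "\<dots> = qform B (mapp A x)"
    using A assms(2) by (simp add: qform_mapp[of B n] mapp_mult[of B n n A n])
  finally show ?thesis .
qed

lemma qform_square:
  assumes "symm n A"
  shows "qform (A * A) x = nsq n (mapp A x)"
  using qform_sandwich[OF assms one_carrier_mat, of x] symm_carrier[OF assms]
  by (simp add: qform_one)

section \<open>Trace inner product\<close>

lemma mip_eq: "A \<in> carrier_mat n n \<Longrightarrow> mip A B = (\<Sum>i<n. \<Sum>j<n. A $$ (i,j) * B $$ (i,j))"
  by (simp add: mip_def)

lemma mip_pairs: "A \<in> carrier_mat n n \<Longrightarrow> mip A B = (\<Sum>p\<in>{..<n}\<times>{..<n}. A $$ p * B $$ p)"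
  by (simp add: mip_def sum.cartesian_product case_prod_unfold)

lemma mip_commute: "A \<in> carrier_mat n n \<Longrightarrow> B \<in> carrier_mat n n \<Longrightarrow> mip A B = mip B A"
  by (simp add: mip_pairs[of _ n] mult.commute)

lemma mip_add_left: "A \<in> carrier_mat n n \<Longrightarrow> B \<in> carrier_mat n n \<Longrightarrow> mip (A + B) C = mip A C + mip B C"
  by (simp add: mip_eq[of _ n] sum.distrib[symmetric] algebra_simps)

lemma mip_minus_left: "A \<in> carrier_mat n n \<Longrightarrow> B \<in> carrier_mat n n \<Longrightarrow> mip (A - B) C = mip A C - mip B C"
  by (simp add: mip_eq[of _ n] minus_carrier_mat sum_subtractf[symmetric] left_diff_distrib)

lemma mip_smult_left: "A \<in> carrier_mat n n \<Longrightarrow> mip (c \<cdot>\<^sub>m A) C = c * mip A C"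
  by (simp add: mip_eq[of _ n] sum_distrib_left algebra_simps)

lemma mip_smult_right: "A \<in> carrier_mat n n \<Longrightarrow> B \<in> carrier_mat n n \<Longrightarrow> mip A (c \<cdot>\<^sub>m B) = c * mip A B"
  by (simp add: mip_eq[of _ n] sum_distrib_left algebra_simps)

lemma mip_one_left: "B \<in> carrier_mat n n \<Longrightarrow> mip (1\<^sub>m n) B = mtr B"
  by (simp add: mip_eq[of _ n] mtr_def if_distrib[of "\<lambda>t. t * _"] cong: if_cong)

text \<open>Cyclicity of the trace, in the form that left multiplication by a symmetric matrix is
  self-adjoint.\<close>

lemma mip_mult_left:
  assumes "symm n A" "B \<in> carrier_mat n n" "C \<in> carrier_mat n n"
  shows "mip (A * B) C = mip B (A * C)"
proof -
  note A = symm_carrier[OF assms(1)]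
  have "mip (A * B) C = (\<Sum>i<n. \<Sum>j<n. \<Sum>k<n. A $$ (i,k) * B $$ (k,j) * C $$ (i,j))"
    using A assms by (simp add: mip_eq[of _ n] mult_index[OF A assms(2)] sum_distrib_right)
  also have "\<dots> = (\<Sum>i<n. \<Sum>k<n. \<Sum>j<n. A $$ (i,k) * B $$ (k,j) * C $$ (i,j))"
    by (intro sum.cong refl sum.swap)
  also have "\<dots> = (\<Sum>k<n. \<Sum>i<n. \<Sum>j<n. A $$ (i,k) * B $$ (k,j) * C $$ (i,j))"
    by (rule sum.swap)
  also have "\<dots> = (\<Sum>k<n. \<Sum>j<n. \<Sum>i<n. A $$ (i,k) * B $$ (k,j) * C $$ (i,j))"
    by (intro sum.cong refl sum.swap)
  also have "\<dots> = mip B (A * C)"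
    using A assms by (auto simp: mip_eq[of _ n] mult_index[OF A assms(3)] sum_distrib_left
        symm_index[OF assms(1)] algebra_simps intro!: sum.cong)
  finally show ?thesis .
qed

lemma mip_transpose: "A \<in> carrier_mat n n \<Longrightarrow> B \<in> carrier_mat n n \<Longrightarrow>
   mip (transpose_mat A) (transpose_mat B) = mip A B"
  by (simp add: mip_eq[of _ n]) (rule sum.swap)

lemma mip_mult_right:
  assumes "symm n A" "B \<in> carrier_mat n n" "C \<in> carrier_mat n n"
  shows "mip (B * A) C = mip B (C * A)"
proof -
  note A = symm_carrier[OF assms(1)]
  have T: "transpose_mat A = A" using assms(1) by (simp add: symm_def)
  have "mip (B * A) C = mip (transpose_mat (B * A)) (transpose_mat C)"
    using A assms by (simp add: mip_transpose[of _ n])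
  also have "\<dots> = mip (A * transpose_mat B) (transpose_mat C)"
    using A assms T by (simp add: transpose_mult[of B n n A n])
  also have "\<dots> = mip (transpose_mat B) (A * transpose_mat C)"
    using assms by (intro mip_mult_left) auto
  also have "\<dots> = mip (transpose_mat B) (transpose_mat (C * A))"
    using A assms T by (simp add: transpose_mult[of C n n A n])
  also have "\<dots> = mip B (C * A)"
    using A assms by (simp add: mip_transpose[of _ n])
  finally show ?thesis .
qed

lemma mip_self_nonneg: "0 \<le> mip A A"
  by (auto simp: mip_def intro!: sum_nonneg)

lemma frob_nonneg [simp]: "0 \<le> frob A"
  by (simp add: frob_def mip_self_nonneg)

lemma frob_sq: "(frob A)\<^sup>2 = mip A A"
  by (simp add: frob_def mip_self_nonneg)

lemma frob_L2: "A \<in> carrier_mat n n \<Longrightarrow> frob A = L2_set (($$) A) ({..<n}\<times>{..<n})"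
  by (simp add: frob_def mip_pairs[of _ n] L2_set_def power2_eq_square)

lemma mip_le_frob:
  assumes "A \<in> carrier_mat n n" "B \<in> carrier_mat n n"
  shows "\<bar>mip A B\<bar> \<le> frob A * frob B"
proof -
  have "\<bar>mip A B\<bar> \<le> (\<Sum>p\<in>{..<n}\<times>{..<n}. \<bar>A $$ p\<bar> * \<bar>B $$ p\<bar>)"
    unfolding mip_pairs[OF assms(1)] abs_mult[symmetric] by (rule sum_abs)
  also have "\<dots> \<le> frob A * frob B"
    using assms by (simp add: frob_L2[of _ n] L2_set_mult_ineq)
  finally show ?thesis .
qed

lemma frob_add: "A \<in> carrier_mat n n \<Longrightarrow> B \<in> carrier_mat n n \<Longrightarrow> frob (A + B) \<le> frob A + frob B"
  by (simp add: frob_L2[of _ n]) (rule order_trans[OF _ L2_set_triangle_ineq],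
     auto simp: L2_set_def intro!: eq_refl arg_cong[where f=sqrt] sum.cong)

lemma frob_smult: "A \<in> carrier_mat n n \<Longrightarrow> frob (c \<cdot>\<^sub>m A) = \<bar>c\<bar> * frob A"
  unfolding frob_def
  by (simp add: mip_smult_left[of _ n] mip_smult_right[of _ n] real_sqrt_mult mult.assoc[symmetric])

lemma frob_minus: 
  assumes "A \<in> carrier_mat n n" "B \<in> carrier_mat n n" shows "frob (A - B) \<le> frob A + frob B"
proof -
  have "A - B = A + (-1) \<cdot>\<^sub>m B" using assms by (auto intro!: eq_matI)
  then show ?thesis using frob_add[of A n "(-1) \<cdot>\<^sub>m B"] frob_smult[of B n "-1"] assms by simp
qed

lemma frob_one: "frob (1\<^sub>m n) = sqrt n"
  by (simp add: frob_def mip_one_left mtr_def)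

lemma frob_mult:
  assumes "A \<in> carrier_mat n n" "B \<in> carrier_mat n n"
  shows "frob (A * B) \<le> frob A * frob B"
proof -
  have "mip (A * B) (A * B) = (\<Sum>i<n. \<Sum>j<n. (\<Sum>k<n. A $$ (i,k) * B $$ (k,j))\<^sup>2)"
    using assms by (simp add: mip_eq[of _ n] mult_index[OF assms] power2_eq_square)
  also have "\<dots> \<le> (\<Sum>i<n. \<Sum>j<n. (\<Sum>k<n. (A $$ (i,k))\<^sup>2) * (\<Sum>k<n. (B $$ (k,j))\<^sup>2))"
    by (intro sum_mono Cauchy_Schwarz_ineq_sum)
  also have "\<dots> = (\<Sum>i<n. \<Sum>k<n. (A $$ (i,k))\<^sup>2) * (\<Sum>j<n. \<Sum>k<n. (B $$ (k,j))\<^sup>2)"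
    by (simp add: sum_product)
  also have "(\<Sum>j<n. \<Sum>k<n. (B $$ (k,j))\<^sup>2) = (\<Sum>k<n. \<Sum>j<n. (B $$ (k,j))\<^sup>2)"
    by (rule sum.swap)
  finally have "mip (A * B) (A * B) \<le> mip A A * mip B B"
    using assms by (simp add: mip_eq[of _ n] power2_eq_square)
  then show ?thesis
    unfolding frob_def real_sqrt_mult[symmetric] by (rule real_sqrt_le_mono)
qed

lemma nsq_mapp_le:
  assumes "A \<in> carrier_mat n n"
  shows "nsq n (mapp A x) \<le> (frob A)\<^sup>2 * nsq n x"
proof -
  have "nsq n (mapp A x) \<le> (\<Sum>i<n. (\<Sum>k<n. (A $$ (i,k))\<^sup>2) * (\<Sum>k<n. (x k)\<^sup>2))"
    using assms unfolding nsq_def by (simp add: mapp_def) (intro sum_mono Cauchy_Schwarz_ineq_sum)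
  also have "\<dots> = (frob A)\<^sup>2 * nsq n x"
    using assms unfolding frob_sq by (simp add: mip_eq[of _ n] nsq_def sum_distrib_right[symmetric] power2_eq_square)
  finally show ?thesis .
qed

text \<open>Cauchy-Schwarz. Here and below the Frobenius norm stands in for the operator norm; the
  matrices \<open>G\<close> of the construction are small even in this larger norm.\<close>

lemma qform_le_frob:
  assumes "A \<in> carrier_mat n n"
  shows "\<bar>qform A x\<bar> \<le> frob A * nsq n x"
proof -
  have "\<bar>qform A x\<bar> = \<bar>\<Sum>i<n. x i * mapp A x i\<bar>"
    using assms by (simp add: qform_mapp[of _ n])
  also have "\<dots> \<le> (\<Sum>i<n. \<bar>x i\<bar> * \<bar>mapp A x i\<bar>)"
    unfolding abs_mult[symmetric] by (rule sum_abs)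
  also have "\<dots> \<le> sqrt (nsq n x) * sqrt (nsq n (mapp A x))"
    using L2_set_mult_ineq[of x "mapp A x" "{..<n}"] by (simp add: L2_set_def nsq_def)
  also have "\<dots> \<le> sqrt (nsq n x) * (frob A * sqrt (nsq n x))"
    using real_sqrt_le_mono[OF nsq_mapp_le[OF assms, of x]]
    by (intro mult_left_mono) (auto simp: real_sqrt_mult)
  finally show ?thesis by (simp add: algebra_simps)
qed

lemma mtr_le_frob:
  assumes "A \<in> carrier_mat n n" "B \<in> carrier_mat n n"
  shows "mtr (A * B) \<le> frob A * frob B"
proof -
  have "mtr (A * B) = mip A (transpose_mat B)"
    using assms by (simp add: mtr_def mip_eq[of _ n] mult_index[OF assms])
  also have "\<dots> \<le> frob A * frob (transpose_mat B)"
    using mip_le_frob[of A n "transpose_mat B"] assms by simp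
  also have "frob (transpose_mat B) = frob B"
    using assms by (simp add: frob_def mip_transpose[of _ n])
  finally show ?thesis .
qed

lemma mtr_add: "A \<in> carrier_mat n n \<Longrightarrow> B \<in> carrier_mat n n \<Longrightarrow> mtr (A + B) = mtr A + mtr B"
  by (simp add: mtr_def sum.distrib)

lemma mtr_smult: "A \<in> carrier_mat n n \<Longrightarrow> mtr (c \<cdot>\<^sub>m A) = c * mtr A"
  by (simp add: mtr_def sum_distrib_left)

lemma mtr_one: "mtr (1\<^sub>m n) = n"
  by (simp add: mtr_def)

section \<open>Positive definite matrices and Schur complements\<close>

lemma pd_symm: "pd n A \<Longrightarrow> symm n A"
  by (simp add: pd_def)

lemma pd_carrier: "pd n A \<Longrightarrow> A \<in> carrier_mat n n"
  by (simp add: pd_def symm_def)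

lemma pd_frobI:
  assumes "symm n A" "frob A < c"
  shows "pd n (c \<cdot>\<^sub>m 1\<^sub>m n + A)"
proof -
  note A = symm_carrier[OF assms(1)]
  have "(c - frob A) * nsq n x \<le> qform (c \<cdot>\<^sub>m 1\<^sub>m n + A) x" for x
    using qform_le_frob[OF A, of x] A
    by (simp add: qform_add[of _ n] qform_smult[of _ n] qform_one algebra_simps)
  then show ?thesis
    using assms unfolding pd_def by (auto intro!: symm_add symm_smult symm_one exI[of _ "c - frob A"])
qed

definition schur :: "nat \<Rightarrow> real mat \<Rightarrow> real mat" where
  "schur n A = Matrix.mat n n (\<lambda>(i,j). A $$ (i,j) - A $$ (i,n) * A $$ (n,j) / A $$ (n,n))"

text \<open>Completes the square in the last variable. The same identity gives the definiteness of
  the complement and, by induction on the dimension, the Gaussian integral.\<close>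

lemma qform_schur:
  assumes A: "symm (Suc n) A" and a: "A $$ (n,n) \<noteq> 0"
  shows "qform A x = A $$ (n,n) * (x n + (\<Sum>j<n. A $$ (n,j) * x j) / A $$ (n,n))\<^sup>2 + qform (schur n A) x"
proof -
  define b where "b = (\<Sum>j<n. A $$ (n,j) * x j)"
  define q where "q = (\<Sum>i<n. \<Sum>j<n. x i * A $$ (i,j) * x j)"
  have b': "(\<Sum>i<n. x i * A $$ (i,n)) = b"
    unfolding b_def by (intro sum.cong refl) (use symm_index[OF A] in \<open>simp add: mult.commute\<close>)
  have "qform A x = q + (\<Sum>i<n. x i * A $$ (i,n)) * x n + (\<Sum>j<n. x n * A $$ (n,j) * x j) + A $$ (n,n) * (x n)\<^sup>2"
    unfolding qform_eq[OF symm_carrier[OF A]] q_def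
    by (simp add: sum.distrib sum_distrib_right power2_eq_square)
  moreover have "x n * b = (\<Sum>i<n. x n * A $$ (n,i) * x i)" by (simp add: b_def sum_distrib_left mult.assoc)
  moreover have "qform (schur n A) x = q - (\<Sum>i<n. x i * A $$ (i,n)) * b / A $$ (n,n)"
    by (simp add: qform_eq[of _ n] schur_def q_def b_def sum_product sum_divide_distrib sum_subtractf[symmetric])
      (intro sum.cong refl, simp add: algebra_simps)
  ultimately have "qform A x = q + 2 * (b * x n) + A $$ (n,n) * (x n)\<^sup>2" "qform (schur n A) x = q - b * b / A $$ (n,n)"
    unfolding b' by (auto simp: mult.commute)
  moreover have "A $$ (n,n) * (x n + b / A $$ (n,n))\<^sup>2 = A $$ (n,n) * (x n)\<^sup>2 + 2 * (b * x n) + b * b / A $$ (n,n)"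
    using a by (simp add: field_simps power2_eq_square)
  ultimately show ?thesis
    unfolding b_def[symmetric] by simp
qed

lemma symm_schur: "symm (Suc n) A \<Longrightarrow> symm n (schur n A)"
  by (rule symmI) (auto simp: schur_def, use symm_index in \<open>metis less_SucI lessI mult.commute\<close>)

lemma qform_unit: "A \<in> carrier_mat n n \<Longrightarrow> k < n \<Longrightarrow> qform A (\<lambda>i. if i = k then 1 else 0) = A $$ (k,k)"
  by (simp add: qform_eq[of _ n] if_distrib[of "\<lambda>t. t * _"] if_distrib[of "\<lambda>t. _ * t"] cong: if_cong)

lemma nsq_unit: "k < n \<Longrightarrow> nsq n (\<lambda>i. if i = k then 1 else 0) = 1"
  by (simp add: nsq_def if_distrib[of "\<lambda>t. t ^ 2"] cong: if_cong)

lemma pd_diag_pos: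
  assumes "pd n A" "k < n" shows "0 < A $$ (k,k)"
  using assms qform_unit[OF pd_carrier[OF assms(1)] assms(2)] nsq_unit[OF assms(2)]
  unfolding pd_def by (metis less_le_trans mult.right_neutral)

lemma qform_cong: "A \<in> carrier_mat n n \<Longrightarrow> (\<And>i. i < n \<Longrightarrow> x i = y i) \<Longrightarrow> qform A x = qform A y"
  by (simp add: qform_eq)

lemma pd_schur:
  assumes "pd (Suc n) A"
  shows "pd n (schur n A)"
proof -
  have s: "symm (Suc n) A" using assms by (rule pd_symm)
  have a: "A $$ (n,n) > 0" using pd_diag_pos[OF assms] by simp
  obtain l where l: "l > 0" "\<And>x. l * nsq (Suc n) x \<le> qform A x" using assms unfolding pd_def by auto
  have "l * nsq n x \<le> qform (schur n A) x" for x
  proof -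
    \<comment> \<open>This last coordinate minimises the form for fixed others: the square in
      \<open>qform_schur\<close> vanishes and only the complement is left.\<close>
    define y where "y = x(n := - (\<Sum>j<n. A $$ (n,j) * x j) / A $$ (n,n))"
    have "(\<Sum>j<n. A $$ (n,j) * y j) = (\<Sum>j<n. A $$ (n,j) * x j)"
      by (intro sum.cong) (auto simp: y_def)
    then have "qform A y = qform (schur n A) y"
      using qform_schur[OF s, of y] a by (simp add: y_def)
    also have "\<dots> = qform (schur n A) x"
      by (rule qform_cong[OF symm_carrier[OF symm_schur[OF s]]]) (simp add: y_def)
    finally have "qform A y = qform (schur n A) x" .
    moreover have "nsq n x = nsq n y" unfolding nsq_def by (intro sum.cong) (auto simp: y_def)
    then have "nsq n x \<le> nsq (Suc n) y" by (simp add: nsq_def)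
    ultimately show ?thesis using l(2)[of y] mult_left_mono[of "nsq n x" "nsq (Suc n) y" l] l(1) by linarith
  qed
  then show ?thesis unfolding pd_def using symm_schur[OF s] l(1) by auto
qed

lemma det_schur:
  assumes A: "symm (Suc n) A" and a: "A $$ (n,n) \<noteq> 0"
  shows "Determinant.det A = A $$ (n,n) * Determinant.det (schur n A)"
proof -
  \<comment> \<open>Column operations that clear the last row to the left of the pivot.
    \<open>U\<close> is unit triangular, so they leave the determinant alone.\<close>
  define U where "U = Matrix.mat (Suc n) (Suc n) (\<lambda>(i,j). if i = j then 1 else if i = n then - A $$ (n,j) / A $$ (n,n) else (0::real))"
  define S where "S = four_block_mat (schur n A) (Matrix.mat n 1 (\<lambda>(i,j). A $$ (i,n))) (0\<^sub>m 1 n) (Matrix.mat 1 1 (\<lambda>_. A $$ (n,n)))"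
  note Ac = symm_carrier[OF A]
  have Uc: "U \<in> carrier_mat (Suc n) (Suc n)" by (simp add: U_def)
  have Sc: "S \<in> carrier_mat (Suc n) (Suc n)" by (auto simp: S_def schur_def)
  have "A * U = S"
  proof (rule eq_matI)
    fix i j assume "i < dim_row S" "j < dim_col S"
    then have ij: "i < Suc n" "j < Suc n" using Sc by auto
    have "(A * U) $$ (i,j) = (\<Sum>l<Suc n. A $$ (i,l) * U $$ (l,j))"
      by (rule mult_index[OF Ac Uc ij])
    also have "\<dots> = (\<Sum>l<n. A $$ (i,l) * (if l = j then 1 else 0)) + A $$ (i,n) * U $$ (n,j)"
      using ij by (auto simp: U_def intro!: sum.cong)
    also have "\<dots> = S $$ (i,j)"
      using ij a by (auto simp: S_def U_def schur_def if_distrib[of "\<lambda>t. _ * t"] less_Suc_eq cong: if_cong)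
    finally show "(A * U) $$ (i,j) = S $$ (i,j)" .
  qed (use Ac Uc Sc in auto)
  then have "Determinant.det A * Determinant.det U = Determinant.det S"
    using det_mult[OF Ac Uc] by simp
  moreover have "Determinant.det U = 1"
  proof -
    have "diag_mat U = map (\<lambda>i. 1) [0..<Suc n]"
      unfolding diag_mat_def by (rule map_cong) (auto simp: U_def)
    then have "prod_list (diag_mat U) = 1"
      by (simp add: map_replicate_const)
    then show ?thesis by (subst det_lower_triangular[OF _ Uc]) (auto simp: U_def)
  qed
  moreover have "Determinant.det S = Determinant.det (schur n A) * A $$ (n,n)"
    unfolding S_def by (subst det_four_block_mat_lower_left_zero[of _ n _ 1]) (auto simp: schur_def det_single)
  ultimately show ?thesis by simp
qed

text \<open>Hadamard's inequality. Passing to the Schur complement can only lower the diagonal, and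
  the pivot splits off as a factor of the determinant; positivity comes out of the same
  induction.\<close>

lemma pd_det_hadamard:
  assumes "pd n A"
  shows "0 < Determinant.det A \<and> Determinant.det A \<le> (\<Prod>i<n. A $$ (i,i))"
  using assms
proof (induction n arbitrary: A)
  case 0
  then show ?case using det_dim_zero[OF pd_carrier[OF 0]] by simp
next
  case (Suc n)
  note s = pd_symm[OF Suc.prems]
  have a: "A $$ (n,n) > 0" using pd_diag_pos[OF Suc.prems] by simp
  have IH: "0 < Determinant.det (schur n A)" "Determinant.det (schur n A) \<le> (\<Prod>i<n. schur n A $$ (i,i))"
    using Suc.IH[OF pd_schur[OF Suc.prems]] by auto
  have "(\<Prod>i<n. schur n A $$ (i,i)) \<le> (\<Prod>i<n. A $$ (i,i))"
  proof (rule prod_mono, safe)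
    fix i assume i: "i < n"
    show "0 \<le> schur n A $$ (i,i)" using pd_diag_pos[OF pd_schur[OF Suc.prems] i] by simp
    have "A $$ (i,n) * A $$ (n,i) / A $$ (n,n) = (A $$ (i,n))\<^sup>2 / A $$ (n,n)"
      using symm_index[OF s, of n i] i by (simp add: power2_eq_square)
    then show "schur n A $$ (i,i) \<le> A $$ (i,i)" using i a by (simp add: schur_def)
  qed
  then have "Determinant.det (schur n A) \<le> (\<Prod>i<n. A $$ (i,i))" using IH by simp
  then show ?case
    using a IH det_schur[OF s] mult_left_mono[of "Determinant.det (schur n A)" "\<Prod>i<n. A $$ (i,i)" "A $$ (n,n)"]
    by (simp add: mult.commute)
qed

lemma pd_det_pos: "pd n A \<Longrightarrow> 0 < Determinant.det A"
  using pd_det_hadamard by blast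

text \<open>\<open>1 + x \<le> exp x\<close> on the diagonal entries: Hadamard replaces the
  eigenvalue proof that log det is at most the trace.\<close>

lemma pd_det_le_exp:
  assumes "pd n (1\<^sub>m n + F)" "F \<in> carrier_mat n n"
  shows "Determinant.det (1\<^sub>m n + F) \<le> exp (mtr F)"
proof -
  have "Determinant.det (1\<^sub>m n + F) \<le> (\<Prod>i<n. (1\<^sub>m n + F) $$ (i,i))"
    using pd_det_hadamard[OF assms(1)] by simp
  also have "\<dots> \<le> (\<Prod>i<n. exp (F $$ (i,i)))"
  proof (rule prod_mono, safe)
    fix i assume i: "i < n"
    show "0 \<le> (1\<^sub>m n + F) $$ (i,i)" using pd_diag_pos[OF assms(1) i] by simp
    show "(1\<^sub>m n + F) $$ (i,i) \<le> exp (F $$ (i,i))" using i assms(2) by simp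
  qed
  also have "\<dots> = exp (mtr F)" using assms(2) by (simp add: mtr_def exp_sum)
  finally show ?thesis .
qed

section \<open>Inverse matrices\<close>

text \<open>The same term as inside \<open>gauss_density\<close>, so that densities can be rewritten
  with it; a genuine inverse wherever the determinant is nonzero.\<close>

definition minv :: "real mat \<Rightarrow> real mat" where
  "minv A = the (mat_inverse A)"

lemma inverse_unique_mat:
  fixes A B C :: "real mat"
  assumes "A \<in> carrier_mat n n" "B \<in> carrier_mat n n" "C \<in> carrier_mat n n" "B * A = 1\<^sub>m n" "A * C = 1\<^sub>m n"
  shows "B = C"
  using assms by (metis assoc_mult_mat left_mult_one_mat right_mult_one_mat)

lemma minv_det:
  assumes A: "A \<in> carrier_mat n n" and "Determinant.det A \<noteq> 0"
  shows "minv A \<in> carrier_mat n n" "A * minv A = 1\<^sub>m n" "minv A * A = 1\<^sub>m n"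
proof -
  have "mat_inverse A \<noteq> None"
    using mat_inverse(1)[OF A, where b=undefined] det_non_zero_imp_unit[OF A assms(2), where b=undefined] by metis
  then have "mat_inverse A = Some (minv A)" by (simp add: minv_def)
  from mat_inverse(2)[OF A this] show "minv A \<in> carrier_mat n n" "A * minv A = 1\<^sub>m n" "minv A * A = 1\<^sub>m n"
    by auto
qed

lemma minv_pd:
  assumes "pd n A"
  shows "minv A \<in> carrier_mat n n" "A * minv A = 1\<^sub>m n" "minv A * A = 1\<^sub>m n"
  using minv_det[OF pd_carrier[OF assms]] pd_det_pos[OF assms] by auto

lemma minv_eqI:
  assumes "A \<in> carrier_mat n n" "B \<in> carrier_mat n n" "A * B = 1\<^sub>m n"
  shows "minv A = B"
proof -
  have "Determinant.det A * Determinant.det B = 1"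
    using det_mult[OF assms(1,2)] assms(3) by simp
  then have "Determinant.det A \<noteq> 0" by auto
  then show ?thesis
    using minv_det[OF assms(1)] inverse_unique_mat[OF assms(1) _ assms(2) _ assms(3)] by blast
qed

lemma minv_pd_symm:
  assumes "pd n A" shows "symm n (minv A)"
proof -
  note A = pd_carrier[OF assms] and I = minv_pd[OF assms]
  have T: "transpose_mat A = A" using pd_symm[OF assms] by (simp add: symm_def)
  have "transpose_mat (minv A) * A = 1\<^sub>m n"
    using transpose_mult[OF A I(1)] unfolding I(2) T by simp
  then have "transpose_mat (minv A) = minv A"
    using I(1) by (intro inverse_unique_mat[OF A _ I(1) _ I(2)]) auto
  then show ?thesis using I(1) by (simp add: symm_def)
qed

section \<open>Gaussian integrals and moments on \<open>Rn\<close>\<close>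

interpretation lb: product_sigma_finite "\<lambda>_ :: nat. lborel :: real measure"
  by standard

lemma Rn_Suc: "Rn (Suc n) = PiM (insert n {..<n}) (\<lambda>_. lborel)"
  by (simp add: Rn_def lessThan_Suc)

lemma Rn_coord [measurable]: "i < n \<Longrightarrow> (\<lambda>x. x i) \<in> borel_measurable (Rn n)"
  unfolding Rn_def by measurable

lemma qform_measurable:
  assumes "A \<in> carrier_mat n n"
  shows "qform A \<in> borel_measurable (Rn n)"
proof -
  have "(\<lambda>x. \<Sum>i<n. \<Sum>j<n. x i * A $$ (i, j) * x j) \<in> borel_measurable (Rn n)"
    by measurable
  then show ?thesis using qform_eq[OF assms] by presburger
qed



lemma nsq_measurable [measurable]: "nsq n \<in> borel_measurable (Rn n)"
  unfolding nsq_def[abs_def] by measurable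

lemma sigma_finite_Rn: "sigma_finite_measure (Rn n)"
  unfolding Rn_def by (rule lb.sigma_finite) simp

lemma exp_quadratic_normal_density:
  fixes a b c y :: real
  assumes "a > 0"
  shows "exp (- (a * y\<^sup>2 + 2 * b * y + c) / 2) =
     exp ((b\<^sup>2 / a - c) / 2) * sqrt (2 * pi / a) * normal_density (- b / a) (1 / sqrt a) y"
proof -
  have "- (a * y\<^sup>2 + 2 * b * y + c) / 2 = (b\<^sup>2 / a - c) / 2 + - (y - - b / a)\<^sup>2 / (2 * (1 / sqrt a)\<^sup>2)"
    using assms by (simp add: field_simps power2_eq_square)
  then have "exp (- (a * y\<^sup>2 + 2 * b * y + c) / 2) =
      exp ((b\<^sup>2 / a - c) / 2) * exp (- (y - - b / a)\<^sup>2 / (2 * (1 / sqrt a)\<^sup>2))"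
    by (simp only: exp_add)
  moreover have "sqrt (2 * pi / a) * (1 / sqrt (2 * pi * (1 / sqrt a)\<^sup>2)) = 1"
    using assms by (simp add: power_divide)
  ultimately have "exp (- (a * y\<^sup>2 + 2 * b * y + c) / 2) = exp ((b\<^sup>2 / a - c) / 2) *
      ((sqrt (2 * pi / a) * (1 / sqrt (2 * pi * (1 / sqrt a)\<^sup>2))) * exp (- (y - - b / a)\<^sup>2 / (2 * (1 / sqrt a)\<^sup>2)))"
    by (simp only: mult_1_left)
  then show ?thesis
    unfolding normal_density_def by (simp only: mult.assoc)
qed

text \<open>\<open>(b + a * y) * e y\<close> is minus the derivative of \<open>e\<close>, so these
  are the two integrations by parts in one variable. They are read off from normal moments after
  completing the square.\<close>

lemma exp_quadratic_moments:
  fixes a b c :: real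
  assumes "a > 0"
  defines "e \<equiv> \<lambda>y. exp (- (a * y\<^sup>2 + 2 * b * y + c) / 2)"
  shows "(\<integral>y. (b + a * y) * e y \<partial>lborel) = 0"
    and "(\<integral>y. (b + a * y) * y * e y \<partial>lborel) = (\<integral>y. e y \<partial>lborel)"
proof -
  define K where "K = exp ((b\<^sup>2 / a - c) / 2) * sqrt (2 * pi / a)"
  define \<mu> where "\<mu> = - b / a"
  define d where "d = normal_density \<mu> (1 / sqrt a)"
  have e: "e = (\<lambda>y. K * d y)"
    unfolding e_def K_def d_def \<mu>_def using exp_quadratic_normal_density[OF assms(1)] by auto
  have s: "1 / sqrt a > 0" using assms by simp
  have b: "b = - a * \<mu>" using assms by (simp add: \<mu>_def)
  have d1: "has_bochner_integral lborel (\<lambda>y. d y * (y - \<mu>)) 0"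
    using normal_moment_odd[OF s, of \<mu> 0] by (simp add: d_def)
  have d2: "has_bochner_integral lborel (\<lambda>y. d y * (y - \<mu>)\<^sup>2) (1 / a)"
    using normal_moment_even[OF s, of \<mu> 1] assms by (simp add: d_def power_divide)
  have "has_bochner_integral lborel (\<lambda>y. (a * K) * (d y * (y - \<mu>))) ((a * K) * 0)"
    by (intro has_bochner_integral_mult_right d1)
  moreover have "(\<lambda>y. (a * K) * (d y * (y - \<mu>))) = (\<lambda>y. (b + a * y) * e y)"
    by (auto simp: e b algebra_simps)
  ultimately show "(\<integral>y. (b + a * y) * e y \<partial>lborel) = 0"
    by (metis has_bochner_integral_integral_eq mult_zero_right)
  have "has_bochner_integral lborel (\<lambda>y. (a * K) * (d y * (y - \<mu>)\<^sup>2) + (a * K * \<mu>) * (d y * (y - \<mu>)))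
     ((a * K) * (1 / a) + (a * K * \<mu>) * 0)"
    by (intro has_bochner_integral_add has_bochner_integral_mult_right d1 d2)
  moreover have "(\<lambda>y. (a * K) * (d y * (y - \<mu>)\<^sup>2) + (a * K * \<mu>) * (d y * (y - \<mu>))) = (\<lambda>y. (b + a * y) * y * e y)"
    by (auto simp: e b algebra_simps power2_eq_square)
  ultimately have "(\<integral>y. (b + a * y) * y * e y \<partial>lborel) = K"
    using assms by (simp add: has_bochner_integral_integral_eq)
  moreover have "(\<integral>y. e y \<partial>lborel) = K"
    unfolding e d_def using integral_normal_density[OF s] by simp
  ultimately show "(\<integral>y. (b + a * y) * y * e y \<partial>lborel) = (\<integral>y. e y \<partial>lborel)" by simp
qed

lemma nn_integral_exp_square:
  fixes a b :: real
  assumes "a > 0"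
  shows "(\<integral>\<^sup>+y. ennreal (exp (- (a * (y + b)\<^sup>2) / 2)) \<partial>lborel) = ennreal (sqrt (2 * pi / a))"
proof -
  have s: "1 / sqrt a > 0" using assms by simp
  have "exp (- (a * (y + b)\<^sup>2) / 2) = sqrt (2 * pi / a) * normal_density (- b) (1 / sqrt a) y" for y
    using exp_quadratic_normal_density[OF assms, of y "a * b" "a * b\<^sup>2"] assms
    by (simp add: algebra_simps power2_eq_square)
  moreover have "(\<integral>\<^sup>+y. ennreal (normal_density (- b) (1 / sqrt a) y) \<partial>lborel) = 1"
    using nn_integral_eq_integral[OF integrable_normal_density[OF s]] integral_normal_density[OF s]
    by simp
  ultimately show ?thesis
    using assms by (simp add: ennreal_mult nn_integral_cmult)
qed

text \<open>Integrating out the last coordinate leaves the Gaussian of the Schur complement, whose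
  determinant is the old one divided by the pivot. Nonnegative integrals make integrability a
  consequence instead of a premise.\<close>

lemma nn_integral_gaussian:
  assumes "pd n A"
  shows "(\<integral>\<^sup>+x. ennreal (exp (- qform A x / 2)) \<partial>Rn n) = ennreal (sqrt ((2 * pi) ^ n / Determinant.det A))"
  using assms
proof (induction n arbitrary: A)
  case 0
  then show ?case using det_dim_zero[OF pd_carrier[OF 0]] pd_carrier[OF 0]
    by (simp add: Rn_def qform_def space_PiM_empty emeasure_PiM_empty)
next
  case (Suc n)
  note s = pd_symm[OF Suc.prems] and c = pd_carrier[OF Suc.prems]
  define a where "a = A $$ (n,n)"
  have a: "a > 0" using pd_diag_pos[OF Suc.prems] by (simp add: a_def)
  define S where "S = schur n A"
  have S: "pd n S" unfolding S_def by (rule pd_schur[OF Suc.prems])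
  define \<beta> where "\<beta> x = (\<Sum>j<n. A $$ (n,j) * x j) / a" for x
  have q: "qform A (x(n := y)) = a * (y + \<beta> x)\<^sup>2 + qform S x" for x y
  proof -
    have "qform S (x(n := y)) = qform S x"
      by (rule qform_cong[OF pd_carrier[OF S]]) auto
    then show ?thesis
      using qform_schur[OF s, of "x(n := y)"] a by (simp add: a_def \<beta>_def S_def)
  qed
  have m[measurable]: "qform A \<in> borel_measurable (Pi\<^sub>M (insert n {..<n}) (\<lambda>_. lborel))"
    using qform_measurable[OF c] unfolding Rn_Suc .
  have mS[measurable]: "qform S \<in> borel_measurable (Rn n)"
    using qform_measurable[OF pd_carrier[OF S]] .
  have "(\<integral>\<^sup>+x. ennreal (exp (- qform A x / 2)) \<partial>Rn (Suc n)) =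
    (\<integral>\<^sup>+x. (\<integral>\<^sup>+y. ennreal (exp (- qform A (x(n := y)) / 2)) \<partial>lborel) \<partial>Rn n)"
    unfolding Rn_Suc by (subst lb.product_nn_integral_insert) (auto simp: Rn_def)
  also have "\<dots> = (\<integral>\<^sup>+x. ennreal (sqrt (2 * pi / a)) * ennreal (exp (- qform S x / 2)) \<partial>Rn n)"
  proof (rule nn_integral_cong)
    fix x
    have "(\<integral>\<^sup>+y. ennreal (exp (- qform A (x(n := y)) / 2)) \<partial>lborel) =
       (\<integral>\<^sup>+y. ennreal (exp (- qform S x / 2)) * ennreal (exp (- (a * (y + \<beta> x)\<^sup>2) / 2)) \<partial>lborel)"
      unfolding q by (intro nn_integral_cong)
        (simp add: ennreal_mult[symmetric] exp_add[symmetric] add_divide_distrib)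
    also have "\<dots> = ennreal (exp (- qform S x / 2)) * ennreal (sqrt (2 * pi / a))"
    proof -
      have *: "(\<lambda>y. ennreal (exp (- (a * (y + \<beta> x)\<^sup>2) / 2))) \<in> borel_measurable lborel" by simp
      show ?thesis unfolding nn_integral_cmult[OF *] nn_integral_exp_square[OF a] ..
    qed
    finally show "(\<integral>\<^sup>+y. ennreal (exp (- qform A (x(n := y)) / 2)) \<partial>lborel) =
       ennreal (sqrt (2 * pi / a)) * ennreal (exp (- qform S x / 2))" by (simp add: mult.commute)
  qed
  also have "\<dots> = ennreal (sqrt (2 * pi / a)) * ennreal (sqrt ((2 * pi) ^ n / Determinant.det S))"
    by (subst nn_integral_cmult) (measurable, simp only: Suc.IH[OF S])
  also have "\<dots> = ennreal (sqrt ((2 * pi) ^ Suc n / Determinant.det A))"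
    using a pd_det_pos[OF S] det_schur[OF s]
    by (simp add: ennreal_mult[symmetric] real_sqrt_mult[symmetric] a_def S_def)
  finally show ?case .
qed

definition gaussZ :: "nat \<Rightarrow> real mat \<Rightarrow> real" where
  "gaussZ n A = sqrt ((2 * pi) ^ n / Determinant.det A)"

lemma gaussian_integral:
  assumes "pd n A"
  shows "integrable (Rn n) (\<lambda>x. exp (- qform A x / 2))"
    and "(\<integral>x. exp (- qform A x / 2) \<partial>Rn n) = gaussZ n A"
proof -
  have [measurable]: "qform A \<in> borel_measurable (Rn n)"
    using qform_measurable[OF pd_carrier[OF assms]] .
  have "has_bochner_integral (Rn n) (\<lambda>x. exp (- qform A x / 2)) (gaussZ n A)"
    using pd_det_pos[OF assms] unfolding gaussZ_def
    by (intro has_bochner_integral_nn_integral nn_integral_gaussian[OF assms]) auto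
  then show "integrable (Rn n) (\<lambda>x. exp (- qform A x / 2))" "(\<integral>x. exp (- qform A x / 2) \<partial>Rn n) = gaussZ n A"
    by (auto simp: has_bochner_integral_iff)
qed

lemma pd_minus_scalar:
  assumes "pd n A"
  obtains l where "l > 0" "pd n (A - l \<cdot>\<^sub>m 1\<^sub>m n)"
proof -
  obtain l where l: "l > 0" "\<And>x. l * nsq n x \<le> qform A x" using assms unfolding pd_def by auto
  have "l/2 * nsq n x \<le> qform (A - (l/2) \<cdot>\<^sub>m 1\<^sub>m n) x" for x
    using l(2)[of x] pd_carrier[OF assms] by (simp add: qform_minus[of _ n] qform_smult[of _ n] qform_one)
  then have "pd n (A - (l/2) \<cdot>\<^sub>m 1\<^sub>m n)"
    unfolding pd_def using l(1) pd_symm[OF assms] by (auto intro!: symm_minus symm_smult symm_one exI[of _ "l/2"])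
  with l(1) show ?thesis by (intro that[of "l/2"]) auto
qed

text \<open>Shifting the form down by \<open>l\<close> leaves an integrable Gaussian and frees a
  factor \<open>exp (l * nsq n x / 2)\<close>, which absorbs the quadratic growth of
  \<open>f\<close>.\<close>

lemma gaussian_dominated_integrable:
  assumes "pd n A" and [measurable]: "f \<in> borel_measurable (Rn n)" 
    and f: "\<And>x. \<bar>f x\<bar> \<le> 1 + nsq n x"
  shows "integrable (Rn n) (\<lambda>x. f x * exp (- qform A x / 2))"
proof -
  note c = pd_carrier[OF assms(1)]
  note [measurable] = qform_measurable[OF c]
  obtain l where l: "l > 0" "pd n (A - l \<cdot>\<^sub>m 1\<^sub>m n)" using pd_minus_scalar[OF assms(1)] .
  have q: "exp (- qform (A - l \<cdot>\<^sub>m 1\<^sub>m n) x / 2) = exp (- qform A x / 2) * exp (l * nsq n x / 2)" for x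
    using c by (simp add: qform_minus[of _ n] qform_smult[of _ n] qform_one exp_add[symmetric] diff_divide_distrib)
  have *: "1 + t \<le> (1 + 2 / l) * exp (l * t / 2)" if "t \<ge> 0" for t
  proof -
    have e: "1 + l * t / 2 \<le> exp (l * t / 2)" by (rule exp_ge_add_one_self)
    have "1 \<le> exp (l * t / 2)" using that l by simp
    moreover have "t \<le> 2 / l * exp (l * t / 2)" using e l by (simp add: field_simps)
    ultimately show ?thesis unfolding distrib_right by linarith
  qed
  show ?thesis
  proof (rule Bochner_Integration.integrable_bound)
    show "integrable (Rn n) (\<lambda>x. (1 + 2 / l) * exp (- qform (A - l \<cdot>\<^sub>m 1\<^sub>m n) x / 2))"
      by (intro integrable_mult_right gaussian_integral l)
    show "AE x in Rn n. norm (f x * exp (- qform A x / 2)) \<le> norm ((1 + 2 / l) * exp (- qform (A - l \<cdot>\<^sub>m 1\<^sub>m n) x / 2))"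
    proof (rule AE_I2)
      fix x
      have "\<bar>f x\<bar> * exp (- qform A x / 2) \<le> ((1 + 2 / l) * exp (l * nsq n x / 2)) * exp (- qform A x / 2)"
        using f[of x] *[of "nsq n x"] by (intro mult_right_mono) auto
      then show "norm (f x * exp (- qform A x / 2)) \<le> norm ((1 + 2 / l) * exp (- qform (A - l \<cdot>\<^sub>m 1\<^sub>m n) x / 2))"
        unfolding q using l(1) by (simp add: abs_mult algebra_simps)
    qed
  qed measurable
qed

lemma coord_sq_le_nsq: "i < n \<Longrightarrow> (x i)\<^sup>2 \<le> nsq n x"
  unfolding nsq_def by (rule member_le_sum) auto

lemma gaussian_moment_integrable:
  assumes "pd n A" "i < n" "j < n"
  shows "integrable (Rn n) (\<lambda>x. x i * x j * exp (- qform A x / 2))"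
    and "integrable (Rn n) (\<lambda>x. x i * exp (- qform A x / 2))"
proof -
  note [measurable] = Rn_coord[OF assms(2)] Rn_coord[OF assms(3)]
  have "\<bar>x i * x j\<bar> \<le> 1 + nsq n x" for x
  proof -
    have "2 * \<bar>x i * x j\<bar> \<le> (x i)\<^sup>2 + (x j)\<^sup>2"
      using sum_squares_bound[of "\<bar>x i\<bar>" "\<bar>x j\<bar>"] by (simp add: abs_mult mult.assoc)
    then show ?thesis using coord_sq_le_nsq[OF assms(2), of x] coord_sq_le_nsq[OF assms(3), of x] by linarith
  qed
  then show "integrable (Rn n) (\<lambda>x. x i * x j * exp (- qform A x / 2))"
    by (intro gaussian_dominated_integrable[OF assms(1)]) auto
  have "\<bar>x i\<bar> \<le> 1 + nsq n x" for x
  proof -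
    have "2 * \<bar>x i\<bar> \<le> 1 + (x i)\<^sup>2"
      using sum_squares_bound[of 1 "\<bar>x i\<bar>"] by simp
    then show ?thesis using coord_sq_le_nsq[OF assms(2), of x] by simp
  qed
  then show "integrable (Rn n) (\<lambda>x. x i * exp (- qform A x / 2))"
    by (intro gaussian_dominated_integrable[OF assms(1)]) auto
qed

lemma gaussian_mapp_integrable:
  assumes A: "pd n A"
  shows "integrable (Rn n) (\<lambda>x. mapp A x i * exp (- qform A x / 2))"
    and "j < n \<Longrightarrow> integrable (Rn n) (\<lambda>x. mapp A x i * x j * exp (- qform A x / 2))"
proof -
  note c = pd_carrier[OF A]
  have "integrable (Rn n) (\<lambda>x. \<Sum>k<n. A $$ (i,k) * (x k * exp (- qform A x / 2)))"
    by (intro Bochner_Integration.integrable_sum integrable_mult_right gaussian_moment_integrable[OF A]) auto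
  then show "integrable (Rn n) (\<lambda>x. mapp A x i * exp (- qform A x / 2))"
    using c by (simp add: mapp_def sum_distrib_right mult.assoc)
  assume "j < n"
  then have "integrable (Rn n) (\<lambda>x. \<Sum>k<n. A $$ (i,k) * (x k * x j * exp (- qform A x / 2)))"
    by (intro Bochner_Integration.integrable_sum integrable_mult_right gaussian_moment_integrable[OF A]) auto
  then show "integrable (Rn n) (\<lambda>x. mapp A x i * x j * exp (- qform A x / 2))"
    using c by (simp add: mapp_def sum_distrib_right mult.assoc)
qed

lemma qform_upd:
  assumes "symm n A" "i < n"
  shows "mapp A (x(i := y)) i = mapp A (x(i := 0)) i + A $$ (i,i) * y"
    and "qform A (x(i := y)) = A $$ (i,i) * y\<^sup>2 + 2 * mapp A (x(i := 0)) i * y + qform A (x(i := 0))"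
proof -
  note c = symm_carrier[OF assms(1)]
  define z where "z = x(i := 0)"
  define u where "u = (\<lambda>k. if k = i then y else 0)"
  have v: "x(i := y) = (\<lambda>k. z k + u k)" by (auto simp: z_def u_def)
  have u: "mapp A u k = A $$ (k,i) * y" for k
    using c assms(2) by (simp add: mapp_def u_def if_distrib[of "\<lambda>t. _ * t"] cong: if_cong)
  have m: "mapp A (x(i := y)) k = mapp A z k + A $$ (k,i) * y" for k
    unfolding v u[symmetric] by (simp add: mapp_def sum.distrib algebra_simps)
  show "mapp A (x(i := y)) i = mapp A (x(i := 0)) i + A $$ (i,i) * y"
    using m by (simp add: z_def)
  have "qform A (x(i := y)) = (\<Sum>k<n. (z k + u k) * (mapp A z k + mapp A u k))"
    unfolding qform_mapp[OF c] m u by (simp add: v)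
  also have "\<dots> = qform A z + (\<Sum>k<n. z k * mapp A u k) + (\<Sum>k<n. u k * mapp A z k) + (\<Sum>k<n. u k * mapp A u k)"
    unfolding qform_mapp[OF c] by (simp add: sum.distrib algebra_simps)
  also have "(\<Sum>k<n. z k * mapp A u k) = (\<Sum>k<n. u k * mapp A z k)"
    by (rule trans[OF mapp_symm_swap[OF assms(1)]]) (simp add: mult.commute)
  also have "(\<Sum>k<n. u k * mapp A z k) = y * mapp A z i"
    using assms(2) by (simp add: u_def if_distrib[of "\<lambda>t. t * _"] cong: if_cong)
  also have "(\<Sum>k<n. u k * mapp A u k) = A $$ (i,i) * y\<^sup>2"
    unfolding u using assms(2) by (simp add: u_def if_distrib[of "\<lambda>t. t * _"] power2_eq_square cong: if_cong)
  finally show "qform A (x(i := y)) = A $$ (i,i) * y\<^sup>2 + 2 * mapp A (x(i := 0)) i * y + qform A (x(i := 0))"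
    by (simp only: z_def ac_simps)
qed

text \<open>Stein's identity: \<open>mapp A x i\<close> times the exponential is minus its
  derivative in coordinate \<open>i\<close>. Integrating that coordinate first leaves zero or,
  against \<open>x i\<close>, the normalisation.\<close>

lemma gaussian_parts:
  assumes A: "pd n A" and i: "i < n"
  shows "j < n \<Longrightarrow> (\<integral>x. mapp A x i * x j * exp (- qform A x / 2) \<partial>Rn n) = (if i = j then gaussZ n A else 0)"
    and "(\<integral>x. mapp A x i * exp (- qform A x / 2) \<partial>Rn n) = 0"
proof -
  note c = pd_carrier[OF A] and s = pd_symm[OF A]
  have I: "insert i ({..<n} - {i}) = {..<n}" using i by auto
  have a: "A $$ (i,i) > 0" by (rule pd_diag_pos[OF A i])
  define m0 q0 where "m0 x = mapp A (x(i := 0)) i" and "q0 x = qform A (x(i := 0))" for x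
  have upd: "mapp A (x(i := y)) i = m0 x + A $$ (i,i) * y"
     "qform A (x(i := y)) = A $$ (i,i) * y\<^sup>2 + 2 * m0 x * y + q0 x" for x y
    unfolding m0_def q0_def by (rule qform_upd[OF s i])+
  have ins: "(\<integral>x. f x \<partial>Rn n) = (\<integral>x. (\<integral>y. f (x(i := y)) \<partial>lborel) \<partial>PiM ({..<n} - {i}) (\<lambda>_. lborel))"
    if "integrable (Rn n) f" for f :: "(nat \<Rightarrow> real) \<Rightarrow> real"
    using lb.product_integral_insert[of "{..<n} - {i}" i f] that unfolding I Rn_def by simp
  let ?e = "\<lambda>x. exp (- qform A x / 2)"
  note int1 = gaussian_mapp_integrable(1)[OF A, of i] and int2 = gaussian_mapp_integrable(2)[OF A, of _ i]
  show "(\<integral>x. mapp A x i * ?e x \<partial>Rn n) = 0"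
    unfolding ins[OF int1] upd exp_quadratic_moments(1)[OF a] by simp
  assume j: "j < n"
  show "(\<integral>x. mapp A x i * x j * ?e x \<partial>Rn n) = (if i = j then gaussZ n A else 0)"
  proof (cases "i = j")
    case True
    have "(\<integral>x. mapp A x i * x j * ?e x \<partial>Rn n) =
      (\<integral>x. (\<integral>y. ?e (x(i := y)) \<partial>lborel) \<partial>PiM ({..<n} - {i}) (\<lambda>_. lborel))"
      unfolding ins[OF int2[OF j]] upd
      unfolding True[symmetric] fun_upd_same exp_quadratic_moments(2)[OF a] ..
    also have "\<dots> = gaussZ n A"
      unfolding gaussian_integral(2)[OF A, symmetric] by (rule ins[symmetric, OF gaussian_integral(1)[OF A]])
    finally show ?thesis using True by simp
  next
    case False
    have f: "(x(i := y)) j = x j" for x :: "nat \<Rightarrow> real" and y using False by simp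
    have key: "(\<integral>y. (m0 x + A $$ (i,i) * y) * x j *
        exp (- (A $$ (i,i) * y\<^sup>2 + 2 * m0 x * y + q0 x) / 2) \<partial>lborel) =
      x j * (\<integral>y. (m0 x + A $$ (i,i) * y) *
        exp (- (A $$ (i,i) * y\<^sup>2 + 2 * m0 x * y + q0 x) / 2) \<partial>lborel)" for x
      unfolding integral_mult_right_zero[symmetric] by (simp add: ac_simps)
    show ?thesis
      unfolding ins[OF int2[OF j]] upd f key exp_quadratic_moments(1)[OF a]
      using False by simp
  qed
qed

text \<open>Writing \<open>x i\<close> as row \<open>i\<close> of the inverse applied to
  \<open>mapp A x\<close> reduces the moments to \<open>gaussian_parts\<close>; the covariance is
  thus the inverse of the form.\<close>

lemma gaussian_moments:
  assumes A: "pd n A" and B: "B \<in> carrier_mat n n" "B * A = 1\<^sub>m n" and i: "i < n"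
  shows "j < n \<Longrightarrow> (\<integral>x. x i * x j * exp (- qform A x / 2) \<partial>Rn n) = gaussZ n A * B $$ (i,j)"
    and "(\<integral>x. x i * exp (- qform A x / 2) \<partial>Rn n) = 0"
proof -
  note c = pd_carrier[OF A]
  let ?e = "\<lambda>x. exp (- qform A x / 2)"
  have x: "x i = (\<Sum>k<n. B $$ (i,k) * mapp A x k)" for x
    using mapp_mult[OF B(1) c i, of x] i by (simp add: B(2) mapp_one mapp_eq[OF B(1)])
  note int1 = gaussian_mapp_integrable(1)[OF A] and int2 = gaussian_mapp_integrable(2)[OF A]
  have "(\<integral>x. x i * ?e x \<partial>Rn n) = (\<integral>x. (\<Sum>k<n. B $$ (i,k) * (mapp A x k * ?e x)) \<partial>Rn n)"
    by (subst x) (simp add: sum_distrib_right mult.assoc)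
  also have "\<dots> = 0"
    unfolding Bochner_Integration.integral_sum[OF integrable_mult_right[OF int1]] integral_mult_right_zero
    by (intro sum.neutral ballI) (simp only: gaussian_parts(2)[OF A] lessThan_iff mult_zero_right)
  finally show "(\<integral>x. x i * ?e x \<partial>Rn n) = 0" .
  assume j: "j < n"
  have "(\<integral>x. x i * x j * ?e x \<partial>Rn n) = (\<integral>x. (\<Sum>k<n. B $$ (i,k) * (mapp A x k * x j * ?e x)) \<partial>Rn n)"
    by (subst x) (simp add: sum_distrib_right mult.assoc)
  also have "\<dots> = (\<Sum>k<n. B $$ (i,k) * (if k = j then gaussZ n A else 0))"
    unfolding Bochner_Integration.integral_sum[OF integrable_mult_right[OF int2[OF j]]] integral_mult_right_zero
    by (intro sum.cong refl) (simp only: gaussian_parts(1)[OF A _ j] lessThan_iff)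
  also have "\<dots> = gaussZ n A * B $$ (i,j)"
    using j by (simp add: if_distrib[of "\<lambda>t. _ * t"] cong: if_cong)
  finally show "(\<integral>x. x i * x j * ?e x \<partial>Rn n) = gaussZ n A * B $$ (i,j)" .
qed

section \<open>Rewriting in the matrix ring, and congruence of forms\<close>

text \<open>The last five rules discharge the carrier premises of the others, so for a fixed
  dimension the list acts as a normaliser for the ring of square matrices.\<close>

lemma mat_ring_simps:
  fixes A B C :: "real mat"
  shows "A \<in> carrier_mat n n \<Longrightarrow> B \<in> carrier_mat n n \<Longrightarrow> C \<in> carrier_mat n n \<Longrightarrow> A * (B + C) = A * B + A * C"
    "A \<in> carrier_mat n n \<Longrightarrow> B \<in> carrier_mat n n \<Longrightarrow> C \<in> carrier_mat n n \<Longrightarrow> (A + B) * C = A * C + B * C"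
    "A \<in> carrier_mat n n \<Longrightarrow> B \<in> carrier_mat n n \<Longrightarrow> C \<in> carrier_mat n n \<Longrightarrow> A * (B - C) = A * B - A * C"
    "A \<in> carrier_mat n n \<Longrightarrow> B \<in> carrier_mat n n \<Longrightarrow> C \<in> carrier_mat n n \<Longrightarrow> (A - B) * C = A * C - B * C"
    "A \<in> carrier_mat n n \<Longrightarrow> B \<in> carrier_mat n n \<Longrightarrow> (k \<cdot>\<^sub>m A) * B = k \<cdot>\<^sub>m (A * B)"
    "A \<in> carrier_mat n n \<Longrightarrow> B \<in> carrier_mat n n \<Longrightarrow> A * (k \<cdot>\<^sub>m B) = k \<cdot>\<^sub>m (A * B)"
    "A \<in> carrier_mat n n \<Longrightarrow> B \<in> carrier_mat n n \<Longrightarrow> C \<in> carrier_mat n n \<Longrightarrow> (A * B) * C = A * (B * C)"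
    "A \<in> carrier_mat n n \<Longrightarrow> 1\<^sub>m n * A = A" "A \<in> carrier_mat n n \<Longrightarrow> A * 1\<^sub>m n = A"
    "A \<in> carrier_mat n n \<Longrightarrow> B \<in> carrier_mat n n \<Longrightarrow> A * B \<in> carrier_mat n n"
    "B \<in> carrier_mat n n \<Longrightarrow> A - B \<in> carrier_mat n n"
    "B \<in> carrier_mat n n \<Longrightarrow> A + B \<in> carrier_mat n n"
    "B \<in> carrier_mat n n \<Longrightarrow> k \<cdot>\<^sub>m B \<in> carrier_mat n n"
    "1\<^sub>m n \<in> carrier_mat n n"
  by (auto simp: algebra_simps mult_smult_distrib mult_smult_assoc_mat minus_carrier_mat)

text \<open>Substitutes x = A y with the invertible \<open>A\<close>; the constant of definiteness
  shrinks by a factor controlled by the Frobenius norm of \<open>A\<close>.\<close>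

lemma pd_congruence:
  assumes A: "pd n A" and M: "symm n M" and AMA: "pd n (A * M * A)"
  shows "pd n M"
proof -
  note c = pd_carrier[OF A] and I = minv_pd[OF A]
  obtain l where l: "l > 0" "\<And>x. l * nsq n x \<le> qform (A * M * A) x" using AMA unfolding pd_def by auto
  \<comment> \<open>The \<open>+ 1\<close> keeps the denominator positive in dimension zero, where
    the Frobenius norm vanishes.\<close>
  define k where "k = l / ((frob A)\<^sup>2 + 1)"
  have pos: "(frob A)\<^sup>2 + 1 > 0" by (simp add: add_nonneg_pos)
  have "k * nsq n x \<le> qform M x" for x
  proof -
    define y where "y = mapp (minv A) x"
    have x: "mapp A y i = x i" if "i < n" for i
      using mapp_mult[OF c I(1) that, of x] that by (simp add: I(2) mapp_one y_def)
    have "qform M x = qform (A * M * A) y"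
      unfolding qform_sandwich[OF pd_symm[OF A] symm_carrier[OF M]]
      by (rule qform_cong[OF symm_carrier[OF M]]) (simp add: x)
    then have q: "l * nsq n y \<le> qform M x" using l(2) by simp
    have "nsq n x = nsq n (mapp A y)" using x by (simp add: nsq_def)
    also have "\<dots> \<le> (frob A)\<^sup>2 * nsq n y" by (rule nsq_mapp_le[OF c])
    also have "\<dots> \<le> ((frob A)\<^sup>2 + 1) * nsq n y" by (simp add: algebra_simps)
    finally have "k * nsq n x \<le> k * (((frob A)\<^sup>2 + 1) * nsq n y)"
      using l(1) pos by (intro mult_left_mono) (auto simp: k_def)
    also have "\<dots> = l * nsq n y" using pos by (simp add: k_def)
    finally show ?thesis using q by simp
  qed
  moreover have "k > 0" using l(1) pos by (simp add: k_def)
  ultimately show ?thesis unfolding pd_def using M by blast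
qed

lemma pd_minv:
  assumes "pd n A" shows "pd n (minv A)"
proof (rule pd_congruence[OF assms minv_pd_symm[OF assms]])
  show "pd n (A * minv A * A)"
    unfolding minv_pd(2)[OF assms] using assms pd_carrier[OF assms] by simp
qed

lemma pd_smult:
  assumes "pd n A" "c > 0" shows "pd n (c \<cdot>\<^sub>m A)"
proof -
  obtain l where l: "l > 0" "\<And>x. l * nsq n x \<le> qform A x" using assms(1) unfolding pd_def by auto
  have "(c * l) * nsq n x \<le> qform (c \<cdot>\<^sub>m A) x" for x
    using l(2)[of x] assms(2) by (simp add: qform_smult[OF pd_carrier[OF assms(1)]] mult.assoc)
  then show ?thesis
    unfolding pd_def using symm_smult[OF pd_symm[OF assms(1)]] l(1) assms(2) by (meson mult_pos_pos)
qed

lemma pd_one_plus: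
  assumes "symm n G" "frob G < 1" shows "pd n (1\<^sub>m n + G)"
proof -
  have "1 \<cdot>\<^sub>m 1\<^sub>m n = (1\<^sub>m n :: real mat)" by (intro eq_matI) auto
  then show ?thesis using pd_frobI[OF assms] by simp
qed

lemma pd_one_minus:
  assumes "symm n G" "frob G < 1" shows "pd n (1\<^sub>m n - G)"
proof -
  have "1\<^sub>m n - G = 1\<^sub>m n + (-1) \<cdot>\<^sub>m G"
    using symm_carrier[OF assms(1)] by (auto intro!: eq_matI)
  then show ?thesis
    using pd_one_plus[OF symm_smult[OF assms(1), of "-1"]] assms frob_smult[OF symm_carrier[OF assms(1)], of "-1"] by simp
qed

section \<open>Resolvents of small symmetric matrices\<close>

locale small_symm =
  fixes n :: nat and G :: "real mat"
  assumes symm: "symm n G" and small: "frob G < 1"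
begin

definition "R = minv (1\<^sub>m n - G)"
definition "Rp = minv (1\<^sub>m n + G)"
text \<open>The geometric series G + G^2 + ..., that is G / (1 - G). It measures the added noise: (1
  + G) / (1 - G) equals 1 + 2 F.\<close>

definition "F = R - 1\<^sub>m n"

lemma G: "G \<in> carrier_mat n n" by (rule symm_carrier[OF symm])
lemmas pm = pd_one_minus[OF symm small] and pp = pd_one_plus[OF symm small]
lemmas R = minv_pd[OF pm, folded R_def] and Rp = minv_pd[OF pp, folded Rp_def]
lemmas mr = mat_ring_simps[where n=n]

lemma pd_R: "pd n R" unfolding R_def by (rule pd_minv[OF pm])
lemma pd_Rp: "pd n Rp" unfolding Rp_def by (rule pd_minv[OF pp])
lemma F: "F \<in> carrier_mat n n" using R by (simp add: F_def mr)
lemma symm_F: "symm n F" unfolding F_def by (intro symm_minus pd_symm[OF pd_R] symm_one)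

lemma G_R: "G * R = F"
proof -
  have e: "R - G * R = 1\<^sub>m n" using R(2) by (simp add: mr R(1) G)
  show ?thesis unfolding F_def e[symmetric] using R(1) G by (intro eq_matI) auto
qed

text \<open>The fixed-point form stands in for the geometric series: norm and trace of
  \<open>F\<close> are bounded by one substitution, without limits.\<close>

lemma F_eq: "F = G + G * F"
proof -
  have "G * F = G * R - G" by (simp add: F_def mr R G)
  then show ?thesis unfolding G_R using F G by (intro eq_matI) auto
qed

lemma frob_F: "frob F \<le> frob G / (1 - frob G)"
proof -
  have "frob F \<le> frob G + frob (G * F)"
    using frob_add[OF G, of "G * F"] G F F_eq by (simp add: mr)
  also have "frob (G * F) \<le> frob G * frob F" by (rule frob_mult[OF G F])
  finally show ?thesis using small by (simp add: field_simps)
qed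

text \<open>Only the part of \<open>F\<close> beyond \<open>G\<close> is estimated by norms. The
  trace of \<open>G\<close> is kept exactly, because Cauchy-Schwarz would replace it by sqrt n times
  the norm.\<close>

lemma mtr_F: "mtr F \<le> mtr G + (frob G)\<^sup>2 / (1 - frob G)"
proof -
  have "mtr F = mtr G + mtr (G * F)" 
    using mtr_add[OF G, of "G * F"] G F F_eq by (simp add: mr)
  also have "mtr (G * F) \<le> frob G * frob F" by (rule mtr_le_frob[OF G F])
  also have "\<dots> \<le> frob G * (frob G / (1 - frob G))" by (intro mult_left_mono frob_F) simp
  finally show ?thesis by (simp add: power2_eq_square)
qed

text \<open>Hadamard bounds determinants from above only, so the lower bound comes from applying it
  to the inverse \<open>1 + F\<close>.\<close>

lemma det_ge: "exp (- mtr F) \<le> Determinant.det (1\<^sub>m n - G)"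
proof -
  have *: "1\<^sub>m n + F = R" using R(1) unfolding F_def by (intro eq_matI) auto
  have "Determinant.det R \<le> exp (mtr F)"
    using pd_det_le_exp[OF _ F] pd_R unfolding * by simp
  moreover have "Determinant.det (1\<^sub>m n - G) * Determinant.det R = 1"
    using det_mult[OF pd_carrier[OF pm] R(1)] R(2) by simp
  moreover have "Determinant.det R > 0" by (rule pd_det_pos[OF pd_R])
  ultimately show ?thesis by (simp add: exp_minus field_simps) (metis mult.commute mult_left_mono pd_det_pos pm less_imp_le)
qed

lemma det_ge': "exp (- (mtr G + (frob G)\<^sup>2 / (1 - frob G))) \<le> Determinant.det (1\<^sub>m n - G)"
  by (rule order_trans[OF _ det_ge]) (use mtr_F in simp)

text \<open>Partial fractions: inserting 2 = (1 + G) + (1 - G) between the two resolvents gives 2 R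
  Rp = R + Rp, from which the product collapses.\<close>

lemma cayley_inverse: "(2 \<cdot>\<^sub>m R - 1\<^sub>m n) * (2 \<cdot>\<^sub>m Rp - 1\<^sub>m n) = 1\<^sub>m n"
proof -
  have "R * (X + Z) * Rp = R * (X * Rp) + (R * Z) * Rp"
    if "X \<in> carrier_mat n n" "Z \<in> carrier_mat n n" for X Z
    using that R(1) Rp(1) by (simp add: mr)
  from this[OF pd_carrier[OF pp] pd_carrier[OF pm]]
  have "R * ((1\<^sub>m n + G) + (1\<^sub>m n - G)) * Rp = R + Rp"
    unfolding Rp(2) R(3) using R(1) Rp(1) by (simp add: mr)
  also have "(1\<^sub>m n + G) + (1\<^sub>m n - G) = 2 \<cdot>\<^sub>m 1\<^sub>m n" using G by (intro eq_matI) auto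
  finally have "2 \<cdot>\<^sub>m (R * Rp) = R + Rp" using R(1) Rp(1) by (simp add: mr)
  then have *: "2 * (R * Rp) $$ (i,j) = R $$ (i,j) + Rp $$ (i,j)" if "i < n" "j < n" for i j
    using that R Rp by (metis carrier_matD index_add_mat(1) index_mult_mat(2,3) index_smult_mat(1))
  show ?thesis
    using R(1) Rp(1) by (intro eq_matI) (auto simp: mr * algebra_simps)
qed

lemma det_cayley: "Determinant.det (2 \<cdot>\<^sub>m Rp - 1\<^sub>m n) = Determinant.det (1\<^sub>m n - G) * Determinant.det Rp"
proof -
  have "(1\<^sub>m n - G) * Rp = 2 \<cdot>\<^sub>m Rp - (1\<^sub>m n + G) * Rp"
    using Rp(1) G unfolding mr(2)[OF mr(14) G Rp(1)] mr(4)[OF mr(14) G Rp(1)] mr(8)[OF Rp(1)]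
    by (intro eq_matI) auto
  then show ?thesis using det_mult[OF pd_carrier[OF pm] Rp(1)] Rp by simp
qed

text \<open>Congruence by 1 + H turns 2 (1 + H)^-1 - 1 into 1 - H^2; the two claims are H = -G and H
  = G.\<close>

lemma pd_cayley: "pd n (2 \<cdot>\<^sub>m R - 1\<^sub>m n)" "pd n (2 \<cdot>\<^sub>m Rp - 1\<^sub>m n)"
proof -
  have gen: "pd n (2 \<cdot>\<^sub>m minv (1\<^sub>m n + H) - 1\<^sub>m n)" if H: "symm n H" "frob H < 1" for H
  proof -
    note p = pd_one_plus[OF H] and c = symm_carrier[OF H(1)]
    note I = minv_pd[OF p]
    have s: "symm n (2 \<cdot>\<^sub>m minv (1\<^sub>m n + H) - 1\<^sub>m n)"
      by (intro symm_minus symm_smult symm_one minv_pd_symm p)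
    have "(1\<^sub>m n + H) * (2 \<cdot>\<^sub>m minv (1\<^sub>m n + H) - 1\<^sub>m n) * (1\<^sub>m n + H) =
        (2 \<cdot>\<^sub>m ((1\<^sub>m n + H) * minv (1\<^sub>m n + H)) - (1\<^sub>m n + H)) * (1\<^sub>m n + H)"
      using I(1) c by (simp only: mr)
    also have "\<dots> = (1\<^sub>m n - H) * (1\<^sub>m n + H)"
      unfolding I(2) using c by (intro arg_cong[where f="\<lambda>A. A * _"] eq_matI) auto
    also have "\<dots> = 1\<^sub>m n - H * H" using c by (simp only: mr) (intro eq_matI, auto)
    finally have e: "(1\<^sub>m n + H) * (2 \<cdot>\<^sub>m minv (1\<^sub>m n + H) - 1\<^sub>m n) * (1\<^sub>m n + H) = 1\<^sub>m n - H * H" .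
    have s2: "symm n (H * H)" by (rule symm_mult[OF H(1) H(1) refl])
    have "frob (H * H) \<le> frob H * frob H" by (rule frob_mult[OF c c])
    also have "\<dots> < 1" using H(2) by (metis frob_nonneg mult_le_one mult_less_cancel_right2 less_le_not_le mult_less_le_imp_less mult_strict_mono' mult_1)
    finally have "pd n (1\<^sub>m n - H * H)" using pd_one_minus[OF s2] by simp
    then show ?thesis by (intro pd_congruence[OF p s]) (simp only: e)
  qed
  show "pd n (2 \<cdot>\<^sub>m Rp - 1\<^sub>m n)" unfolding Rp_def by (rule gen[OF symm small])
  have "1\<^sub>m n + (-1) \<cdot>\<^sub>m G = 1\<^sub>m n - G" using G by (intro eq_matI) auto
  then show "pd n (2 \<cdot>\<^sub>m R - 1\<^sub>m n)"
    using gen[OF symm_smult[OF symm, of "-1"]] small frob_smult[OF G, of "-1"] unfolding R_def by simp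
qed

end

text \<open>The product is the determinant of 1 - D^2, so the first-order traces cancel. This is
  what makes the chi-square divergence quadratic in the signal.\<close>

lemma det_one_plus_one_minus_ge:
  assumes "symm n D" "frob D < 1"
  shows "exp (- ((frob D)\<^sup>2 / (1 - (frob D)\<^sup>2))) \<le> Determinant.det (1\<^sub>m n + D) * Determinant.det (1\<^sub>m n - D)"
proof -
  note c = symm_carrier[OF assms(1)] and mr = mat_ring_simps[where n=n]
  have f: "frob (D * D) \<le> (frob D)\<^sup>2" using frob_mult[OF c c] by (simp add: power2_eq_square)
  have d1: "(frob D)\<^sup>2 < 1" using assms(2) by (simp add: abs_square_less_1)
  interpret small_symm n "D * D"
    using f d1 symm_mult[OF assms(1) assms(1) refl] by unfold_locales auto
  have tr: "mtr (D * D) = (frob D)\<^sup>2"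
    using mip_mult_left[OF assms(1) one_carrier_mat c] c
    by (simp add: frob_sq mip_one_left[symmetric])
  have "mtr (D * D) + (frob (D * D))\<^sup>2 / (1 - frob (D * D)) \<le> (frob D)\<^sup>2 + ((frob D)\<^sup>2)\<^sup>2 / (1 - (frob D)\<^sup>2)"
    unfolding tr using f d1 by (intro add_left_mono frac_le power_mono) auto
  also have "\<dots> = (frob D)\<^sup>2 / (1 - (frob D)\<^sup>2)" using d1 by (simp add: field_simps power2_eq_square)
  finally have "exp (- ((frob D)\<^sup>2 / (1 - (frob D)\<^sup>2))) \<le> Determinant.det (1\<^sub>m n - D * D)"
    using det_ge' by (meson dual_order.trans exp_le_cancel_iff neg_le_iff_le)
  also have "1\<^sub>m n - D * D = (1\<^sub>m n + D) * (1\<^sub>m n - D)" using c by (simp only: mr) (intro eq_matI, auto)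
  also have "Determinant.det \<dots> = Determinant.det (1\<^sub>m n + D) * Determinant.det (1\<^sub>m n - D)"
    using c by (intro det_mult) (auto intro: mr)
  finally show ?thesis .
qed

section \<open>A Cayley transform aligned with a symmetric matrix\<close>

text \<open>The grading has a single cut at \<open>m\<close>: when the dimension is odd, the spare
  index \<open>2 * m\<close> belongs to the second block.\<close>

definition same_block :: "nat \<Rightarrow> nat \<Rightarrow> nat \<Rightarrow> bool" where
  "same_block m i j \<longleftrightarrow> (i < m \<longleftrightarrow> j < m)"

text \<open>Conjugation by the diagonal matrix with +1 on the first block and -1 on the second: an
  automorphism that fixes even matrices and negates odd ones.\<close>

definition bconj :: "nat \<Rightarrow> nat \<Rightarrow> real mat \<Rightarrow> real mat" where
  "bconj m n X = Matrix.mat n n (\<lambda>(i,j). (if same_block m i j then 1 else -1) * X $$ (i,j))"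

lemma bconj_mult:
  assumes "X \<in> carrier_mat n n" "Y \<in> carrier_mat n n"
  shows "bconj m n (X * Y) = bconj m n X * bconj m n Y"
proof (rule eq_matI)
  fix i j assume "i < dim_row (bconj m n X * bconj m n Y)" "j < dim_col (bconj m n X * bconj m n Y)"
  then have ij: "i < n" "j < n" by (auto simp: bconj_def)
  define s :: "nat \<Rightarrow> real" where "s i = (if i < m then 1 else -1)" for i
  have b: "bconj m n Z = Matrix.mat n n (\<lambda>(i,j). s i * s j * Z $$ (i,j))" for Z
    by (auto simp: bconj_def same_block_def s_def)
  have c: "bconj m n Z \<in> carrier_mat n n" for Z by (simp add: b)
  have s2: "s i * s j * (x * y) = (s i * s k * x) * (s k * s j * y)" for k x y by (simp add: s_def)
  show "bconj m n (X * Y) $$ (i,j) = (bconj m n X * bconj m n Y) $$ (i,j)"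
    unfolding mult_index[OF c c ij] using ij
    by (simp add: b mult_index[OF assms] sum_distrib_left s2[symmetric])
qed (auto simp: bconj_def)

lemma qform_columns:
  assumes "X \<in> carrier_mat n n" "Y \<in> carrier_mat n n"
  shows "mip X (Y * X) = (\<Sum>k<n. qform Y (\<lambda>i. X $$ (i,k)))"
proof -
  have "mip X (Y * X) = (\<Sum>i<n. \<Sum>k<n. \<Sum>j<n. X $$ (i,k) * Y $$ (i,j) * X $$ (j,k))"
    using assms by (simp add: mip_eq[of _ n] mult_index[OF assms(2,1)] sum_distrib_left mult.assoc)
  also have "\<dots> = (\<Sum>k<n. \<Sum>i<n. \<Sum>j<n. X $$ (i,k) * Y $$ (i,j) * X $$ (j,k))"
    by (rule sum.swap)
  finally show ?thesis using assms by (simp add: qform_eq[of _ n])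
qed

text \<open>\<open>P + i S\<close> is the Cayley transform (1 + i A) / (1 - i A), a unitary with
  imaginary part 2 A / (1 + A^2). On an eigenvalue x of \<open>A\<close> the last claim reads 2 x^2
  / (1 + x^2) \<ge> 2 (x^2 - x^4). The sign function of \<open>A\<close> would reach the full trace
  norm, but the Cayley transform is rational and needs no diagonalisation.\<close>

lemma cayley_alignment:
  assumes A: "symm n A" and odd: "\<And>i j. i < n \<Longrightarrow> j < n \<Longrightarrow> same_block m i j \<Longrightarrow> A $$ (i,j) = 0"
  obtains P S where "symm n P" "symm n S" "P * P + S * S = 1\<^sub>m n" "P * S = S * P"
    "\<And>i j. i < n \<Longrightarrow> j < n \<Longrightarrow> same_block m i j \<Longrightarrow> S $$ (i,j) = 0"
    "2 * (mip A A - mip (A * A) (A * A)) \<le> mip S A"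
proof -
  note c = symm_carrier[OF A] and mr = mat_ring_simps[where n=n]
  define W where "W = A * A"
  have W: "W \<in> carrier_mat n n" "symm n W" unfolding W_def using c symm_mult[OF A A refl] by auto
  have "1 * nsq n x \<le> qform (1\<^sub>m n + W) x" for x
    using W(1) by (simp add: qform_add[of _ n] qform_one W_def qform_square[OF A])
  then have pdW: "pd n (1\<^sub>m n + W)" unfolding pd_def using symm_add[OF symm_one W(2)]
    by (intro conjI exI[of _ 1] allI) auto
  define Y where "Y = minv (1\<^sub>m n + W)"
  note Y = minv_pd[OF pdW, folded Y_def] and sY = minv_pd_symm[OF pdW, folded Y_def]
    and pY = pd_minv[OF pdW, folded Y_def]
  have AW: "A * (1\<^sub>m n + W) = (1\<^sub>m n + W) * A" using c W by (simp add: mr W_def)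
  have AY: "A * Y = Y * A"
  proof -
    have "A * Y = (Y * (1\<^sub>m n + W)) * (A * Y)" unfolding Y(3) using c Y(1) by (simp add: mr)
    also have "\<dots> = Y * ((1\<^sub>m n + W) * A) * Y" using c Y(1) W(1) by (simp only: mr)
    also have "\<dots> = (Y * A) * ((1\<^sub>m n + W) * Y)" unfolding AW[symmetric] using c Y(1) W(1) by (simp only: mr)
    also have "\<dots> = Y * A" unfolding Y(2) using c Y(1) by (simp add: mr)
    finally show ?thesis .
  qed
  have WY: "W * Y = 1\<^sub>m n - Y"
  proof -
    have "Y + W * Y = 1\<^sub>m n" using Y(1,2) W(1) by (simp add: mr)
    then have "Y $$ (i,j) + (W * Y) $$ (i,j) = (1\<^sub>m n) $$ (i,j)" if "i < n" "j < n" for i j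
      using that Y(1) W(1) by (metis carrier_matD index_add_mat(1) index_mult_mat(2,3))
    then show ?thesis using Y(1) W(1) by (intro eq_matI) (auto simp: algebra_simps)
  qed
  have YW: "Y * W = W * Y"
  proof -
    have "Y * W = A * Y * A" unfolding AY W_def using c Y(1) by (simp only: mr)
    also have "\<dots> = A * (Y * A)" using c Y(1) by (simp only: mr)
    also have "\<dots> = W * Y" unfolding AY[symmetric] W_def using c Y(1) by (simp only: mr)
    finally show ?thesis .
  qed
  define P where "P = 2 \<cdot>\<^sub>m Y - 1\<^sub>m n"
  define S where "S = 2 \<cdot>\<^sub>m (A * Y)"
  have P: "P \<in> carrier_mat n n" "symm n P"
    unfolding P_def by (auto intro!: symm_minus symm_smult sY symm_one simp: mr)
  have S: "S \<in> carrier_mat n n" "symm n S"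
    unfolding S_def using c Y(1) by (auto intro!: symm_smult symm_mult A sY AY)
  have "S * S = 4 \<cdot>\<^sub>m ((1\<^sub>m n - Y) * Y)"
  proof -
    have "S * S = 2 \<cdot>\<^sub>m (2 \<cdot>\<^sub>m (A * (Y * A) * Y))" unfolding S_def using c Y(1) by (simp only: mr)
    also have "A * (Y * A) * Y = W * Y * Y" unfolding AY[symmetric] W_def using c Y(1) by (simp only: mr)
    finally show ?thesis unfolding WY using Y(1) by (intro eq_matI) (auto simp: mr)
  qed
  then have 1: "P * P + S * S = 1\<^sub>m n"
    unfolding P_def using Y(1) by (simp only: mr) (intro eq_matI, auto simp: algebra_simps)
  have 2: "P * S = S * P"
  proof -
    have "Y * (A * Y) = (A * Y) * Y" unfolding AY using c Y(1) by (metis AY mr(7))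
    then show ?thesis unfolding P_def S_def using c Y(1)
      by (simp only: mr) (intro eq_matI, auto simp: algebra_simps)
  qed
  \<comment> \<open>Even functions of an odd matrix are even: \<open>W\<close> and its resolvent
    \<open>Y\<close> are fixed by the automorphism, hence \<open>A * Y\<close> is odd like
    \<open>A\<close>.\<close>
  have bA: "bconj m n A = (-1) \<cdot>\<^sub>m A" using c odd by (intro eq_matI) (auto simp: bconj_def)
  have b1: "bconj m n (1\<^sub>m n) = 1\<^sub>m n" by (intro eq_matI) (auto simp: bconj_def same_block_def)
  have bc: "bconj m n X \<in> carrier_mat n n" for X by (simp add: bconj_def)
  have bW: "bconj m n (1\<^sub>m n + W) = 1\<^sub>m n + W"
  proof -
    have "bconj m n W = W" unfolding W_def bconj_mult[OF c c] bA using c by (simp add: mr) (intro eq_matI, auto)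
    then have "(if same_block m i j then 1 else -1) * W $$ (i,j) = W $$ (i,j)" if "i < n" "j < n" for i j
      using that by (metis (no_types, lifting) bconj_def index_mat(1) case_prod_conv)
    then show ?thesis using W(1) by (intro eq_matI) (auto simp: bconj_def same_block_def distrib_left)
  qed
  have bY: "bconj m n Y = Y"
  proof (rule inverse_unique_mat[OF _ bc Y(1) _ Y(2)])
    show "bconj m n Y * (1\<^sub>m n + W) = 1\<^sub>m n"
      using bconj_mult[OF Y(1) pd_carrier[OF pdW], of m] unfolding bW Y(3) b1 by simp
  qed (rule pd_carrier[OF pdW])
  have 3: "S $$ (i,j) = 0" if "i < n" "j < n" "same_block m i j" for i j
  proof -
    have "bconj m n (A * Y) = (-1) \<cdot>\<^sub>m (A * Y)" unfolding bconj_mult[OF c Y(1)] bA bY using c Y(1) by (simp only: mr)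
    from arg_cong[OF this, of "\<lambda>Z. Z $$ (i,j)"] have "(A * Y) $$ (i,j) = - (A * Y) $$ (i,j)"
      using that c Y(1) by (simp add: bconj_def)
    then show ?thesis using that c Y(1) by (simp add: S_def)
  qed
  have AWc: "A * W = W * A" using c unfolding W_def by (simp only: mr)
  have "mip S A = 2 * mip (A * Y) A" unfolding S_def using c Y(1) by (simp add: mip_smult_left[of _ n])
  also have "mip (A * Y) A = mip Y W" unfolding W_def by (rule mip_mult_left[OF A Y(1) c])
  \<comment> \<open>Second-order expansion Y = 1 - W + W Y W with its exact remainder; the first two
    terms give the claimed bound.\<close>
  also have "mip Y W = mtr W - mip W W + mip (W * Y * W) W"
  proof -
    have "W * Y * W = W - Y * W" unfolding WY using Y(1) W(1) by (simp only: mr)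
    also have "Y * W = 1\<^sub>m n - Y" unfolding YW by (rule WY)
    finally have "Y = 1\<^sub>m n - W + W * Y * W" using Y(1) W(1) by (intro eq_matI) auto
    then have "mip Y W = mip (1\<^sub>m n - W + W * Y * W) W" by simp
    also have "\<dots> = mip (1\<^sub>m n) W - mip W W + mip (W * Y * W) W"
      using Y(1) W(1) by (simp add: mip_add_left[of _ n] mip_minus_left[of _ n] mr del: assoc_mult_mat)
    finally show ?thesis using mip_one_left[OF W(1)] by simp
  qed
  also have "mtr W = mip A A"
  proof -
    have "mtr W = mip (A * 1\<^sub>m n) A"
      unfolding mip_one_left[OF W(1), symmetric] unfolding W_def using mip_mult_left[OF A one_carrier_mat c] by simp
    then show ?thesis using c by simp
  qed
  finally have e: "mip S A = 2 * (mip A A - mip W W + mip (W * Y * W) W)" .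
  \<comment> \<open>With X = W A the remainder is the trace of X^T Y X, a sum of values of the
    positive form \<open>Y\<close> on the columns of X.\<close>
  have "mip (W * Y * W) W \<ge> 0"
  proof -
    have X: "W * A \<in> carrier_mat n n" using c W(1) by simp
    have "mip (W * Y * W) W = mip (A * (W * Y * W)) A"
      unfolding W_def by (rule mip_mult_left[OF A _ c, symmetric]) (use c Y(1) in \<open>simp add: mr\<close>)
    also have "A * (W * Y * W) = (Y * (W * A)) * W"
    proof -
      have "A * (W * Y * W) = (A * W) * (Y * W)" using c Y(1) W(1) by (simp only: mr)
      also have "\<dots> = W * (A * Y) * W" unfolding AWc using c Y(1) W(1) by (simp only: mr)
      also have "\<dots> = (W * Y) * A * W" unfolding AY using c Y(1) W(1) by (simp only: mr)
      also have "\<dots> = (Y * (W * A)) * W" unfolding YW[symmetric] using c Y(1) W(1) by (simp only: mr)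
      finally show ?thesis .
    qed
    also have "mip ((Y * (W * A)) * W) A = mip (Y * (W * A)) (A * W)"
      by (rule mip_mult_right[OF W(2) _ c]) (use X Y(1) in \<open>simp add: mr\<close>)
    also have "\<dots> = mip (W * A) (Y * (W * A))"
      unfolding AWc using X Y(1) by (intro mip_commute[of _ n]) (auto simp: mr)
    also have "\<dots> = (\<Sum>k<n. qform Y (\<lambda>i. (W * A) $$ (i,k)))" by (rule qform_columns[OF X Y(1)])
    also have "\<dots> \<ge> 0"
    proof (rule sum_nonneg)
      obtain l where "l > 0" "\<And>x. l * nsq n x \<le> qform Y x" using pY unfolding pd_def by auto
      then show "0 \<le> qform Y (\<lambda>i. (W * A) $$ (i,k))" for k
        by (meson less_imp_le mult_nonneg_nonneg nsq_nonneg order_trans)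
    qed
    finally show ?thesis .
  qed
  then have 4: "2 * (mip A A - mip (A * A) (A * A)) \<le> mip S A" using e unfolding W_def by simp
  show ?thesis by (rule that[OF P(2) S(2) 1 2 3 4])
qed

section \<open>Changes of variables\<close>

lemma space_Rn: "space (Rn n) = PiE {..<n} (\<lambda>_. UNIV)"
  by (simp add: Rn_def space_PiM)

lemma restrict_measurable_Rn:
  assumes "\<And>i. i < n \<Longrightarrow> (\<lambda>x. f x i) \<in> borel_measurable M"
  shows "(\<lambda>x. \<lambda>i\<in>{..<n}. f x i) \<in> measurable M (Rn n)"
  unfolding Rn_def using assms by (intro measurable_restrict) auto

lemma Rn_translate: "distr (Rn n) (Rn n) (\<lambda>x. \<lambda>i\<in>{..<n}. x i + v i) = Rn n"
proof -
  let ?f = "\<lambda>x. \<lambda>i\<in>{..<n}. x i + v i"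
  have f: "?f \<in> measurable (Rn n) (Rn n)"
    by (intro restrict_measurable_Rn) auto
  have "distr (Rn n) (Rn n) ?f = PiM {..<n} (\<lambda>_. lborel)"
  proof (rule lb.PiM_eqI)
    fix A :: "nat \<Rightarrow> real set" assume A: "\<And>i. i \<in> {..<n} \<Longrightarrow> A i \<in> sets lborel"
    have "emeasure (distr (Rn n) (Rn n) ?f) (PiE {..<n} A) = emeasure (Rn n) (?f -` PiE {..<n} A \<inter> space (Rn n))"
      using A by (intro emeasure_distr f) (auto simp: Rn_def intro!: sets_PiM_I_finite)
    also have "?f -` PiE {..<n} A \<inter> space (Rn n) = PiE {..<n} (\<lambda>i. (+) (v i) -` A i)"
      by (auto simp: space_Rn PiE_def Pi_def extensional_def add.commute)
    also have "emeasure (Rn n) \<dots> = (\<Prod>i<n. emeasure lborel ((+) (v i) -` A i))"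
      unfolding Rn_def using A by (intro lb.emeasure_PiM) (auto intro!: measurable_sets_borel[of _ borel])
    also have "\<dots> = (\<Prod>i<n. emeasure lborel (A i))"
    proof (rule prod.cong[OF refl])
      fix i assume "i \<in> {..<n}"
      then have "emeasure lborel (A i) = emeasure (distr lborel borel ((+) (v i))) (A i)"
        by (simp add: lborel_distr_plus)
      also have "\<dots> = emeasure lborel ((+) (v i) -` A i)"
        using A[OF \<open>i \<in> {..<n}\<close>] by (subst emeasure_distr) auto
      finally show "emeasure lborel ((+) (v i) -` A i) = emeasure lborel (A i)" by simp
    qed
    finally show "emeasure (distr (Rn n) (Rn n) ?f) (PiE {..<n} A) = (\<Prod>i<n. emeasure lborel (A i))" .
  qed (auto simp: Rn_def)
  then show ?thesis by (simp add: Rn_def)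
qed

lemma nn_integral_translate:
  assumes "f \<in> borel_measurable (Rn n)"
  shows "(\<integral>\<^sup>+x. f x \<partial>Rn n) = (\<integral>\<^sup>+x. f (\<lambda>i\<in>{..<n}. x i + v i) \<partial>Rn n)"
proof -
  have "(\<integral>\<^sup>+x. f x \<partial>Rn n) = (\<integral>\<^sup>+x. f x \<partial>distr (Rn n) (Rn n) (\<lambda>x. \<lambda>i\<in>{..<n}. x i + v i))"
    by (simp only: Rn_translate)
  also have "\<dots> = (\<integral>\<^sup>+x. f (\<lambda>i\<in>{..<n}. x i + v i) \<partial>Rn n)"
    using assms by (intro nn_integral_distr restrict_measurable_Rn) auto
  finally show ?thesis .
qed

lemma pair_Rn: "pair_sigma_finite (Rn n) (Rn n)"
  by (simp add: pair_sigma_finite_def sigma_finite_Rn)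

lemma Rn_pair_coord:
  assumes "i < n"
  shows "(\<lambda>z. fst z i) \<in> borel_measurable (Rn n \<Otimes>\<^sub>M Rn n)" "(\<lambda>z. snd z i) \<in> borel_measurable (Rn n \<Otimes>\<^sub>M Rn n)"
  using assms by (auto intro!: measurable_compose[OF measurable_fst Rn_coord] measurable_compose[OF measurable_snd Rn_coord])

text \<open>If (x, y) is the image of (a, c), then c = x + y and 2 a = x - y. The scaling of the two
  variables is chosen to give Jacobian one.\<close>

definition mean_diff :: "nat \<Rightarrow> (nat \<Rightarrow> real) \<times> (nat \<Rightarrow> real) \<Rightarrow> (nat \<Rightarrow> real) \<times> (nat \<Rightarrow> real)" where
  "mean_diff n = (\<lambda>(a,c). (\<lambda>i\<in>{..<n}. a i + c i / 2, \<lambda>i\<in>{..<n}. c i / 2 - a i))"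

lemma mean_diff_measurable: "mean_diff n \<in> measurable (Rn n \<Otimes>\<^sub>M Rn n) (Rn n \<Otimes>\<^sub>M Rn n)"
proof -
  note [measurable] = Rn_pair_coord
  show ?thesis
    unfolding mean_diff_def case_prod_unfold
    by (intro measurable_Pair restrict_measurable_Rn) auto
qed

text \<open>The map is a composition of two shears, (a, c) to (a + c/2, c) and (a, c) to (a, c - a),
  so translation invariance and Fubini suffice.\<close>

lemma Rn_pair_mean_diff: "distr (Rn n \<Otimes>\<^sub>M Rn n) (Rn n \<Otimes>\<^sub>M Rn n) (mean_diff n) = Rn n \<Otimes>\<^sub>M Rn n"
proof (rule measure_eqI)
  interpret pair_sigma_finite "Rn n" "Rn n" by (rule pair_Rn)
  let ?P = "Rn n \<Otimes>\<^sub>M Rn n"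
  fix X assume "X \<in> sets (distr ?P ?P (mean_diff n))"
  then have X[measurable]: "X \<in> sets ?P" by simp
  define f :: "(nat \<Rightarrow> real) \<times> (nat \<Rightarrow> real) \<Rightarrow> ennreal" where "f = indicator X"
  have f[measurable]: "f \<in> borel_measurable ?P" by (simp add: f_def)
  note [measurable] = Rn_pair_coord
  have g: "(\<lambda>z. f (fst z, \<lambda>i\<in>{..<n}. snd z i + - fst z i)) \<in> borel_measurable ?P"
    by (intro measurable_compose[OF _ f] measurable_Pair restrict_measurable_Rn) auto
  have "emeasure ?P X = (\<integral>\<^sup>+z. f z \<partial>?P)" by (simp add: f_def)
  also have "\<dots> = (\<integral>\<^sup>+a. \<integral>\<^sup>+b. f (a,b) \<partial>Rn n \<partial>Rn n)"
    by (rule sigma_finite_measure.nn_integral_fst[OF sigma_finite_Rn f, symmetric])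
  also have "\<dots> = (\<integral>\<^sup>+a. \<integral>\<^sup>+c. f (a, \<lambda>i\<in>{..<n}. c i + - a i) \<partial>Rn n \<partial>Rn n)"
    by (intro nn_integral_cong nn_integral_translate) (auto intro: measurable_Pair2[OF f])
  also have "\<dots> = (\<integral>\<^sup>+c. \<integral>\<^sup>+a. f (a, \<lambda>i\<in>{..<n}. c i + - a i) \<partial>Rn n \<partial>Rn n)"
    using g by (intro Fubini'[symmetric]) (simp add: case_prod_unfold)
  also have "\<dots> = (\<integral>\<^sup>+c. \<integral>\<^sup>+a. f (\<lambda>i\<in>{..<n}. a i + c i / 2, \<lambda>i\<in>{..<n}. c i + - (\<lambda>i\<in>{..<n}. a i + c i / 2) i) \<partial>Rn n \<partial>Rn n)"
  proof (rule nn_integral_cong)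
    fix c assume c: "c \<in> space (Rn n)"
    have "(\<lambda>a. f (a, \<lambda>i\<in>{..<n}. c i + - a i)) \<in> borel_measurable (Rn n)"
      using measurable_Pair1[OF g c] by simp
    from nn_integral_translate[OF this, of "\<lambda>i. c i / 2"]
    show "(\<integral>\<^sup>+a. f (a, \<lambda>i\<in>{..<n}. c i + - a i) \<partial>Rn n) =
      (\<integral>\<^sup>+a. f (\<lambda>i\<in>{..<n}. a i + c i / 2, \<lambda>i\<in>{..<n}. c i + - (\<lambda>i\<in>{..<n}. a i + c i / 2) i) \<partial>Rn n)"
      .
  qed
  also have "\<dots> = (\<integral>\<^sup>+c. \<integral>\<^sup>+a. f (mean_diff n (a,c)) \<partial>Rn n \<partial>Rn n)"
    by (intro nn_integral_cong arg_cong[where f=f]) (auto simp: mean_diff_def)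
  also have "\<dots> = (\<integral>\<^sup>+z. f (mean_diff n z) \<partial>?P)"
    using nn_integral_snd[of "\<lambda>z. f (mean_diff n z)"] measurable_compose[OF mean_diff_measurable f] by simp
  also have "\<dots> = emeasure (distr ?P ?P (mean_diff n)) X"
    unfolding f_def by (subst nn_integral_distr[OF mean_diff_measurable, symmetric]) auto
  finally show "emeasure (distr ?P ?P (mean_diff n)) X = emeasure ?P X" by simp
qed simp

lemma integral_mean_diff:
  fixes f :: "_ \<Rightarrow> real"
  assumes "f \<in> borel_measurable (Rn n \<Otimes>\<^sub>M Rn n)"
  shows "(\<integral>z. f z \<partial>(Rn n \<Otimes>\<^sub>M Rn n)) = (\<integral>z. f (mean_diff n z) \<partial>(Rn n \<Otimes>\<^sub>M Rn n))"
  using integral_distr[OF mean_diff_measurable assms] unfolding Rn_pair_mean_diff .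

lemma integrable_product_Rn:
  fixes f g :: "(nat \<Rightarrow> real) \<Rightarrow> 'b :: {real_normed_field, banach, second_countable_topology}"
  assumes f: "integrable (Rn n) f" and g: "integrable (Rn n) g"
  shows "integrable (Rn n \<Otimes>\<^sub>M Rn n) (\<lambda>z. f (fst z) * g (snd z))"
    and "(\<integral>z. f (fst z) * g (snd z) \<partial>(Rn n \<Otimes>\<^sub>M Rn n)) = (\<integral>x. f x \<partial>Rn n) * (\<integral>x. g x \<partial>Rn n)"
proof -
  interpret pair_sigma_finite "Rn n" "Rn n" by (rule pair_Rn)
  note [measurable] = borel_measurable_integrable[OF f] borel_measurable_integrable[OF g]
  show i: "integrable (Rn n \<Otimes>\<^sub>M Rn n) (\<lambda>z. f (fst z) * g (snd z))"
  proof (rule Fubini_integrable)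
    show "integrable (Rn n) (\<lambda>x. \<integral>y. norm (f (fst (x, y)) * g (snd (x, y))) \<partial>Rn n)"
      using f g by (simp add: norm_mult)
    show "AE x in Rn n. integrable (Rn n) (\<lambda>y. f (fst (x, y)) * g (snd (x, y)))"
      using g by simp
  qed measurable
  show "(\<integral>z. f (fst z) * g (snd z) \<partial>(Rn n \<Otimes>\<^sub>M Rn n)) = (\<integral>x. f x \<partial>Rn n) * (\<integral>x. g x \<partial>Rn n)"
    using integral_fst'[OF i] by simp
qed

section \<open>Block diagonal matrices\<close>

definition bdiag :: "nat \<Rightarrow> real mat \<Rightarrow> real mat \<Rightarrow> real mat" where
  "bdiag n A D = four_block_mat A (0\<^sub>m n n) (0\<^sub>m n n) D"

lemma bdiag_carrier: "A \<in> carrier_mat n n \<Longrightarrow> D \<in> carrier_mat n n \<Longrightarrow> bdiag n A D \<in> carrier_mat (2*n) (2*n)"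
  unfolding bdiag_def using four_block_carrier_mat[of A n n D n n] by (simp add: mult_2)

lemma bdiag_index:
  assumes "A \<in> carrier_mat n n" "D \<in> carrier_mat n n" "i < n" "j < n"
  shows "bdiag n A D $$ (i,j) = A $$ (i,j)" "bdiag n A D $$ (i+n,j) = 0" "bdiag n A D $$ (i,j+n) = 0"
    "bdiag n A D $$ (i+n,j+n) = D $$ (i,j)"
  using assms by (auto simp: bdiag_def)

lemma bdiag_mult:
  assumes "A \<in> carrier_mat n n" "D \<in> carrier_mat n n" "A' \<in> carrier_mat n n" "D' \<in> carrier_mat n n"
  shows "bdiag n A D * bdiag n A' D' = bdiag n (A * A') (D * D')"
  unfolding bdiag_def using assms
  by (subst mult_four_block_mat[of _ n n _ n _ n _ _ n _ n]) auto

lemma bdiag_one: "bdiag n (1\<^sub>m n) (1\<^sub>m n) = 1\<^sub>m (2*n)"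
  unfolding bdiag_def by (simp add: mult_2)

lemma det_bdiag:
  assumes "A \<in> carrier_mat n n" "D \<in> carrier_mat n n"
  shows "Determinant.det (bdiag n A D) = Determinant.det A * Determinant.det D"
  unfolding bdiag_def using assms by (subst det_four_block_mat_upper_right_zero[of _ n _ n]) auto

lemma sum_double: "(\<Sum>i<2*n. f i) = (\<Sum>i<n. f i) + (\<Sum>i<n. f (i + n))" for f :: "nat \<Rightarrow> 'a :: comm_monoid_add"
proof -
  have "(\<Sum>i<2*n. f i) = (\<Sum>i\<in>{..<n} \<union> {n..<n+n}. f i)" by (rule sum.cong) auto
  also have "\<dots> = (\<Sum>i<n. f i) + (\<Sum>i=n..<n+n. f i)" by (rule sum.union_disjoint) auto
  also have "(\<Sum>i=n..<n+n. f i) = (\<Sum>i<n. f (i + n))"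
    using sum.shift_bounds_nat_ivl[of f 0 n n] by (simp add: lessThan_atLeast0)
  finally show ?thesis .
qed

lemma mapp_bdiag:
  assumes "A \<in> carrier_mat n n" "D \<in> carrier_mat n n" "i < n"
  shows "mapp (bdiag n A D) z i = mapp A z i" "mapp (bdiag n A D) z (i+n) = mapp D (\<lambda>j. z (j+n)) i"
  using assms bdiag_carrier[OF assms(1,2)]
  by (auto simp: mapp_eq[of _ "2*n" "2*n"] mapp_eq[of _ n n] sum_double bdiag_index)

lemma qform_bdiag:
  assumes "A \<in> carrier_mat n n" "D \<in> carrier_mat n n"
  shows "qform (bdiag n A D) z = qform A z + qform D (\<lambda>j. z (j+n))"
  using assms bdiag_carrier[OF assms]
  by (simp add: qform_mapp[of _ "2*n"] qform_mapp[of _ n] sum_double mapp_bdiag)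

lemma symm_bdiag:
  assumes "symm n A" "symm n D" shows "symm (2*n) (bdiag n A D)"
proof (rule symmI)
  note c = symm_carrier[OF assms(1)] symm_carrier[OF assms(2)]
  show "bdiag n A D \<in> carrier_mat (2*n) (2*n)" by (rule bdiag_carrier[OF c])
  fix i j assume "i < 2*n" "j < 2*n"
  then show "bdiag n A D $$ (i,j) = bdiag n A D $$ (j,i)"
    using c symm_index[OF assms(1)] symm_index[OF assms(2)] by (auto simp: bdiag_def)
qed

lemma nsq_double: "nsq (2*n) z = nsq n z + nsq n (\<lambda>j. z (j+n))"
  by (simp add: nsq_def sum_double)

lemma pd_bdiag:
  assumes "pd n A" "pd n D" shows "pd (2*n) (bdiag n A D)"
proof -
  obtain l where l: "l > 0" "\<And>x. l * nsq n x \<le> qform A x" using assms unfolding pd_def by auto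
  obtain k where k: "k > 0" "\<And>x. k * nsq n x \<le> qform D x" using assms unfolding pd_def by auto
  have "min l k * nsq (2*n) z \<le> qform (bdiag n A D) z" for z
  proof -
    have "min l k * nsq n z \<le> l * nsq n z" "min l k * nsq n (\<lambda>j. z (j+n)) \<le> k * nsq n (\<lambda>j. z (j+n))"
      by (auto intro!: mult_right_mono)
    then show ?thesis
      using l(2)[of z] k(2)[of "\<lambda>j. z (j+n)"]
      by (simp add: nsq_double qform_bdiag[OF pd_carrier[OF assms(1)] pd_carrier[OF assms(2)]] distrib_left)
  qed
  then show ?thesis
    unfolding pd_def using l(1) k(1) symm_bdiag[OF pd_symm[OF assms(1)] pd_symm[OF assms(2)]]
    by (intro conjI exI[of _ "min l k"]) auto
qed

lemma pd_scalar: "c > 0 \<Longrightarrow> pd n (c \<cdot>\<^sub>m 1\<^sub>m n)"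
  unfolding pd_def by (auto intro!: symm_smult symm_one exI[of _ c] simp: qform_smult[of _ n] qform_one)

lemma scalar_mult: "(c \<cdot>\<^sub>m 1\<^sub>m n) * (d \<cdot>\<^sub>m 1\<^sub>m n) = (c * d) \<cdot>\<^sub>m (1\<^sub>m n :: real mat)"
  by (simp add: mat_ring_simps[where n=n]) (intro eq_matI, auto)

lemma one_smult_mat: "1 \<cdot>\<^sub>m A = (A :: real mat)"
  by (intro eq_matI) auto

section \<open>Fourier transform of an isotropic Gaussian\<close>

text \<open>Rescaling to unit variance turns the integral into the characteristic function of the
  standard normal distribution.\<close>

lemma gaussian_fourier_1d:
  fixes s d :: real
  assumes "s > 0"
  shows "integrable lborel (\<lambda>p. complex_of_real (exp (- p\<^sup>2 / (2 * s))) * exp (\<i> * complex_of_real (p * d)))"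
    and "(\<integral>p. complex_of_real (exp (- p\<^sup>2 / (2 * s))) * exp (\<i> * complex_of_real (p * d)) \<partial>lborel) =
      complex_of_real (sqrt (2 * pi * s) * exp (- s * d\<^sup>2 / 2))"
proof -
  let ?f = "\<lambda>p. complex_of_real (exp (- p\<^sup>2 / (2 * s))) * exp (\<i> * complex_of_real (p * d))"
  have n: "exp (- p\<^sup>2 / (2 * s)) = sqrt (2 * pi * s) * normal_density 0 (sqrt s) p" for p
    using assms by (simp add: normal_density_def)
  have "integrable lborel (\<lambda>p. exp (- p\<^sup>2 / (2 * s)))"
    unfolding n using assms by (intro integrable_mult_right integrable_normal_density) auto
  then show "integrable lborel ?f"
    by (rule Bochner_Integration.integrable_bound) (auto simp: norm_mult)
  have "(\<integral>p. ?f p \<partial>lborel) = \<bar>sqrt s\<bar> *\<^sub>R (\<integral>u. ?f (0 + sqrt s * u) \<partial>lborel)"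
    using assms by (intro lborel_integral_real_affine) auto
  also have "(\<integral>u. ?f (0 + sqrt s * u) \<partial>lborel) =
     (\<integral>u. complex_of_real (sqrt (2 * pi)) * (std_normal_density u *\<^sub>R iexp ((sqrt s * d) * u)) \<partial>lborel)"
    using assms by (intro Bochner_Integration.integral_cong refl)
      (simp add: std_normal_density_def power_mult_distrib scaleR_conv_of_real algebra_simps)
  also have "\<dots> = complex_of_real (sqrt (2 * pi)) * char std_normal_distribution (sqrt s * d)"
  proof -
    have "char std_normal_distribution (sqrt s * d) = (\<integral>u. std_normal_density u *\<^sub>R iexp ((sqrt s * d) * u) \<partial>lborel)"
      unfolding char_def by (subst integral_density) auto
    then show ?thesis by (simp only: integral_mult_right_zero)
  qed
  also have "\<dots> = complex_of_real (sqrt (2 * pi) * exp (- s * d\<^sup>2 / 2))"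
    using assms by (simp add: char_std_normal_distribution power_mult_distrib)
  finally show "(\<integral>p. ?f p \<partial>lborel) = complex_of_real (sqrt (2 * pi * s) * exp (- s * d\<^sup>2 / 2))"
    using assms by (simp add: scaleR_conv_of_real real_sqrt_mult algebra_simps)
qed

lemma gaussian_fourier:
  fixes s :: real
  assumes "s > 0"
  shows "(\<integral>p. complex_of_real (exp (- nsq n p / (2 * s))) * exp (\<i> * complex_of_real (\<Sum>i<n. p i * d i)) \<partial>Rn n) =
    complex_of_real (sqrt (2 * pi * s) ^ n * exp (- s * nsq n d / 2))"
proof -
  have "complex_of_real (exp (- nsq n p / (2 * s))) * exp (\<i> * complex_of_real (\<Sum>i<n. p i * d i)) =
      (\<Prod>i<n. complex_of_real (exp (- (p i)\<^sup>2 / (2 * s))) * exp (\<i> * complex_of_real (p i * d i)))" for p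
    by (simp add: nsq_def prod.distrib exp_sum[symmetric] sum_distrib_left sum_divide_distrib sum_negf
        flip: of_real_prod exp_of_real)
  then have "(\<integral>p. complex_of_real (exp (- nsq n p / (2 * s))) * exp (\<i> * complex_of_real (\<Sum>i<n. p i * d i)) \<partial>Rn n) =
     (\<Prod>i<n. \<integral>p. complex_of_real (exp (- p\<^sup>2 / (2 * s))) * exp (\<i> * complex_of_real (p * d i)) \<partial>lborel)"
    unfolding Rn_def by (simp only:) (intro lb.product_integral_prod gaussian_fourier_1d assms, auto)
  also have "\<dots> = (\<Prod>i<n. complex_of_real (sqrt (2 * pi * s) * exp (- s * (d i)\<^sup>2 / 2)))"
    by (simp only: gaussian_fourier_1d[OF assms])
  also have "\<dots> = complex_of_real (sqrt (2 * pi * s) ^ n * exp (- s * nsq n d / 2))"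
    by (simp add: nsq_def prod.distrib exp_sum[symmetric] sum_distrib_left sum_divide_distrib sum_negf power_mult_distrib
        flip: of_real_prod exp_of_real)
  finally show ?thesis .
qed

section \<open>Single excitations of the squeezed vacuum, and the noisy squeezed states\<close>

text \<open>One excitation in mode \<open>i\<close> above the squeezed vacuum, whose wave function
  is proportional to \<open>exp (- s * nsq n x)\<close>. Its position variance is
  \<open>1 / (4 * s)\<close>, hence the factor \<open>4 * s\<close> in the normalisation of this
  first Hermite function.\<close>

definition psi :: "nat \<Rightarrow> real \<Rightarrow> nat \<Rightarrow> (nat \<Rightarrow> real) \<Rightarrow> real" where
  "psi n s i x = sqrt (4 * s * sqrt ((2 * s / pi) ^ n)) * (x i * exp (- s * nsq n x))"

lemma qform_scalar: "qform (c \<cdot>\<^sub>m 1\<^sub>m n) x = c * nsq n x"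
  by (simp add: qform_smult[of _ n] qform_one)

lemma psi_integrable:
  assumes "s > 0" "i < n" shows "integrable (Rn n) (psi n s i)"
proof -
  have "integrable (Rn n) (\<lambda>x. x i * exp (- qform ((2 * s) \<cdot>\<^sub>m 1\<^sub>m n) x / 2))"
    using assms by (intro gaussian_moment_integrable[OF pd_scalar]) auto
  then show ?thesis unfolding psi_def[abs_def] by (intro integrable_mult_right) (simp add: qform_scalar)
qed

lemma psi_orthonormal:
  assumes "s > 0" "i < n" "j < n"
  shows "integrable (Rn n) (\<lambda>x. psi n s i x * psi n s j x)"
    and "(\<integral>x. psi n s i x * psi n s j x \<partial>Rn n) = (if i = j then 1 else 0)"
proof -
  let ?A = "(4 * s) \<cdot>\<^sub>m 1\<^sub>m n" and ?B = "(1 / (4 * s)) \<cdot>\<^sub>m 1\<^sub>m n :: real mat"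
  define k where "k = 4 * s * sqrt ((2 * s / pi) ^ n)"
  have A: "pd n ?A" using assms by (intro pd_scalar) auto
  have k: "k \<ge> 0" using assms by (simp add: k_def)
  have p: "psi n s i x * psi n s j x = k * (x i * x j * exp (- qform ?A x / 2))" for x
  proof -
    have "exp (- qform ?A x / 2) = exp (- s * nsq n x) * exp (- s * nsq n x)"
      by (simp add: qform_scalar exp_add[symmetric])
    then show ?thesis unfolding psi_def k_def[symmetric] using k by (simp add: ac_simps)
  qed
  show "integrable (Rn n) (\<lambda>x. psi n s i x * psi n s j x)"
    unfolding p by (intro integrable_mult_right gaussian_moment_integrable A assms)
  have "(\<integral>x. psi n s i x * psi n s j x \<partial>Rn n) = k * (gaussZ n ?A * ?B $$ (i,j))"
    unfolding p integral_mult_right_zero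
    using assms by (subst gaussian_moments(1)[OF A, of ?B]) (auto simp: scalar_mult one_smult_mat)
  also have "\<dots> = (if i = j then 1 else 0)"
  proof -
    have "sqrt ((2 * s / pi) ^ n) * sqrt ((2 * pi) ^ n / (4 * s) ^ n) = 1"
    proof -
      have "(2 * s / pi) * (2 * pi / (4 * s)) = 1" using assms by simp
      then have "(2 * s / pi) ^ n * ((2 * pi) ^ n / (4 * s) ^ n) = 1"
        unfolding power_divide[symmetric] power_mult_distrib[symmetric] by (metis power_one)
      then show ?thesis by (simp add: real_sqrt_mult[symmetric])
    qed
    then have "k * gaussZ n ?A = 4 * s" by (simp add: k_def gaussZ_def)
    then show ?thesis using assms by (auto simp: mult.assoc[symmetric])
  qed
  finally show "(\<integral>x. psi n s i x * psi n s j x \<partial>Rn n) = (if i = j then 1 else 0)" .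
qed

text \<open>\<open>s\<close> is the momentum variance, later set to the energy bound.
  \<open>G_eq\<close> presents \<open>G\<close> as a multiple of a square, which yields positivity
  without eigenvalues.\<close>

locale gstate = small_symm +
  fixes s g :: real and Z :: "real mat"
  assumes s: "s > 0" and g: "g \<ge> 0" and Z: "symm n Z" and G_eq: "G = g \<cdot>\<^sub>m (Z * Z)"
begin

definition "Sx = (1 / (4 * s)) \<cdot>\<^sub>m (2 \<cdot>\<^sub>m R - 1\<^sub>m n)"
definition "Sxi = (4 * s) \<cdot>\<^sub>m (2 \<cdot>\<^sub>m Rp - 1\<^sub>m n)"
definition "Sig = bdiag n Sx (s \<cdot>\<^sub>m 1\<^sub>m n)"
definition "ck = sqrt (Determinant.det Sxi / (2 * pi) ^ n)"
text \<open>The population of the squeezed vacuum in the state: without the two coordinate factors,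
  the integral of \<open>matrix_element\<close> reduces to this constant.\<close>

definition "vac = sqrt (Determinant.det (1\<^sub>m n - G))"

lemma pd_Sx: "pd n Sx" unfolding Sx_def using s by (intro pd_smult pd_cayley) auto
lemma pd_Sxi: "pd n Sxi" unfolding Sxi_def using s by (intro pd_smult pd_cayley) auto
lemma Sx: "Sx \<in> carrier_mat n n" by (rule pd_carrier[OF pd_Sx])
lemma Sxi: "Sxi \<in> carrier_mat n n" by (rule pd_carrier[OF pd_Sxi])
lemma Sig: "Sig \<in> carrier_mat (2*n) (2*n)" unfolding Sig_def by (intro bdiag_carrier Sx) auto

lemma Sx_Sxi: "Sx * Sxi = 1\<^sub>m n"
proof -
  have "Sx * Sxi = (1 / (4 * s)) \<cdot>\<^sub>m ((4 * s) \<cdot>\<^sub>m ((2 \<cdot>\<^sub>m R - 1\<^sub>m n) * (2 \<cdot>\<^sub>m Rp - 1\<^sub>m n)))"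
    unfolding Sx_def Sxi_def
    using mr(5)[OF pd_carrier[OF pd_cayley(1)] mr(13)[OF pd_carrier[OF pd_cayley(2)]]]
      mr(6)[OF pd_carrier[OF pd_cayley(1)] pd_carrier[OF pd_cayley(2)]] by simp
  then show ?thesis unfolding cayley_inverse using s by (intro eq_matI) auto
qed

lemma Sig_eq: "the (mat_inverse Sig) = bdiag n Sxi ((1 / s) \<cdot>\<^sub>m 1\<^sub>m n)"
proof -
  have "minv Sig = bdiag n Sxi ((1 / s) \<cdot>\<^sub>m 1\<^sub>m n)"
    unfolding Sig_def using s
    by (intro minv_eqI[of _ "2*n"] bdiag_carrier Sx Sxi)
      (auto simp: bdiag_mult Sx Sxi Sx_Sxi scalar_mult one_smult_mat bdiag_one)
  then show ?thesis by (simp add: minv_def)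
qed

lemma det_Sig: "Determinant.det Sig = Determinant.det Sx * s ^ n"
  unfolding Sig_def using Sx by (simp add: det_bdiag)

lemma det_Sx_Sxi: "Determinant.det Sx * Determinant.det Sxi = 1"
  using det_mult[OF Sx Sxi] by (simp add: Sx_Sxi)

text \<open>The momentum block is isotropic, so the inverse Weyl transform is a product of
  one-dimensional Fourier integrals; the position block enters through its inverse
  \<open>Sxi\<close> at the midpoint.\<close>

lemma kernel_eq:
  "gauss_state_kernel n Sig a b = complex_of_real
     (ck * exp (- qform Sxi (\<lambda>i. a i + b i) / 8 - s * nsq n (\<lambda>i. a i - b i) / 2))"
proof -
  define x where "x = (\<lambda>i. (a i + b i) / 2)"
  define d where "d = (\<lambda>i. a i - b i)"
  define D where "D = sqrt ((2 * pi) ^ (2 * n) * (Determinant.det Sx * s ^ n))"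
  have qx: "qform Sxi x / 2 = qform Sxi (\<lambda>i. a i + b i) / 8"
    unfolding x_def by (simp add: qform_eq[OF Sxi] sum_divide_distrib)
  have w: "wigner_gauss n Sig x p = exp (- qform Sxi x / 2) / D * exp (- nsq n p / (2 * s))" for p
  proof -
    have "qform Sxi (join_xp n x p) = qform Sxi x"
      by (rule qform_cong[OF Sxi]) (simp add: join_xp_def)
    moreover have "(\<lambda>j. join_xp n x p (j + n)) = p" by (auto simp: join_xp_def)
    ultimately have "qform (bdiag n Sxi ((1 / s) \<cdot>\<^sub>m 1\<^sub>m n)) (join_xp n x p) = qform Sxi x + nsq n p / s"
      using Sxi by (simp add: qform_bdiag qform_scalar)
    then show ?thesis
      unfolding wigner_gauss_def gauss_density_def Sig_eq det_Sig D_def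
      by (simp add: exp_add[symmetric] add_divide_distrib mult.commute)
  qed
  have "gauss_state_kernel n Sig a b = (\<integral>p. complex_of_real (exp (- qform Sxi x / 2) / D) *
      (complex_of_real (exp (- nsq n p / (2 * s))) * exp (\<i> * complex_of_real (\<Sum>i<n. p i * d i))) \<partial>Rn n)"
    unfolding gauss_state_kernel_def x_def[symmetric] w by (simp add: d_def mult.assoc)
  also have "\<dots> = complex_of_real (exp (- qform Sxi x / 2) / D) * complex_of_real (sqrt (2 * pi * s) ^ n * exp (- s * nsq n d / 2))"
    unfolding integral_mult_right_zero gaussian_fourier[OF s] ..
  also have "\<dots> = complex_of_real (sqrt (2 * pi * s) ^ n / D * exp (- qform Sxi (\<lambda>i. a i + b i) / 8 - s * nsq n d / 2))"
  proof -
    have "- qform Sxi (\<lambda>i. a i + b i) / 8 - s * nsq n d / 2 = - qform Sxi x / 2 + - s * nsq n d / 2"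
      using qx by simp
    then have "exp (- qform Sxi (\<lambda>i. a i + b i) / 8 - s * nsq n d / 2) = exp (- qform Sxi x / 2) * exp (- s * nsq n d / 2)"
      by (simp only: exp_add)
    then show ?thesis unfolding of_real_mult[symmetric] by (simp add: ac_simps)
  qed
  also have "sqrt (2 * pi * s) ^ n / D = ck"
  proof -
    have dS: "Determinant.det Sx > 0" by (rule pd_det_pos[OF pd_Sx])
    have dSi: "Determinant.det Sxi = 1 / Determinant.det Sx" using det_Sx_Sxi dS by (simp add: field_simps)
    have "sqrt (2 * pi * s) ^ n / D = sqrt ((2 * pi * s) ^ n / ((2 * pi) ^ (2 * n) * (Determinant.det Sx * s ^ n)))"
      by (simp add: D_def real_sqrt_power real_sqrt_divide)
    also have "(2 * pi * s) ^ n / ((2 * pi) ^ (2 * n) * (Determinant.det Sx * s ^ n)) = Determinant.det Sxi / (2 * pi) ^ n"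
    proof -
      define P where "P = (2 * pi) ^ n"
      have "P > 0" by (simp add: P_def)
      moreover have "(2 * pi) ^ (2 * n) = P * P" unfolding P_def by (metis mult_2 power_add)
      moreover have "(2 * pi * s) ^ n = P * s ^ n" unfolding P_def by (rule power_mult_distrib)
      ultimately show ?thesis
        unfolding P_def[symmetric] dSi using s dS by (simp add: field_simps)
    qed
    finally show ?thesis by (simp add: ck_def)
  qed
  finally show ?thesis by (simp only: d_def)
qed

lemma qform_Sxi: "qform Sxi x = 4 * s * (2 * qform Rp x - nsq n x)"
  using Rp(1) by (simp add: Sxi_def qform_smult[of _ n] qform_minus[of _ n] qform_one mr)

text \<open>Once the two vacuum factors are included the exponent decouples: the half-difference is
  isotropic and the sum carries \<open>Rp\<close>, so \<open>G\<close> enters through one variable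
  only.\<close>

lemma exponent_mean_diff:
  fixes z :: "(nat \<Rightarrow> real) \<times> (nat \<Rightarrow> real)"
  defines "x \<equiv> fst (mean_diff n z)" and "y \<equiv> snd (mean_diff n z)"
  shows "s * nsq n x + s * nsq n y + (qform Sxi (\<lambda>i. x i + y i) / 8 + s * nsq n (\<lambda>i. x i - y i) / 2) =
    qform ((8 * s) \<cdot>\<^sub>m 1\<^sub>m n) (fst z) / 2 + qform ((2 * s) \<cdot>\<^sub>m Rp) (snd z) / 2"
proof -
  obtain a c where z: "z = (a, c)" by (cases z)
  have xy: "x i = a i + c i / 2" "y i = c i / 2 - a i" if "i < n" for i
    using that by (auto simp: x_def y_def z mean_diff_def)
  have "qform Sxi (\<lambda>i. x i + y i) = qform Sxi c"
    by (rule qform_cong[OF Sxi]) (simp add: xy)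
  then have "qform Sxi (\<lambda>i. x i + y i) / 8 = s * qform Rp c - s * nsq n c / 2"
    by (simp only: qform_Sxi[of c]) (simp add: diff_divide_distrib right_diff_distrib)
  moreover have "nsq n (\<lambda>i. x i - y i) = 4 * nsq n a"
    by (simp add: nsq_def xy sum_distrib_left power2_eq_square)
  moreover have "nsq n x + nsq n y = 2 * nsq n a + nsq n c / 2"
    by (simp add: nsq_def xy sum_distrib_left sum_divide_distrib sum.distrib[symmetric])
      (rule sum.cong, simp_all add: power2_eq_square field_simps)
  then have "s * nsq n x + s * nsq n y = s * (2 * nsq n a + nsq n c / 2)" by (metis distrib_left)
  ultimately show ?thesis
    using Rp(1) by (simp add: z qform_scalar qform_smult[of _ n] algebra_simps)
qed

text \<open>In the decoupled variables the coordinate product is (c_i / 2 + a_i) (c_j / 2 - a_j).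
  Its mean is one quarter of the covariance (1 + G) / (2 s) of c, minus the covariance 1 / (8 s) of
  a: the identities cancel and G / (8 s) remains.\<close>

lemma matrix_element:
  assumes i: "i < n" and j: "j < n"
  shows "(\<integral>z. psi n s i (fst z) * (ck * exp (- qform Sxi (\<lambda>i. fst z i + snd z i) / 8 - s * nsq n (\<lambda>i. fst z i - snd z i) / 2)) *
      psi n s j (snd z) \<partial>(Rn n \<Otimes>\<^sub>M Rn n)) = vac * G $$ (i,j) / 2"
proof -
  let ?P = "Rn n \<Otimes>\<^sub>M Rn n"
  define k where "k = 4 * s * sqrt ((2 * s / pi) ^ n)"
  have k: "k \<ge> 0" using s by (simp add: k_def)
  define q where "q z = qform Sxi (\<lambda>i. fst z i + snd z i) / 8 + s * nsq n (\<lambda>i. fst z i - snd z i) / 2" for z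
  define f where "f z = fst z i * snd z j * exp (- (s * nsq n (fst z) + s * nsq n (snd z) + q z))" for z
  define A where "A = (8 * s) \<cdot>\<^sub>m (1\<^sub>m n :: real mat)"
  define B where "B = (2 * s) \<cdot>\<^sub>m Rp"
  have pA: "pd n A" using s by (simp add: A_def pd_scalar)
  have pB: "pd n B" unfolding B_def using s by (intro pd_smult pd_Rp) auto
  have iA: "(1 / (8 * s)) \<cdot>\<^sub>m 1\<^sub>m n \<in> carrier_mat n n" "(1 / (8 * s)) \<cdot>\<^sub>m 1\<^sub>m n * A = 1\<^sub>m n"
    using s by (auto simp: A_def scalar_mult one_smult_mat)
  have iB: "(1 / (2 * s)) \<cdot>\<^sub>m (1\<^sub>m n + G) \<in> carrier_mat n n" "(1 / (2 * s)) \<cdot>\<^sub>m (1\<^sub>m n + G) * B = 1\<^sub>m n"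
  proof -
    show "(1 / (2 * s)) \<cdot>\<^sub>m (1\<^sub>m n + G) \<in> carrier_mat n n" using G by simp
    have "(1 / (2 * s)) \<cdot>\<^sub>m (1\<^sub>m n + G) * B = (1 / (2 * s)) \<cdot>\<^sub>m ((2 * s) \<cdot>\<^sub>m ((1\<^sub>m n + G) * Rp))"
      unfolding B_def using mr(5)[OF pd_carrier[OF pp] mr(13)[OF Rp(1)]] mr(6)[OF pd_carrier[OF pp] Rp(1)] by simp
    then show "(1 / (2 * s)) \<cdot>\<^sub>m (1\<^sub>m n + G) * B = 1\<^sub>m n"
      unfolding Rp(2) using s by (intro eq_matI) auto
  qed
  note co = Rn_pair_coord[of _ n]
  note [measurable] = co[OF i] co[OF j]
  have [measurable]: "q \<in> borel_measurable ?P"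
    unfolding q_def[abs_def] qform_eq[OF Sxi] nsq_def using co by measurable
  have [measurable]: "f \<in> borel_measurable ?P"
    unfolding f_def[abs_def] by measurable
  have "(\<integral>z. psi n s i (fst z) * (ck * exp (- qform Sxi (\<lambda>i. fst z i + snd z i) / 8 - s * nsq n (\<lambda>i. fst z i - snd z i) / 2)) *
      psi n s j (snd z) \<partial>?P) = (\<integral>z. (k * ck) * f z \<partial>?P)"
  proof (rule Bochner_Integration.integral_cong[OF refl])
    fix z :: "(nat \<Rightarrow> real) \<times> (nat \<Rightarrow> real)"
    have e: "exp (- (s * nsq n (fst z) + s * nsq n (snd z) + q z)) = exp (- s * nsq n (fst z)) *
       exp (- qform Sxi (\<lambda>i. fst z i + snd z i) / 8 - s * nsq n (\<lambda>i. fst z i - snd z i) / 2) * exp (- s * nsq n (snd z))"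
      by (simp add: exp_add[symmetric] q_def)
    show "psi n s i (fst z) * (ck * exp (- qform Sxi (\<lambda>i. fst z i + snd z i) / 8 - s * nsq n (\<lambda>i. fst z i - snd z i) / 2)) *
      psi n s j (snd z) = (k * ck) * f z"
      unfolding f_def e psi_def k_def[symmetric] using k by (simp add: ac_simps)
  qed
  also have "\<dots> = (k * ck) * (\<integral>z. f (mean_diff n z) \<partial>?P)"
    unfolding integral_mult_right_zero by (subst integral_mean_diff) auto
  also have "(\<integral>z. f (mean_diff n z) \<partial>?P) = gaussZ n A * gaussZ n B * G $$ (i,j) / (8 * s)"
  proof -
    define ea where "ea x = exp (- qform A x / 2)" for x
    define ec where "ec x = exp (- qform B x / 2)" for x
    \<comment> \<open>The last two products are odd in each variable and integrate to zero.\<close>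
    have fm: "f (mean_diff n z) = (1/4) * (ea (fst z) * (snd z i * snd z j * ec (snd z)))
        - (fst z i * fst z j * ea (fst z)) * ec (snd z)
        + (1/2) * ((fst z i * ea (fst z)) * (snd z j * ec (snd z)))
        - (1/2) * ((fst z j * ea (fst z)) * (snd z i * ec (snd z)))" for z
    proof -
      obtain a c where z: "z = (a, c)" by (cases z)
      have "exp (- (s * nsq n (fst (mean_diff n z)) + s * nsq n (snd (mean_diff n z)) + q (mean_diff n z))) = ea (fst z) * ec (snd z)"
        unfolding q_def exponent_mean_diff ea_def ec_def A_def B_def by (simp add: exp_add[symmetric])
      then show ?thesis unfolding f_def using i j by (simp add: z mean_diff_def algebra_simps)
    qed
    have i0a: "integrable (Rn n) ea" unfolding ea_def[abs_def] by (rule gaussian_integral[OF pA])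
    have i0c: "integrable (Rn n) ec" unfolding ec_def[abs_def] by (rule gaussian_integral[OF pB])
    have i1a: "integrable (Rn n) (\<lambda>x. x l * ea x)" if "l < n" for l unfolding ea_def[abs_def]
      using gaussian_moment_integrable[OF pA that that] by simp
    have i1c: "integrable (Rn n) (\<lambda>x. x l * ec x)" if "l < n" for l unfolding ec_def[abs_def]
      using gaussian_moment_integrable[OF pB that that] by simp
    have i2a: "integrable (Rn n) (\<lambda>x. x i * x j * ea x)" unfolding ea_def[abs_def]
      using gaussian_moment_integrable[OF pA i j] by simp
    have i2c: "integrable (Rn n) (\<lambda>x. x i * x j * ec x)" unfolding ec_def[abs_def]
      using gaussian_moment_integrable[OF pB i j] by simp
    note I = integrable_product_Rn(1)[OF i0a i2c] integrable_product_Rn(1)[OF i2a i0c]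
      integrable_product_Rn(1)[OF i1a[OF i] i1c[OF j]] integrable_product_Rn(1)[OF i1a[OF j] i1c[OF i]]
    note J = integrable_product_Rn(2)[OF i0a i2c] integrable_product_Rn(2)[OF i2a i0c]
      integrable_product_Rn(2)[OF i1a[OF i] i1c[OF j]] integrable_product_Rn(2)[OF i1a[OF j] i1c[OF i]]
    have v: "(\<integral>x. ea x \<partial>Rn n) = gaussZ n A" "(\<integral>x. ec x \<partial>Rn n) = gaussZ n B"
      unfolding ea_def ec_def by (rule gaussian_integral(2)[OF pA], rule gaussian_integral(2)[OF pB])
    have v1: "(\<integral>x. x l * ea x \<partial>Rn n) = 0" if "l < n" for l
      unfolding ea_def by (rule gaussian_moments(2)[OF pA iA that])
    have v2: "(\<integral>x. x i * x j * ea x \<partial>Rn n) = gaussZ n A * ((1 / (8 * s)) \<cdot>\<^sub>m 1\<^sub>m n) $$ (i,j)"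
      unfolding ea_def by (rule gaussian_moments(1)[OF pA iA i j])
    have v3: "(\<integral>x. x i * x j * ec x \<partial>Rn n) = gaussZ n B * ((1 / (2 * s)) \<cdot>\<^sub>m (1\<^sub>m n + G)) $$ (i,j)"
      unfolding ec_def by (rule gaussian_moments(1)[OF pB iB i j])
    have "(\<integral>z. f (mean_diff n z) \<partial>?P) = (1/4) * (gaussZ n A * (gaussZ n B * ((1 / (2 * s)) \<cdot>\<^sub>m (1\<^sub>m n + G)) $$ (i,j)))
       - gaussZ n A * ((1 / (8 * s)) \<cdot>\<^sub>m 1\<^sub>m n) $$ (i,j) * gaussZ n B"
      unfolding fm using I by (simp add: J v v1 v2 v3 i j del: index_smult_mat)
    also have "\<dots> = gaussZ n A * gaussZ n B * G $$ (i,j) / (8 * s)"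
      using i j G by (simp add: algebra_simps)
    finally show ?thesis .
  qed
  also have "(k * ck) * (gaussZ n A * gaussZ n B * G $$ (i,j) / (8 * s)) = vac * G $$ (i,j) / 2"
  proof -
    have dR: "Determinant.det Rp > 0" by (rule pd_det_pos[OF pd_Rp])
    have "sqrt ((2 * s / pi) ^ n) * ck * gaussZ n A * gaussZ n B = 
       sqrt ((2 * s / pi) ^ n * (Determinant.det Sxi / (2 * pi) ^ n) * ((2 * pi) ^ n / Determinant.det A) * ((2 * pi) ^ n / Determinant.det B))"
      by (simp only: ck_def gaussZ_def real_sqrt_mult)
    also have "(2 * s / pi) ^ n * (Determinant.det Sxi / (2 * pi) ^ n) * ((2 * pi) ^ n / Determinant.det A) * ((2 * pi) ^ n / Determinant.det B) =
       ((2 * s / pi) ^ n * (4 * s) ^ n / (8 * s) ^ n * (2 * pi) ^ n / (2 * s) ^ n) * Determinant.det (1\<^sub>m n - G)"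
      using dR Rp(1) by (simp add: Sxi_def A_def B_def det_cayley mr)
    also have "(2 * s / pi) ^ n * (4 * s) ^ n / (8 * s) ^ n * (2 * pi) ^ n / (2 * s) ^ n = 1"
    proof -
      have "(2 * s / pi) * (4 * s) / (8 * s) * (2 * pi) / (2 * s) = 1" using s by simp
      then show ?thesis unfolding power_divide[symmetric] power_mult_distrib[symmetric] by (metis power_one)
    qed
    finally have e: "sqrt ((2 * s / pi) ^ n) * ck * gaussZ n A * gaussZ n B = vac" by (simp add: vac_def)
    have "(k * ck) * (gaussZ n A * gaussZ n B * G $$ (i,j) / (8 * s)) =
       (sqrt ((2 * s / pi) ^ n) * ck * gaussZ n A * gaussZ n B) * G $$ (i,j) * (4 * s / (8 * s))"
      by (simp add: k_def)
    also have "4 * s / (8 * s) = 1 / 2" using s by simp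
    finally show ?thesis unfolding e by simp
  qed
  finally show ?thesis .
qed

text \<open>Sandwiching F = G / (1 - G) between factors 1 - G leaves G - G^2. For G = g Z^2 and w =
  Z y its value at y is g (|w|^2 - w^T G w), nonnegative because \<open>frob G < 1\<close>.\<close>

lemma qform_F_nonneg: "0 \<le> qform F x"
proof -
  define y where "y = mapp R x"
  have x: "mapp (1\<^sub>m n - G) y i = x i" if "i < n" for i
    using mapp_mult[OF pd_carrier[OF pm] R(1) that, of x] that unfolding R(2) y_def by (simp add: mapp_one)
  have e: "(1\<^sub>m n - G) * F * (1\<^sub>m n - G) = G - G * G"
  proof -
    have "F * (1\<^sub>m n - G) = G * (R * (1\<^sub>m n - G))"
      unfolding G_R[symmetric] by (rule mr(7)[OF G R(1) pd_carrier[OF pm]])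
    then have "F * (1\<^sub>m n - G) = G" unfolding R(3) using G by simp
    moreover have "(1\<^sub>m n - G) * F * (1\<^sub>m n - G) = (1\<^sub>m n - G) * (F * (1\<^sub>m n - G))"
      by (rule mr(7)[OF pd_carrier[OF pm] F pd_carrier[OF pm]])
    ultimately show ?thesis using G by (simp add: mr)
  qed
  have "qform F x = qform F (mapp (1\<^sub>m n - G) y)" by (rule qform_cong[OF F]) (simp add: x)
  also have "\<dots> = qform (G - G * G) y"
    unfolding e[symmetric] by (rule qform_sandwich[OF pd_symm[OF pm] F, symmetric])
  also have "\<dots> = qform G y - nsq n (mapp G y)"
    using G by (simp add: qform_minus[of _ n] qform_square[OF symm])
  also have "\<dots> \<ge> 0"
  proof -
    define w where "w = mapp Z y"
    note Zc = symm_carrier[OF Z]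
    have q: "qform G u = g * nsq n (mapp Z u)" for u
      unfolding G_eq using Zc by (simp add: qform_smult[of _ n] qform_square[OF Z])
    have Gy: "mapp G y i = g * mapp Z w i" if "i < n" for i
      unfolding G_eq w_def using that Zc by (simp add: mapp_smult[of _ n n] mapp_mult[of Z n n Z n])
    have "nsq n (mapp G y) = g * (g * nsq n (mapp Z w))"
      by (simp add: nsq_def Gy sum_distrib_left power2_eq_square mult.assoc mult.left_commute)
    also have "\<dots> = g * qform G w" by (simp only: q)
    also have "\<dots> \<le> g * nsq n w"
    proof (intro mult_left_mono g)
      have "qform G w \<le> frob G * nsq n w" using qform_le_frob[OF G, of w] by simp
      also have "\<dots> \<le> 1 * nsq n w" using small by (intro mult_right_mono) auto
      finally show "qform G w \<le> nsq n w" by simp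
    qed
    also have "\<dots> = qform G y" by (simp add: q w_def)
    finally show ?thesis by simp
  qed
  finally show ?thesis .
qed

lemma Sx_F: "Sx = (1 / (4 * s)) \<cdot>\<^sub>m (1\<^sub>m n + 2 \<cdot>\<^sub>m F)"
  unfolding Sx_def F_def using R(1) by (intro eq_matI) (auto simp: algebra_simps)

lemma qform_Sig_ge: "nsq n v / (4 * s) + s * nsq n (\<lambda>j. v (j + n)) \<le> qform Sig v"
  unfolding Sig_def using Sx F qform_F_nonneg[of v] s
  by (simp add: qform_bdiag qform_scalar)
    (simp add: Sx_F qform_smult[of _ n] qform_add[of _ n] qform_one divide_right_mono)

text \<open>The noise only adds to the covariance of a pure squeezed vacuum, for which the
  uncertainty relation is the weighted arithmetic-geometric mean inequality \<open>am\<close>. Real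
  and imaginary parts of \<open>v\<close> enter the form separately and meet only in the symplectic
  term \<open>\<omega>\<close>.\<close>

lemma quantum_cov_Sig: "quantum_cov n Sig"
  unfolding quantum_cov_def
proof (intro conjI allI)
  show "Sig \<in> carrier_mat (2*n) (2*n)" by (rule Sig)
  have sS: "symm (2*n) Sig" unfolding Sig_def by (intro symm_bdiag pd_symm pd_Sx symm_smult symm_one)
  then show "transpose_mat Sig = Sig" by (simp add: symm_def)
  fix v :: "nat \<Rightarrow> complex"
  define a b where "a j = Re (v j)" and "b j = Im (v j)" for j
  define \<omega> where "\<omega> = (\<Sum>j<n. a j * b (j+n) - a (j+n) * b j)"
  have t: "Re (cnj (v j) * (complex_of_real (Sig $$ (j,k)) + \<i> / 2 * complex_of_real (Omega n $$ (j,k))) * v k) =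
     (a j * Sig $$ (j,k) * a k + b j * Sig $$ (j,k) * b k) + Omega n $$ (j,k) * (b j * a k - a j * b k) / 2" for j k
    by (simp add: a_def b_def algebra_simps)
  have O: "Omega n $$ (j,k) = 0" "Omega n $$ (j+n,k+n) = 0" "Omega n $$ (j,k+n) = (if j = k then 1 else 0)"
    "Omega n $$ (j+n,k) = (if j = k then -1 else 0)" if "j < n" "k < n" for j k
    using that by (auto simp: Omega_def)
  have "(\<Sum>j<2*n. \<Sum>k<2*n. Omega n $$ (j,k) * (b j * a k - a j * b k) / 2) = - \<omega>"
    by (simp add: sum_double sum.distrib O \<omega>_def sum_subtractf sum_negf if_distrib[of "\<lambda>t. t * _"] if_distrib[of "\<lambda>t. t / _"] cong: if_cong)
      (simp add: sum_subtractf[symmetric] sum_negf[symmetric] sum.distrib[symmetric] field_simps, rule sum.cong, simp_all)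
  then have re: "Re (\<Sum>j<2*n. \<Sum>k<2*n. cnj (v j) * (complex_of_real (Sig $$ (j,k)) + \<i> / 2 * complex_of_real (Omega n $$ (j,k))) * v k) =
     qform Sig a + qform Sig b - \<omega>"
    unfolding Re_sum t by (simp add: sum.distrib qform_eq[OF Sig])
  have am: "x * y \<le> x\<^sup>2 / (4 * s) + s * y\<^sup>2" for x y :: real
  proof -
    have "0 \<le> (x - 2 * s * y)\<^sup>2 / (4 * s)" using s by simp
    also have "\<dots> = x\<^sup>2 / (4 * s) + s * y\<^sup>2 - x * y" using s by (simp add: power2_eq_square field_simps)
    finally show ?thesis by simp
  qed
  have "\<omega> \<le> (\<Sum>j<n. ((a j)\<^sup>2 / (4 * s) + s * (b (j+n))\<^sup>2) + ((b j)\<^sup>2 / (4 * s) + s * (a (j+n))\<^sup>2))"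
    unfolding \<omega>_def
  proof (rule sum_mono)
    fix j
    show "a j * b (j+n) - a (j+n) * b j \<le> ((a j)\<^sup>2 / (4 * s) + s * (b (j+n))\<^sup>2) + ((b j)\<^sup>2 / (4 * s) + s * (a (j+n))\<^sup>2)"
      using am[of "a j" "b (j+n)"] am[of "- b j" "a (j+n)"] by (simp add: mult.commute)
  qed
  also have "\<dots> = (nsq n a / (4 * s) + s * nsq n (\<lambda>j. a (j + n))) + (nsq n b / (4 * s) + s * nsq n (\<lambda>j. b (j + n)))"
    by (simp add: nsq_def sum.distrib sum_distrib_left sum_divide_distrib)
  also have "\<dots> \<le> qform Sig a + qform Sig b" by (intro add_mono qform_Sig_ge)
  finally show "0 \<le> Re (\<Sum>j<2*n. \<Sum>k<2*n. cnj (v j) * (complex_of_real (Sig $$ (j,k)) + \<i> / 2 * complex_of_real (Omega n $$ (j,k))) * v k)"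
    unfolding re by simp
qed

text \<open>The momentum block is responsible for the bound \<open>s\<close>; the position block has
  norm at most one, since (x + 2 f)^2 \<le> 2 x^2 + 8 f^2 and the bound on \<open>F\<close> leave a
  factor 10 / 16.\<close>

lemma op_norm_Sig:
  assumes "1 \<le> s" "frob F \<le> 1"
  shows "op_norm_le n Sig s"
  unfolding op_norm_le_def
proof
  fix x :: "nat \<Rightarrow> real"
  define y where "y = (\<lambda>j. x (j + n))"
  have "nsq n (mapp Sx x) \<le> s\<^sup>2 * nsq n x"
  proof -
    have "nsq n (mapp Sx x) = (\<Sum>i<n. (x i + 2 * mapp F x i)\<^sup>2 / (4 * s)\<^sup>2)"
      unfolding nsq_def Sx_F using F
      by (intro sum.cong refl) (simp add: mapp_smult[of _ n n] mapp_add[of _ n n] mapp_one power_divide)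
    also have "\<dots> \<le> (\<Sum>i<n. (2 * (x i)\<^sup>2 + 8 * (mapp F x i)\<^sup>2) / (4 * s)\<^sup>2)"
    proof (intro sum_mono divide_right_mono)
      fix i
      have "0 \<le> (x i - 2 * mapp F x i)\<^sup>2" by simp
      then show "(x i + 2 * mapp F x i)\<^sup>2 \<le> 2 * (x i)\<^sup>2 + 8 * (mapp F x i)\<^sup>2"
        by (simp add: power2_eq_square algebra_simps)
    qed auto
    also have "\<dots> = (2 * nsq n x + 8 * nsq n (mapp F x)) / (4 * s)\<^sup>2"
      by (simp add: nsq_def sum_divide_distrib[symmetric] sum.distrib sum_distrib_left)
    also have "\<dots> \<le> (10 * nsq n x) / (4 * s)\<^sup>2"
    proof (rule divide_right_mono)
      have "nsq n (mapp F x) \<le> (frob F)\<^sup>2 * nsq n x" by (rule nsq_mapp_le[OF F])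
      also have "\<dots> \<le> 1 * nsq n x" using assms(2) by (intro mult_right_mono) (auto simp: abs_square_le_1)
      finally show "2 * nsq n x + 8 * nsq n (mapp F x) \<le> 10 * nsq n x" by simp
    qed auto
    also have "\<dots> \<le> (10 * nsq n x) / 16"
      using assms(1) by (intro divide_left_mono) (auto simp: power_mult_distrib)
    also have "\<dots> \<le> 1 * nsq n x" by simp
    also have "\<dots> \<le> s\<^sup>2 * nsq n x" using assms(1) by (intro mult_right_mono) auto
    finally show ?thesis .
  qed
  moreover have "nsq n (mapp (s \<cdot>\<^sub>m 1\<^sub>m n) y) = s\<^sup>2 * nsq n y"
    by (simp add: nsq_def mapp_smult[of _ n n] mapp_one power_mult_distrib sum_distrib_left)
  ultimately have "nsq (2*n) (mapp Sig x) \<le> s\<^sup>2 * nsq (2*n) x"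
  proof -
    have "nsq (2*n) (mapp Sig x) = nsq n (mapp Sx x) + nsq n (mapp (s \<cdot>\<^sub>m 1\<^sub>m n) y)"
      using Sx by (simp add: nsq_def sum_double Sig_def mapp_bdiag y_def)
    moreover have "nsq (2*n) x = nsq n x + nsq n y" by (simp add: nsq_double y_def)
    ultimately show ?thesis
      using \<open>nsq n (mapp Sx x) \<le> s\<^sup>2 * nsq n x\<close> \<open>nsq n (mapp (s \<cdot>\<^sub>m 1\<^sub>m n) y) = s\<^sup>2 * nsq n y\<close>
      by (simp add: distrib_left)
  qed
  from real_sqrt_le_mono[OF this]
  show "sqrt (\<Sum>j<2*n. (\<Sum>k<2*n. Sig $$ (j,k) * x k)\<^sup>2) \<le> s * sqrt (\<Sum>k<2*n. (x k)\<^sup>2)"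
    using s Sig by (simp add: nsq_def mapp_eq[OF Sig] real_sqrt_mult)
qed

end

section \<open>Integral kernels and trace distance\<close>

text \<open>Two kinds of kernel are paired with the same test functions: the learner's output is
  square integrable and calls for L2, the Gaussian kernels are used through boundedness and call for
  L1.\<close>

definition L1L2 :: "nat \<Rightarrow> ((nat \<Rightarrow> real) \<Rightarrow> complex) \<Rightarrow> bool" where
  "L1L2 n f \<longleftrightarrow> L2 n f \<and> integrable (Rn n) f"

definition bounded_kernel :: "nat \<Rightarrow> kernel \<Rightarrow> bool" where
  "bounded_kernel n K \<longleftrightarrow> (\<lambda>(x,y). K x y) \<in> borel_measurable (Rn n \<Otimes>\<^sub>M Rn n) \<and> (\<exists>C. \<forall>x y. cmod (K x y) \<le> C)"

lemma kform_integrand_measurable: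
  assumes f: "f \<in> borel_measurable (Rn n)" and g: "g \<in> borel_measurable (Rn n)"
    and K: "(\<lambda>z. K (fst z) (snd z)) \<in> borel_measurable (Rn n \<Otimes>\<^sub>M Rn n)"
  shows "(\<lambda>z. cnj (f (fst z)) * K (fst z) (snd z) * g (snd z) :: complex) \<in> borel_measurable (Rn n \<Otimes>\<^sub>M Rn n)"
proof -
  have "cnj \<in> borel_measurable borel"
    by (intro borel_measurable_continuous_onI continuous_intros)
  then have "(\<lambda>z. cnj (f (fst z))) \<in> borel_measurable (Rn n \<Otimes>\<^sub>M Rn n)"
    by (intro measurable_compose[OF measurable_compose[OF measurable_fst f]])
  then show ?thesis
    by (intro borel_measurable_times K measurable_compose[OF measurable_snd g])
qed

lemma kform_integrable_bounded:
  assumes K: "bounded_kernel n K" and f: "L1L2 n f" and g: "L1L2 n g"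
  shows "integrable (Rn n \<Otimes>\<^sub>M Rn n) (\<lambda>(x,y). cnj (f x) * K x y * g y)"
proof -
  obtain C where C: "\<And>x y. cmod (K x y) \<le> C" using K unfolding bounded_kernel_def by auto
  have m: "(\<lambda>z. K (fst z) (snd z)) \<in> borel_measurable (Rn n \<Otimes>\<^sub>M Rn n)"
    using K unfolding bounded_kernel_def by (simp add: case_prod_unfold)
  have fg: "f \<in> borel_measurable (Rn n)" "g \<in> borel_measurable (Rn n)"
    using f g by (auto simp: L1L2_def L2_def)
  have i: "integrable (Rn n \<Otimes>\<^sub>M Rn n) (\<lambda>z. cmod (f (fst z)) * cmod (g (snd z)))"
    using f g by (intro integrable_product_Rn) (auto simp: L1L2_def)
  show ?thesis unfolding case_prod_unfold
  proof (rule Bochner_Integration.integrable_bound[OF integrable_mult_right[OF i, of C]])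
    show "AE z in Rn n \<Otimes>\<^sub>M Rn n. norm (cnj (f (fst z)) * K (fst z) (snd z) * g (snd z)) \<le> norm (C * (cmod (f (fst z)) * cmod (g (snd z))))"
    proof (rule AE_I2)
      fix z
      have "cmod (f (fst z)) * cmod (K (fst z) (snd z)) * cmod (g (snd z)) \<le> cmod (f (fst z)) * C * cmod (g (snd z))"
        using C by (intro mult_right_mono mult_left_mono) auto
      also have "\<dots> \<le> \<bar>C * (cmod (f (fst z)) * cmod (g (snd z)))\<bar>" by (simp add: ac_simps abs_le_iff)
      finally show "norm (cnj (f (fst z)) * K (fst z) (snd z) * g (snd z)) \<le> norm (C * (cmod (f (fst z)) * cmod (g (snd z))))"
        by (simp add: norm_mult)
    qed
  qed (rule kform_integrand_measurable[OF fg m])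
qed

lemma kform_integrable_density:
  assumes K: "density_kernel n K" and f: "L2 n f" and g: "L2 n g"
  shows "integrable (Rn n \<Otimes>\<^sub>M Rn n) (\<lambda>(x,y). cnj (f x) * K x y * g y)"
proof -
  have m: "(\<lambda>z. K (fst z) (snd z)) \<in> borel_measurable (Rn n \<Otimes>\<^sub>M Rn n)"
    and i: "integrable (Rn n \<Otimes>\<^sub>M Rn n) (\<lambda>z. (cmod (K (fst z) (snd z)))\<^sup>2)"
    using K unfolding density_kernel_def by (simp_all add: case_prod_unfold)
  have fg: "f \<in> borel_measurable (Rn n)" "g \<in> borel_measurable (Rn n)"
    using f g by (auto simp: L2_def)
  have j: "integrable (Rn n \<Otimes>\<^sub>M Rn n) (\<lambda>z. (cmod (f (fst z)))\<^sup>2 * (cmod (g (snd z)))\<^sup>2)"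
    using f g by (intro integrable_product_Rn) (auto simp: L2_def)
  show ?thesis unfolding case_prod_unfold
  proof (rule Bochner_Integration.integrable_bound[OF Bochner_Integration.integrable_add[OF i j]])
    show "AE z in Rn n \<Otimes>\<^sub>M Rn n. norm (cnj (f (fst z)) * K (fst z) (snd z) * g (snd z)) \<le>
      norm ((cmod (K (fst z) (snd z)))\<^sup>2 + (cmod (f (fst z)))\<^sup>2 * (cmod (g (snd z)))\<^sup>2)"
    proof (rule AE_I2)
      fix z
      let ?k = "cmod (K (fst z) (snd z))" and ?h = "cmod (f (fst z)) * cmod (g (snd z))"
      have "2 * (?k * ?h) \<le> ?k\<^sup>2 + ?h\<^sup>2" using sum_squares_bound[of ?k ?h] by (simp add: mult.assoc)
      moreover have "0 \<le> ?k * ?h" by simp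
      ultimately have "?k * ?h \<le> ?k\<^sup>2 + ?h\<^sup>2" by linarith
      then show "norm (cnj (f (fst z)) * K (fst z) (snd z) * g (snd z)) \<le>
        norm ((cmod (K (fst z) (snd z)))\<^sup>2 + (cmod (f (fst z)))\<^sup>2 * (cmod (g (snd z)))\<^sup>2)"
        by (simp add: norm_mult power_mult_distrib ac_simps)
    qed
  qed (rule kform_integrand_measurable[OF fg m])
qed

text \<open>Integrability has to be assumed because the Bochner integral of a non-integrable
  function is zero by convention, which would break additivity.\<close>

lemma kform_diff:
  assumes "integrable (Rn n \<Otimes>\<^sub>M Rn n) (\<lambda>(x,y). cnj (f x) * K x y * g y)"
    "integrable (Rn n \<Otimes>\<^sub>M Rn n) (\<lambda>(x,y). cnj (f x) * L x y * g y)"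
  shows "kform n (\<lambda>x y. K x y - L x y) f g = kform n K f g - kform n L f g"
  unfolding kform_def Bochner_Integration.integral_diff[OF assms, symmetric]
  by (simp add: case_prod_unfold algebra_simps)

lemma trace_dist_ge:
  assumes "orthonormal n k e" "orthonormal n k f"
  shows "ereal ((\<Sum>i<k. cmod (kform n (\<lambda>x y. K x y - L x y) (f i) (e i))) / 2) \<le> trace_dist n K L"
proof -
  have "ereal (\<Sum>i<k. cmod (kform n (\<lambda>x y. K x y - L x y) (f i) (e i))) \<le> trace_norm n (\<lambda>x y. K x y - L x y)"
    unfolding trace_norm_def by (rule SUP_upper2[of "(k, e, f)"]) (use assms in auto)
  then have "ereal (\<Sum>i<k. cmod (kform n (\<lambda>x y. K x y - L x y) (f i) (e i))) / 2 \<le> trace_dist n K L"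
    unfolding trace_dist_def by (intro ereal_divide_right_mono) auto
  then show ?thesis by simp
qed

lemma trace_dist_nonneg: "0 \<le> trace_dist n K L"
  using trace_dist_ge[of n 0 "\<lambda>_ _. 0" "\<lambda>_ _. 0" K L] by (simp add: orthonormal_def zero_ereal_def)

text \<open>The triangle inequality is taken for fixed test families, so integrability has to be
  checked for them alone. The factor is 4 because a trace distance is half a trace norm.\<close>

lemma trace_dist_triangle:
  assumes A: "density_kernel n A" and K: "bounded_kernel n K" and L: "bounded_kernel n L"
    and AK: "trace_dist n A K \<le> ereal \<epsilon>" and AL: "trace_dist n A L \<le> ereal \<epsilon>"
    and e: "orthonormal n k e" "\<And>i. i < k \<Longrightarrow> L1L2 n (e i)"
    and f: "orthonormal n k f" "\<And>i. i < k \<Longrightarrow> L1L2 n (f i)"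
  shows "(\<Sum>i<k. cmod (kform n K (f i) (e i) - kform n L (f i) (e i))) \<le> 4 * \<epsilon>"
proof -
  have d: "kform n (\<lambda>x y. A x y - B x y) (f i) (e i) = kform n A (f i) (e i) - kform n B (f i) (e i)"
    if "i < k" "bounded_kernel n B" for i B
    using that e f A by (intro kform_diff kform_integrable_density kform_integrable_bounded) (auto simp: L1L2_def)
  have "(\<Sum>i<k. cmod (kform n K (f i) (e i) - kform n L (f i) (e i))) \<le>
      (\<Sum>i<k. cmod (kform n (\<lambda>x y. A x y - L x y) (f i) (e i)) + cmod (kform n (\<lambda>x y. A x y - K x y) (f i) (e i)))"
  proof (rule sum_mono)
    fix i assume "i \<in> {..<k}"
    then have "kform n K (f i) (e i) - kform n L (f i) (e i) =
       kform n (\<lambda>x y. A x y - L x y) (f i) (e i) - kform n (\<lambda>x y. A x y - K x y) (f i) (e i)"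
      by (simp add: d K L)
    then show "cmod (kform n K (f i) (e i) - kform n L (f i) (e i)) \<le>
      cmod (kform n (\<lambda>x y. A x y - L x y) (f i) (e i)) + cmod (kform n (\<lambda>x y. A x y - K x y) (f i) (e i))"
      by (simp add: norm_triangle_ineq4)
  qed
  moreover have "(\<Sum>i<k. cmod (kform n (\<lambda>x y. A x y - L x y) (f i) (e i))) / 2 \<le> \<epsilon>"
    using order_trans[OF trace_dist_ge[OF e(1) f(1)] AL] by simp
  moreover have "(\<Sum>i<k. cmod (kform n (\<lambda>x y. A x y - K x y) (f i) (e i))) / 2 \<le> \<epsilon>"
    using order_trans[OF trace_dist_ge[OF e(1) f(1)] AK] by simp
  ultimately show ?thesis by (simp add: sum.distrib)
qed

section \<open>The single-excitation block\<close>

text \<open>Column \<open>k\<close> of \<open>U\<close> as a superposition of excitations; a unitary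
  \<open>U\<close> gives a rotated orthonormal family.\<close>

definition rot :: "nat \<Rightarrow> real \<Rightarrow> (nat \<Rightarrow> nat \<Rightarrow> complex) \<Rightarrow> nat \<Rightarrow> (nat \<Rightarrow> real) \<Rightarrow> complex" where
  "rot n s U k x = (\<Sum>j<n. U j k * complex_of_real (psi n s j x))"

lemma rot_L1L2:
  assumes "s > 0" shows "L1L2 n (rot n s U k)"
proof -
  have i: "integrable (Rn n) (rot n s U k)"
    unfolding rot_def[abs_def] using assms psi_integrable[of s _ n]
    by (intro Bochner_Integration.integrable_sum integrable_mult_right integrable_of_real) auto
  have "integrable (Rn n) (\<lambda>x. \<Sum>j<n. \<Sum>l<n. (U j k * cnj (U l k)) * complex_of_real (psi n s j x * psi n s l x))"
    using assms psi_orthonormal(1)[of s _ n]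
    by (intro Bochner_Integration.integrable_sum integrable_mult_right integrable_of_real) auto
  also have "(\<lambda>x. \<Sum>j<n. \<Sum>l<n. (U j k * cnj (U l k)) * complex_of_real (psi n s j x * psi n s l x)) =
     (\<lambda>x. complex_of_real ((cmod (rot n s U k x))\<^sup>2))"
    unfolding complex_norm_square rot_def cnj_sum sum_product by (simp add: ac_simps)
  finally have "integrable (Rn n) (\<lambda>x. (cmod (rot n s U k x))\<^sup>2)"
    by (simp only: complex_of_real_integrable_eq)
  then show ?thesis using i by (simp add: L1L2_def L2_def)
qed

lemma rot_inner:
  assumes "s > 0"
  shows "l2_inner n (rot n s U k) (rot n s V l) = (\<Sum>j<n. cnj (U j k) * V j l)"
proof -
  have "l2_inner n (rot n s U k) (rot n s V l) =
     (\<integral>x. (\<Sum>j<n. \<Sum>i<n. (cnj (U j k) * V i l) * complex_of_real (psi n s j x * psi n s i x)) \<partial>Rn n)"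
    unfolding l2_inner_def rot_def cnj_sum sum_product by (simp add: ac_simps)
  also have "\<dots> = (\<Sum>j<n. \<Sum>i<n. (cnj (U j k) * V i l) * complex_of_real (if j = i then 1 else 0))"
    using assms psi_orthonormal[of s _ n]
    by (subst Bochner_Integration.integral_sum Bochner_Integration.integral_sum,
        auto intro!: Bochner_Integration.integrable_sum integrable_mult_right integrable_of_real sum.cong simp del: of_real_mult)
  also have "\<dots> = (\<Sum>j<n. cnj (U j k) * V j l)"
    by (intro sum.cong refl) (simp add: if_distrib[of "\<lambda>t. _ * complex_of_real t"] cong: if_cong)
  finally show ?thesis .
qed

text \<open>\<open>K\<close> is the compression of the operator to the span of the excitations.
  Boundedness is part of the notion so that the matrix entries determine the form on all
  superpositions.\<close>

definition excitation_block :: "nat \<Rightarrow> real \<Rightarrow> kernel \<Rightarrow> real mat \<Rightarrow> bool" where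
  "excitation_block n s \<rho> K \<longleftrightarrow> bounded_kernel n \<rho> \<and> K \<in> carrier_mat n n \<and> (\<forall>i<n. \<forall>j<n.
      kform n \<rho> (\<lambda>x. complex_of_real (psi n s i x)) (\<lambda>x. complex_of_real (psi n s j x)) = complex_of_real (K $$ (i,j)))"

lemma psi_L1L2:
  assumes "s > 0" "i < n" shows "L1L2 n (\<lambda>x. complex_of_real (psi n s i x))"
proof -
  have "rot n s (\<lambda>j k. if j = i then 1 else 0) 0 = (\<lambda>x. complex_of_real (psi n s i x))"
    using assms by (simp add: rot_def fun_eq_iff if_distrib[of "\<lambda>t. t * _"] cong: if_cong)
  then show ?thesis using rot_L1L2[OF assms(1)] by metis
qed

lemma kform_rot:
  assumes "s > 0" and \<rho>: "excitation_block n s \<rho> K"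
  shows "kform n \<rho> (rot n s U k) (rot n s V l) = (\<Sum>j<n. \<Sum>i<n. cnj (U j k) * V i l * complex_of_real (K $$ (j,i)))"
proof -
  define h where "h j i z = cnj (complex_of_real (psi n s j (fst z))) * \<rho> (fst z) (snd z) * complex_of_real (psi n s i (snd z))" for j i z
  have h: "integrable (Rn n \<Otimes>\<^sub>M Rn n) (h j i)" if "j < n" "i < n" for j i
    using kform_integrable_bounded[of n \<rho>, OF _ psi_L1L2[OF assms(1) that(1)] psi_L1L2[OF assms(1) that(2)]] \<rho>
    by (simp add: excitation_block_def h_def[abs_def] case_prod_unfold)
  have hi: "(\<integral>z. h j i z \<partial>(Rn n \<Otimes>\<^sub>M Rn n)) = complex_of_real (K $$ (j,i))" if "j < n" "i < n" for j i
    using \<rho> that by (simp add: excitation_block_def h_def kform_def case_prod_unfold)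
  have pt: "cnj (\<Sum>j<n. U j k * complex_of_real (psi n s j x)) * r * (\<Sum>i<n. V i l * complex_of_real (psi n s i y)) =
     (\<Sum>j<n. \<Sum>i<n. (cnj (U j k) * V i l) * (cnj (complex_of_real (psi n s j x)) * r * complex_of_real (psi n s i y)))" for x y r
  proof -
    have m: "A * r * B = r * (A * B)" for A B :: complex by (simp add: ac_simps)
    show ?thesis unfolding m cnj_sum unfolding sum_product unfolding sum_distrib_left by (simp add: ac_simps)
  qed
  have "kform n \<rho> (rot n s U k) (rot n s V l) = 
     (\<integral>z. (\<Sum>j<n. \<Sum>i<n. (cnj (U j k) * V i l) * h j i z) \<partial>(Rn n \<Otimes>\<^sub>M Rn n))"
    unfolding kform_def rot_def case_prod_unfold h_def pt ..
  also have "\<dots> = (\<Sum>j<n. \<integral>z. (\<Sum>i<n. (cnj (U j k) * V i l) * h j i z) \<partial>(Rn n \<Otimes>\<^sub>M Rn n))"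
    using h by (intro Bochner_Integration.integral_sum Bochner_Integration.integrable_sum integrable_mult_right) auto
  also have "\<dots> = (\<Sum>j<n. \<Sum>i<n. \<integral>z. (cnj (U j k) * V i l) * h j i z \<partial>(Rn n \<Otimes>\<^sub>M Rn n))"
    using h by (intro sum.cong refl Bochner_Integration.integral_sum integrable_mult_right) auto
  also have "\<dots> = (\<Sum>j<n. \<Sum>i<n. cnj (U j k) * V i l * complex_of_real (K $$ (j,i)))"
    unfolding integral_mult_right_zero by (intro sum.cong refl) (simp add: hi)
  finally show ?thesis .
qed

text \<open>The difference is tested with the excitations on one side and their rotation by
  \<open>P + i S\<close> on the other. The blocks are real, so the imaginary part of the resulting
  sum isolates \<open>S\<close>; conjugating the rotated family gives it a minus sign.\<close>

lemma close_states_alignment: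
  assumes s: "s > 0" and K: "excitation_block n s \<rho> K" and L: "excitation_block n s \<sigma> L"
    and A: "density_kernel n A" "trace_dist n A \<rho> \<le> ereal \<epsilon>" "trace_dist n A \<sigma> \<le> ereal \<epsilon>"
    and P: "symm n P" and S: "symm n S" and PS: "P * P + S * S = 1\<^sub>m n" "P * S = S * P"
  shows "mip S (K - L) \<le> 4 * \<epsilon>"
proof -
  note Pc = symm_carrier[OF P] and Sc = symm_carrier[OF S]
  define U where "U j k = Complex (P $$ (j,k)) (S $$ (j,k))" for j k
  define I where "I j k = (if j = k then 1 else 0 :: complex)" for j k :: nat
  have "(\<Sum>j<n. cnj (U j k) * U j l) = (if k = l then 1 else 0)" if kl: "k < n" "l < n" for k l
  proof (rule complex_eqI)
    have 1: "(P * P) $$ (k,l) + (S * S) $$ (k,l) = (if k = l then 1 else 0)"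
      using arg_cong[OF PS(1), of "\<lambda>A. A $$ (k,l)"] kl Pc Sc by simp
    have 2: "(P * S) $$ (k,l) = (S * P) $$ (k,l)" using PS(2) by simp
    show "Re (\<Sum>j<n. cnj (U j k) * U j l) = Re (if k = l then 1 else 0)"
      using 1 unfolding mult_index[OF Pc Pc kl] mult_index[OF Sc Sc kl]
      by (simp add: U_def sum.distrib symm_index[OF P, of _ k] symm_index[OF S, of _ k] kl)
    show "Im (\<Sum>j<n. cnj (U j k) * U j l) = Im (if k = l then 1 else 0)"
      using 2 unfolding mult_index[OF Pc Sc kl] mult_index[OF Sc Pc kl]
      by (simp add: U_def sum_subtractf symm_index[OF P, of _ k] symm_index[OF S, of _ k] kl)
  qed
  then have f: "orthonormal n n (rot n s U)"
    using rot_L1L2[OF s] by (simp add: orthonormal_def rot_inner[OF s] L1L2_def)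
  have "(\<Sum>j<n. cnj (I j k) * I j l) = (if k = l then 1 else 0)" if "k < n" "l < n" for k l
    using that by (simp add: I_def if_distrib[of "\<lambda>t. t * _"] if_distrib[of cnj] cong: if_cong)
  then have e: "orthonormal n n (rot n s I)"
    using rot_L1L2[OF s] by (simp add: orthonormal_def rot_inner[OF s] L1L2_def)
  have kf: "kform n \<tau> (rot n s U k) (rot n s I k) = (\<Sum>j<n. cnj (U j k) * complex_of_real (M $$ (j,k)))"
    if "excitation_block n s \<tau> M" "k < n" for \<tau> M k
    unfolding kform_rot[OF s that(1)] using that(2)
    by (simp add: I_def if_distrib[of "\<lambda>t. _ * t"] if_distrib[of "\<lambda>t. t * _"] cong: if_cong)
  have KL: "K \<in> carrier_mat n n" "L \<in> carrier_mat n n" using K L by (auto simp: excitation_block_def)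
  have "mip S (K - L) = (\<Sum>k<n. \<Sum>j<n. S $$ (j,k) * (K $$ (j,k) - L $$ (j,k)))"
    using Sc KL by (simp add: mip_eq[of _ n]) (rule sum.swap)
  also have "\<dots> \<le> (\<Sum>k<n. cmod (kform n \<rho> (rot n s U k) (rot n s I k) - kform n \<sigma> (rot n s U k) (rot n s I k)))"
  proof (rule sum_mono)
    fix k assume "k \<in> {..<n}"
    then have "(\<Sum>j<n. S $$ (j,k) * (K $$ (j,k) - L $$ (j,k))) =
       - Im (kform n \<rho> (rot n s U k) (rot n s I k) - kform n \<sigma> (rot n s U k) (rot n s I k))"
      by (simp add: kf[OF K] kf[OF L] U_def sum_subtractf right_diff_distrib sum_negf)
    also have "\<dots> \<le> cmod (kform n \<rho> (rot n s U k) (rot n s I k) - kform n \<sigma> (rot n s U k) (rot n s I k))"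
      using abs_Im_le_cmod[of "kform n \<rho> (rot n s U k) (rot n s I k) - kform n \<sigma> (rot n s U k) (rot n s I k)"] by linarith
    finally show "(\<Sum>j<n. S $$ (j,k) * (K $$ (j,k) - L $$ (j,k))) \<le>
      cmod (kform n \<rho> (rot n s U k) (rot n s I k) - kform n \<sigma> (rot n s U k) (rot n s I k))" .
  qed
  also have "\<dots> \<le> 4 * \<epsilon>"
    by (rule trace_dist_triangle[OF A(1) _ _ A(2,3) e _ f])
      (use K L rot_L1L2[OF s] in \<open>auto simp: excitation_block_def\<close>)
  finally show ?thesis .
qed

lemma (in gstate) excitation_block_Sig:
  "excitation_block n s (gauss_state_kernel n Sig) ((vac / 2) \<cdot>\<^sub>m G)"
  unfolding excitation_block_def
proof (intro conjI allI impI)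
  let ?P = "Rn n \<Otimes>\<^sub>M Rn n"
  define h where "h z = ck * exp (- qform Sxi (\<lambda>i. fst z i + snd z i) / 8 - s * nsq n (\<lambda>i. fst z i - snd z i) / 2)"
    for z :: "(nat \<Rightarrow> real) \<times> (nat \<Rightarrow> real)"
  note co = Rn_pair_coord[of _ n]
  have [measurable]: "h \<in> borel_measurable ?P"
    unfolding h_def[abs_def] qform_eq[OF Sxi] nsq_def using co by measurable
  have ker: "gauss_state_kernel n Sig a b = complex_of_real (h (a, b))" for a b
    unfolding kernel_eq h_def by simp
  have ck0: "ck \<ge> 0" unfolding ck_def using pd_det_pos[OF pd_Sxi] by simp
  have "cmod (gauss_state_kernel n Sig a b) \<le> ck" for a b
  proof -
    obtain l where l: "l > 0" "\<And>x. l * nsq n x \<le> qform Sxi x" using pd_Sxi unfolding pd_def by auto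
    have "0 \<le> qform Sxi x" for x using l by (meson less_imp_le mult_nonneg_nonneg nsq_nonneg order_trans)
    then have "exp (- qform Sxi (\<lambda>i. a i + b i) / 8 - s * nsq n (\<lambda>i. a i - b i) / 2) \<le> 1"
    proof -
      assume "\<And>x. 0 \<le> qform Sxi x"
      then have "0 \<le> qform Sxi (\<lambda>i. a i + b i)" .
      moreover have "0 \<le> s * nsq n (\<lambda>i. a i - b i)" using s by simp
      ultimately show ?thesis unfolding exp_le_one_iff by linarith
    qed
    from mult_left_mono[OF this ck0] have "h (a, b) \<le> ck" "0 \<le> h (a, b)" unfolding h_def using ck0 by auto
    then show ?thesis unfolding ker norm_of_real by simp
  qed
  then show "bounded_kernel n (gauss_state_kernel n Sig)"
    unfolding bounded_kernel_def ker by (auto simp: case_prod_unfold)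
  show "(vac / 2) \<cdot>\<^sub>m G \<in> carrier_mat n n" using G by simp
  fix i j assume i: "i < n" and j: "j < n"
  have "kform n (gauss_state_kernel n Sig) (\<lambda>x. complex_of_real (psi n s i x)) (\<lambda>x. complex_of_real (psi n s j x)) =
     (\<integral>z. complex_of_real (psi n s i (fst z) * h z * psi n s j (snd z)) \<partial>?P)"
    unfolding kform_def ker by (simp add: case_prod_unfold)
  also have "\<dots> = complex_of_real (\<integral>z. psi n s i (fst z) * h z * psi n s j (snd z) \<partial>?P)"
    by (rule integral_complex_of_real)
  also have "(\<integral>z. psi n s i (fst z) * h z * psi n s j (snd z) \<partial>?P) = vac * G $$ (i,j) / 2"
    unfolding h_def by (rule matrix_element[OF i j])
  also have "\<dots> = ((vac / 2) \<cdot>\<^sub>m G) $$ (i,j)" using i j G by simp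
  finally show "kform n (gauss_state_kernel n Sig) (\<lambda>x. complex_of_real (psi n s i x)) (\<lambda>x. complex_of_real (psi n s j x)) =
     complex_of_real (((vac / 2) \<cdot>\<^sub>m G) $$ (i,j))" .
qed

section \<open>Heterodyne samples\<close>

lemma gauss_density_minv:
  "gauss_density m S x = exp (- qform (minv S) x / 2) / sqrt ((2 * pi) ^ m * Determinant.det S)"
  by (simp add: gauss_density_def minv_def)

lemma gauss_density_measurable:
  assumes "pd m S" shows "gauss_density m S \<in> borel_measurable (Rn m)"
proof -
  note [measurable] = qform_measurable[OF minv_pd(1)[OF assms]]
  show ?thesis unfolding gauss_density_minv[abs_def] by measurable
qed

lemma gauss_density_pos: "pd m S \<Longrightarrow> 0 < gauss_density m S x"
  unfolding gauss_density_minv using pd_det_pos[of m S] by simp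

lemma det_minv: "pd m S \<Longrightarrow> Determinant.det S * Determinant.det (minv S) = 1"
  using det_mult[OF pd_carrier minv_pd(1)] minv_pd(2) by (metis det_one)

lemma prob_space_gauss_measure:
  assumes "pd m S" shows "prob_space (gauss_measure m S)"
proof
  note [measurable] = gauss_density_measurable[OF assms]
  define D where "D = sqrt ((2 * pi) ^ m * Determinant.det S)"
  have dS: "Determinant.det S > 0" by (rule pd_det_pos[OF assms])
  have D: "D > 0" using dS by (simp add: D_def)
  note [measurable] = qform_measurable[OF minv_pd(1)[OF assms]]
  have "emeasure (gauss_measure m S) (space (gauss_measure m S)) = (\<integral>\<^sup>+x. ennreal (gauss_density m S x) \<partial>Rn m)"
    unfolding gauss_measure_def by (simp add: emeasure_density)
  also have "\<dots> = (\<integral>\<^sup>+x. ennreal (1 / D) * ennreal (exp (- qform (minv S) x / 2)) \<partial>Rn m)"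
    unfolding gauss_density_minv D_def[symmetric] using D
    by (intro nn_integral_cong) (simp add: ennreal_mult[symmetric])
  also have "\<dots> = ennreal (1 / D) * ennreal (sqrt ((2 * pi) ^ m / Determinant.det (minv S)))"
    by (subst nn_integral_cmult) (measurable, simp only: nn_integral_gaussian[OF pd_minv[OF assms]])
  also have "\<dots> = ennreal (1 / D * sqrt ((2 * pi) ^ m / Determinant.det (minv S)))"
    using D pd_det_pos[OF pd_minv[OF assms]] by (simp add: ennreal_mult[symmetric])
  also have "(2 * pi) ^ m / Determinant.det (minv S) = (2 * pi) ^ m * Determinant.det S"
  proof -
    have "Determinant.det (minv S) = 1 / Determinant.det S" using det_minv[OF assms] dS by (simp add: field_simps)
    then show ?thesis by simp
  qed
  finally show "emeasure (gauss_measure m S) (space (gauss_measure m S)) = 1"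
    using D unfolding D_def[symmetric] by simp
qed

text \<open>\<open>p\<close> supplies the sigma-finiteness under which the product of the weighted
  measures is determined by its values on boxes.\<close>

lemma PiM_density:
  assumes M: "sigma_finite_measure M" and f: "f \<in> borel_measurable M" and p: "prob_space (density M f)" and I: "finite I"
  shows "PiM I (\<lambda>_. density M f) = density (PiM I (\<lambda>_. M)) (\<lambda>x. \<Prod>i\<in>I. f (x i))"
proof -
  interpret A: product_sigma_finite "\<lambda>_. M" using M by (simp add: product_sigma_finite_def)
  interpret B: product_sigma_finite "\<lambda>_. density M f"
    using p by (simp add: product_sigma_finite_def prob_space_imp_sigma_finite)
  note [measurable] = f
  have m: "(\<lambda>x. \<Prod>i\<in>I. f (x i)) \<in> borel_measurable (PiM I (\<lambda>_. M))" by measurable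
  have "density (PiM I (\<lambda>_. M)) (\<lambda>x. \<Prod>i\<in>I. f (x i)) = PiM I (\<lambda>_. density M f)"
  proof (rule B.PiM_eqI[OF I])
    show "sets (density (PiM I (\<lambda>_. M)) (\<lambda>x. \<Prod>i\<in>I. f (x i))) = sets (PiM I (\<lambda>_. density M f))"
      by (simp cong: sets_PiM_cong)
    fix S assume S: "\<And>i. i \<in> I \<Longrightarrow> S i \<in> sets (density M f)"
    then have S': "\<And>i. i \<in> I \<Longrightarrow> S i \<in> sets M" by simp
    then have E: "PiE I S \<in> sets (PiM I (\<lambda>_. M))" using I by (intro sets_PiM_I_finite) auto
    have "emeasure (density (PiM I (\<lambda>_. M)) (\<lambda>x. \<Prod>i\<in>I. f (x i))) (PiE I S) =
       (\<integral>\<^sup>+x. (\<Prod>i\<in>I. f (x i)) * indicator (PiE I S) x \<partial>PiM I (\<lambda>_. M))"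
      by (rule emeasure_density[OF m E])
    also have "\<dots> = (\<integral>\<^sup>+x. (\<Prod>i\<in>I. f (x i) * indicator (S i) (x i)) \<partial>PiM I (\<lambda>_. M))"
    proof (rule nn_integral_cong)
      fix x assume x: "x \<in> space (PiM I (\<lambda>_. M))"
      show "(\<Prod>i\<in>I. f (x i)) * indicator (PiE I S) x = (\<Prod>i\<in>I. f (x i) * indicator (S i) (x i))"
      proof (cases "x \<in> PiE I S")
        case True
        then have "x i \<in> S i" if "i \<in> I" for i using that by (auto simp: PiE_def)
        then show ?thesis using True by (auto intro!: prod.cong)
      next
        case False
        then obtain i where "i \<in> I" "x i \<notin> S i" using x by (auto simp: PiE_def space_PiM)
        then have "(\<Prod>i\<in>I. f (x i) * indicator (S i) (x i)) = 0" using I by (intro prod_zero) (auto simp: indicator_def intro!: bexI[of _ i])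
        then show ?thesis using False by simp
      qed
    qed
    also have "\<dots> = (\<Prod>i\<in>I. \<integral>\<^sup>+x. f x * indicator (S i) x \<partial>M)"
      using I S' by (intro A.product_nn_integral_prod) auto
    also have "\<dots> = (\<Prod>i\<in>I. emeasure (density M f) (S i))"
      using S' by (intro prod.cong refl) (simp add: emeasure_density)
    finally show "emeasure (density (PiM I (\<lambda>_. M)) (\<lambda>x. \<Prod>i\<in>I. f (x i))) (PiE I S) = (\<Prod>i\<in>I. emeasure (density M f) (S i))" .
  qed
  then show ?thesis by simp
qed

text \<open>The chi-square comparison \<open>p \<le> (\<lambda> q + p\<^sup>2 / (\<lambda> q)) / 2\<close>, integrated over \<open>N\<close> samples.\<close>

lemma iid_chi_square:
  fixes p q :: "'a \<Rightarrow> real" and N :: nat and X l :: real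
  assumes M: "sigma_finite_measure M" and [measurable]: "p \<in> borel_measurable M" "q \<in> borel_measurable M"
    and p: "\<And>x. 0 \<le> p x" and q: "\<And>x. 0 < q x"
    and pP: "prob_space (density M (\<lambda>x. ennreal (p x)))" and pQ: "prob_space (density M (\<lambda>x. ennreal (q x)))"
    and U: "prob_space U" and l: "l > 0" and X: "(\<integral>\<^sup>+x. ennreal ((p x)\<^sup>2 / q x) \<partial>M) \<le> ennreal X" "X \<ge> 0"
    and S: "S \<in> sets (PiM {..<N} (\<lambda>_. M) \<Otimes>\<^sub>M U)"
  shows "emeasure (PiM {..<N} (\<lambda>_. density M (\<lambda>x. ennreal (p x))) \<Otimes>\<^sub>M U) S \<le>
     ennreal (l / 2) * emeasure (PiM {..<N} (\<lambda>_. density M (\<lambda>x. ennreal (q x))) \<Otimes>\<^sub>M U) S + ennreal (X ^ N / (2 * l))"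
proof -
  interpret U: prob_space U by (rule U)
  interpret A: product_sigma_finite "\<lambda>_. M" using M by (simp add: product_sigma_finite_def)
  let ?L = "PiM {..<N} (\<lambda>_. M)"
  have sL: "sigma_finite_measure ?L" by (rule A.sigma_finite) simp
  have dens: "PiM {..<N} (\<lambda>_. density M (\<lambda>x. ennreal (f x))) \<Otimes>\<^sub>M U = density (?L \<Otimes>\<^sub>M U) (\<lambda>z. ennreal (\<Prod>i<N. f (fst z i)))"
    if [measurable]: "f \<in> borel_measurable M" and f: "\<And>x. 0 \<le> f x" and pf: "prob_space (density M (\<lambda>x. ennreal (f x)))" for f :: "'a \<Rightarrow> real"
  proof -
    have "PiM {..<N} (\<lambda>_. density M (\<lambda>x. ennreal (f x))) = density ?L (\<lambda>x. \<Prod>i<N. ennreal (f (x i)))"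
      by (rule PiM_density[OF M _ pf]) auto
    then have "PiM {..<N} (\<lambda>_. density M (\<lambda>x. ennreal (f x))) \<Otimes>\<^sub>M U = density ?L (\<lambda>x. \<Prod>i<N. ennreal (f (x i))) \<Otimes>\<^sub>M density U (\<lambda>_. 1)"
      by (simp add: density_1)
    also have "\<dots> = density (?L \<Otimes>\<^sub>M U) (\<lambda>(x,y). (\<Prod>i<N. ennreal (f (x i))) * 1)"
      by (rule pair_measure_density) (auto simp: density_1 U.sigma_finite_measure_axioms)
    also have "\<dots> = density (?L \<Otimes>\<^sub>M U) (\<lambda>z. ennreal (\<Prod>i<N. f (fst z i)))"
      using f by (simp add: case_prod_unfold prod_ennreal)
    finally show ?thesis .
  qed
  define P where "P z = (\<Prod>i<N. p (fst z i))" for z :: "(nat \<Rightarrow> 'a) \<times> 'b"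
  define Q where "Q z = (\<Prod>i<N. q (fst z i))" for z :: "(nat \<Rightarrow> 'a) \<times> 'b"
  have mP[measurable]: "P \<in> borel_measurable (?L \<Otimes>\<^sub>M U)" and mQ[measurable]: "Q \<in> borel_measurable (?L \<Otimes>\<^sub>M U)"
    unfolding P_def[abs_def] Q_def[abs_def] by measurable
  have P0: "P z \<ge> 0" and Q0: "Q z > 0" for z using p q by (auto simp: P_def Q_def prod_nonneg prod_pos)
  have pt: "P z \<le> l / 2 * Q z + 1 / (2 * l) * ((P z)\<^sup>2 / Q z)" for z
  proof -
    have "0 \<le> (l * Q z - P z)\<^sup>2 / (2 * l * Q z)" using l Q0[of z] by simp
    also have "\<dots> = l / 2 * Q z + 1 / (2 * l) * ((P z)\<^sup>2 / Q z) - P z"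
      using l Q0[of z] by (simp add: field_simps power2_eq_square)
    finally show ?thesis by simp
  qed
  have "emeasure (PiM {..<N} (\<lambda>_. density M (\<lambda>x. ennreal (p x))) \<Otimes>\<^sub>M U) S = (\<integral>\<^sup>+z. ennreal (P z) * indicator S z \<partial>(?L \<Otimes>\<^sub>M U))"
    using S by (subst dens[OF _ p pP]) (simp_all add: emeasure_density P_def[symmetric])
  also have "\<dots> \<le> (\<integral>\<^sup>+z. ennreal (l / 2) * (ennreal (Q z) * indicator S z) + ennreal (1 / (2 * l)) * ennreal ((P z)\<^sup>2 / Q z) \<partial>(?L \<Otimes>\<^sub>M U))"
  proof (rule nn_integral_mono)
    fix z
    have "ennreal (P z) \<le> ennreal (l / 2) * ennreal (Q z) + ennreal (1 / (2 * l)) * ennreal ((P z)\<^sup>2 / Q z)"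
      using pt[of z] l Q0[of z] by (simp add: ennreal_mult[symmetric] ennreal_plus[symmetric] del: ennreal_plus)
    then show "ennreal (P z) * indicator S z \<le> ennreal (l / 2) * (ennreal (Q z) * indicator S z) + ennreal (1 / (2 * l)) * ennreal ((P z)\<^sup>2 / Q z)"
      by (auto simp: indicator_def)
  qed
  also have "\<dots> = ennreal (l / 2) * (\<integral>\<^sup>+z. ennreal (Q z) * indicator S z \<partial>(?L \<Otimes>\<^sub>M U)) +
      ennreal (1 / (2 * l)) * (\<integral>\<^sup>+z. ennreal ((P z)\<^sup>2 / Q z) \<partial>(?L \<Otimes>\<^sub>M U))"
    using S by (subst nn_integral_add) (auto simp: nn_integral_cmult)
  also have "(\<integral>\<^sup>+z. ennreal (Q z) * indicator S z \<partial>(?L \<Otimes>\<^sub>M U)) = emeasure (PiM {..<N} (\<lambda>_. density M (\<lambda>x. ennreal (q x))) \<Otimes>\<^sub>M U) S"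
    using S q by (subst dens[OF _ _ pQ]) (auto simp: emeasure_density Q_def[symmetric] less_imp_le)
  also have "(\<integral>\<^sup>+z. ennreal ((P z)\<^sup>2 / Q z) \<partial>(?L \<Otimes>\<^sub>M U)) \<le> ennreal (X ^ N)"
  proof -
    have "(\<integral>\<^sup>+z. ennreal ((P z)\<^sup>2 / Q z) \<partial>(?L \<Otimes>\<^sub>M U)) = (\<integral>\<^sup>+x. \<integral>\<^sup>+y. ennreal ((P (x,y))\<^sup>2 / Q (x,y)) \<partial>U \<partial>?L)"
      by (rule U.nn_integral_fst[symmetric]) measurable
    \<comment> \<open>The seed integrates out to one, and the remaining likelihood quotient
      factorises over the samples.\<close>
    also have "\<dots> = (\<integral>\<^sup>+x. (\<Prod>i<N. ennreal ((p (x i))\<^sup>2 / q (x i))) \<partial>?L)"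
      using p q by (intro nn_integral_cong)
        (simp add: P_def Q_def prod_ennreal less_imp_le prod_dividef prod_power_distrib U.emeasure_space_1)
    also have "\<dots> = (\<Prod>i<N. \<integral>\<^sup>+x. ennreal ((p x)\<^sup>2 / q x) \<partial>M)"
      by (rule A.product_nn_integral_prod) auto
    also have "\<dots> \<le> ennreal X ^ N"
      by (induction N) (use X(1) in \<open>auto simp: lessThan_Suc intro!: mult_mono\<close>)
    also have "\<dots> = ennreal (X ^ N)" using X(2) by (simp add: ennreal_power)
    finally show ?thesis .
  qed
  finally show ?thesis
    using l X(2) by (simp add: ennreal_mult[symmetric] mult_left_mono)
qed

context gstate
begin

text \<open>The relative signal at the detector: the noise F / (2 s) divided by the blurred vacuum
  variance 1 / (4 s) + 1 / 2 = (s + 1 / 2) / (2 s). Without the added 1 / 2 the quotient would be 2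
  F, independent of the energy.\<close>

definition "Dl = (1 / (s + 1/2)) \<cdot>\<^sub>m F"
definition "Cov = Sig + (1/2) \<cdot>\<^sub>m 1\<^sub>m (2*n)"

lemma Dl: "symm n Dl" unfolding Dl_def by (intro symm_smult symm_F)

lemma frob_Dl: "frob Dl = frob F / (s + 1/2)"
  unfolding Dl_def using s by (simp add: frob_smult[OF F])

end

text \<open>Outcome covariance of the squeezed vacuum without extra noise, the common reference of
  all hypotheses.\<close>

definition Cov0 :: "nat \<Rightarrow> real \<Rightarrow> real mat" where
  "Cov0 n s = bdiag n ((1 / (4 * s) + 1/2) \<cdot>\<^sub>m 1\<^sub>m n) ((s + 1/2) \<cdot>\<^sub>m 1\<^sub>m n)"

lemma pd_Cov0: "s > 0 \<Longrightarrow> pd (2*n) (Cov0 n s)"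
  unfolding Cov0_def by (intro pd_bdiag pd_scalar) (auto intro: add_pos_pos)

context gstate
begin

lemma Cov_eq: "Cov = bdiag n ((1 / (4 * s) + 1/2) \<cdot>\<^sub>m (1\<^sub>m n + Dl)) ((s + 1/2) \<cdot>\<^sub>m 1\<^sub>m n)"
proof -
  have "1 / (4 * s) + 1/2 = (s + 1/2) / (2 * s)" using s by (simp add: field_simps)
  moreover have "s + 1/2 \<noteq> 0" using s by simp
  ultimately have c: "(1 / (4 * s) + 1/2) / (s + 1/2) = 1 / (2 * s)" by simp
  have D: "(1 / (4 * s) + 1/2) \<cdot>\<^sub>m (1\<^sub>m n + Dl) = Sx + (1/2) \<cdot>\<^sub>m 1\<^sub>m n"
  proof (rule eq_matI)
    fix i j assume "i < dim_row (Sx + (1/2) \<cdot>\<^sub>m 1\<^sub>m n)" "j < dim_col (Sx + (1/2) \<cdot>\<^sub>m 1\<^sub>m n)"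
    then have ij: "i < n" "j < n" by auto
    have "((1 / (4 * s) + 1/2) \<cdot>\<^sub>m (1\<^sub>m n + Dl)) $$ (i,j) =
        (1 / (4 * s) + 1/2) * (1\<^sub>m n) $$ (i,j) + (1 / (4 * s) + 1/2) / (s + 1/2) * F $$ (i,j)"
      using ij F by (simp add: Dl_def algebra_simps)
    also have "\<dots> = (Sx + (1/2) \<cdot>\<^sub>m 1\<^sub>m n) $$ (i,j)"
      unfolding c using ij F s by (auto simp: Sx_F field_simps)
    finally show "((1 / (4 * s) + 1/2) \<cdot>\<^sub>m (1\<^sub>m n + Dl)) $$ (i,j) = (Sx + (1/2) \<cdot>\<^sub>m 1\<^sub>m n) $$ (i,j)" .
  qed (use Sx symm_carrier[OF Dl] in auto)
  show ?thesis
    unfolding Cov_def Sig_def D bdiag_def mult_2 four_block_one_mat[symmetric]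
    using Sx by (intro eq_matI) auto
qed

text \<open>The integrand is a Gaussian whose form is twice the inverse of \<open>Cov\<close> minus
  that of \<open>Cov0\<close>. In units of the reference its position block is 2 (1 + Dl)^-1 - 1,
  again a Cayley transform, and the integral equals 1 / sqrt (det (1 + Dl) det (1 - Dl)).\<close>

lemma chi_square:
  assumes d: "frob Dl < 1"
  shows "pd (2*n) Cov"
    and "(\<integral>\<^sup>+x. ennreal ((gauss_density (2*n) Cov x)\<^sup>2 / gauss_density (2*n) (Cov0 n s) x) \<partial>Rn (2*n)) \<le>
      ennreal (exp ((frob Dl)\<^sup>2 / (1 - (frob Dl)\<^sup>2) / 2))"
proof -
  interpret D: small_symm n Dl by unfold_locales (rule Dl, rule d)
  define \<sigma> where "\<sigma> = 1 / (4 * s) + 1/2"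
  define \<kappa> where "\<kappa> = s + 1/2"
  have pos: "\<sigma> > 0" "\<kappa> > 0" using s by (auto simp: \<sigma>_def \<kappa>_def add_pos_pos)
  have C: "Cov = bdiag n (\<sigma> \<cdot>\<^sub>m (1\<^sub>m n + Dl)) (\<kappa> \<cdot>\<^sub>m 1\<^sub>m n)" unfolding Cov_eq \<sigma>_def \<kappa>_def ..
  have C0: "Cov0 n s = bdiag n (\<sigma> \<cdot>\<^sub>m 1\<^sub>m n) (\<kappa> \<cdot>\<^sub>m 1\<^sub>m n)" unfolding Cov0_def \<sigma>_def \<kappa>_def ..
  show pC: "pd (2*n) Cov" unfolding C using pos by (intro pd_bdiag pd_smult pd_scalar D.pp)
  have pC0: "pd (2*n) (Cov0 n s)" by (rule pd_Cov0[OF s])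
  have iC: "minv Cov = bdiag n ((1/\<sigma>) \<cdot>\<^sub>m D.Rp) ((1/\<kappa>) \<cdot>\<^sub>m 1\<^sub>m n)"
  proof (rule minv_eqI[OF pd_carrier[OF pC]])
    have "\<sigma> \<cdot>\<^sub>m (1\<^sub>m n + Dl) * ((1/\<sigma>) \<cdot>\<^sub>m D.Rp) = \<sigma> \<cdot>\<^sub>m ((1/\<sigma>) \<cdot>\<^sub>m ((1\<^sub>m n + Dl) * D.Rp))"
      using mr(5)[OF pd_carrier[OF D.pp] mr(13)[OF D.Rp(1)]] mr(6)[OF pd_carrier[OF D.pp] D.Rp(1)] by simp
    also have "\<dots> = 1\<^sub>m n" unfolding D.Rp(2) using pos by (intro eq_matI) auto
    finally show "Cov * bdiag n ((1/\<sigma>) \<cdot>\<^sub>m D.Rp) ((1/\<kappa>) \<cdot>\<^sub>m 1\<^sub>m n) = 1\<^sub>m (2*n)"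
      unfolding C using D.Rp(1) pd_carrier[OF D.pp] pos
      by (subst bdiag_mult) (auto simp: scalar_mult one_smult_mat bdiag_one)
  qed (use D.Rp(1) in \<open>auto intro: bdiag_carrier\<close>)
  have iC0: "minv (Cov0 n s) = bdiag n ((1/\<sigma>) \<cdot>\<^sub>m 1\<^sub>m n) ((1/\<kappa>) \<cdot>\<^sub>m 1\<^sub>m n)"
    using pos by (intro minv_eqI[OF pd_carrier[OF pC0]] bdiag_carrier)
      (auto simp: C0 bdiag_mult scalar_mult one_smult_mat bdiag_one)
  define A where "A = bdiag n ((1/\<sigma>) \<cdot>\<^sub>m (2 \<cdot>\<^sub>m D.Rp - 1\<^sub>m n)) ((1/\<kappa>) \<cdot>\<^sub>m 1\<^sub>m n)"
  have pA: "pd (2*n) A" unfolding A_def using pos by (intro pd_bdiag pd_smult pd_scalar D.pd_cayley) auto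
  note [measurable] = qform_measurable[OF pd_carrier[OF pA]]
  have qA: "2 * qform (minv Cov) x - qform (minv (Cov0 n s)) x = qform A x" for x
    unfolding iC iC0 A_def using D.Rp(1)
    by (simp add: qform_bdiag qform_scalar mr qform_smult[of _ n] qform_minus[of _ n] qform_one algebra_simps)
  define dp where "dp = sqrt ((2 * pi) ^ (2*n) * Determinant.det Cov)"
  define dq where "dq = sqrt ((2 * pi) ^ (2*n) * Determinant.det (Cov0 n s))"
  have dpos: "dp > 0" "dq > 0" using pd_det_pos[OF pC] pd_det_pos[OF pC0] by (auto simp: dp_def dq_def)
  have ratio: "(gauss_density (2*n) Cov x)\<^sup>2 / gauss_density (2*n) (Cov0 n s) x = dq / dp\<^sup>2 * exp (- qform A x / 2)" for x
  proof -
    have "exp (- qform A x / 2) * exp (- qform (minv (Cov0 n s)) x / 2) = (exp (- qform (minv Cov) x / 2))\<^sup>2"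
      unfolding power2_eq_square exp_add[symmetric] qA[symmetric] by (simp add: field_simps)
    then show ?thesis
      unfolding gauss_density_minv dp_def[symmetric] dq_def[symmetric]
      using dpos by (simp add: field_simps)
  qed
  have "(\<integral>\<^sup>+x. ennreal ((gauss_density (2*n) Cov x)\<^sup>2 / gauss_density (2*n) (Cov0 n s) x) \<partial>Rn (2*n)) =
     (\<integral>\<^sup>+x. ennreal (dq / dp\<^sup>2) * ennreal (exp (- qform A x / 2)) \<partial>Rn (2*n))"
    unfolding ratio using dpos by (intro nn_integral_cong) (simp add: ennreal_mult[symmetric])
  also have "\<dots> = ennreal (dq / dp\<^sup>2) * ennreal (sqrt ((2 * pi) ^ (2*n) / Determinant.det A))"
    by (subst nn_integral_cmult) (measurable, simp only: nn_integral_gaussian[OF pA])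
  also have "\<dots> = ennreal (dq / dp\<^sup>2 * sqrt ((2 * pi) ^ (2*n) / Determinant.det A))"
    using dpos pd_det_pos[OF pA] by (simp add: ennreal_mult[symmetric])
  also have "dq / dp\<^sup>2 * sqrt ((2 * pi) ^ (2*n) / Determinant.det A) \<le> exp ((frob Dl)\<^sup>2 / (1 - (frob Dl)\<^sup>2) / 2)"
  proof -
    define v where "v = Determinant.det (1\<^sub>m n + Dl)"
    define w where "w = Determinant.det (1\<^sub>m n - Dl)"
    define T where "T = (2 * pi) ^ (2 * n)"
    define k where "k = (\<sigma> * \<kappa>) ^ n"
    have vw: "v > 0" "w > 0" unfolding v_def w_def by (rule pd_det_pos[OF D.pp], rule pd_det_pos[OF D.pm])
    have Tk: "T > 0" "k > 0" using pos by (auto simp: T_def k_def)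
    have dRp: "Determinant.det D.Rp = 1 / v"
      using det_mult[OF pd_carrier[OF D.pp] D.Rp(1)] vw unfolding D.Rp(2) v_def by (simp add: field_simps)
    have dC: "Determinant.det Cov = k * v"
      unfolding C v_def k_def using symm_carrier[OF Dl] by (simp add: det_bdiag power_mult_distrib)
    have dC0: "Determinant.det (Cov0 n s) = k"
      unfolding C0 k_def by (simp add: det_bdiag power_mult_distrib)
    have "Determinant.det A = (1/\<sigma>) ^ n * (w * (1 / v)) * (1/\<kappa>) ^ n"
      unfolding A_def using D.Rp(1) by (simp add: det_bdiag mr D.det_cayley w_def[symmetric] dRp)
    also have "\<dots> = w / (v * k)" using pos by (simp add: k_def power_divide power_mult_distrib)
    finally have dA: "Determinant.det A = w / (v * k)" .
    have "dq / dp\<^sup>2 * sqrt (T / Determinant.det A) = sqrt (T * k) * sqrt (T / (w / (v * k))) / (T * (k * v))"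
      unfolding dq_def dp_def dC dC0 dA T_def[symmetric] using Tk vw by simp
    also have "sqrt (T * k) * sqrt (T / (w / (v * k))) = sqrt ((T * k)\<^sup>2 * (v / w))"
      unfolding real_sqrt_mult[symmetric] by (simp add: power2_eq_square ac_simps)
    also have "\<dots> = (T * k) * sqrt (v / w)" unfolding real_sqrt_mult using Tk by simp
    also have "(T * k) * sqrt (v / w) / (T * (k * v)) = sqrt (v / w) / v" using Tk by (simp add: field_simps)
    also have "\<dots> = 1 / sqrt (v * w)"
    proof -
      have "v = sqrt v * sqrt v" using vw by simp
      then show ?thesis using vw by (simp add: real_sqrt_mult real_sqrt_divide field_simps)
    qed
    also have "\<dots> \<le> exp ((frob Dl)\<^sup>2 / (1 - (frob Dl)\<^sup>2) / 2)"
    proof -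
      define e where "e = (frob Dl)\<^sup>2 / (1 - (frob Dl)\<^sup>2)"
      have "exp (- e) \<le> v * w"
        unfolding e_def v_def w_def by (rule det_one_plus_one_minus_ge[OF Dl d])
      moreover have "exp (- e) = (exp (- e / 2))\<^sup>2" unfolding power2_eq_square exp_add[symmetric] by simp
      ultimately have "exp (- e / 2) \<le> sqrt (v * w)" by (intro real_le_rsqrt) simp
      then have "1 / sqrt (v * w) \<le> 1 / exp (- e / 2)" by (intro divide_left_mono) (use vw in auto)
      also have "\<dots> = exp (e / 2)" by (simp add: exp_minus field_simps)
      finally show ?thesis by (simp add: e_def)
    qed
    finally show ?thesis by (simp add: T_def)
  qed
  finally show "(\<integral>\<^sup>+x. ennreal ((gauss_density (2*n) Cov x)\<^sup>2 / gauss_density (2*n) (Cov0 n s) x) \<partial>Rn (2*n)) \<le>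
      ennreal (exp ((frob Dl)\<^sup>2 / (1 - (frob Dl)\<^sup>2) / 2))" by (simp add: ennreal_leI)
qed

text \<open>All Gaussian measures share the sigma algebra of \<open>Rn\<close>, so a success event
  of one hypothesis can be evaluated under the reference.\<close>

lemma hetero_samples_le:
  assumes d: "frob Dl < 1" and l: "l > 0"
    and S: "S \<in> sets (hetero_samples n N Sig)"
  defines "Q \<equiv> PiM {..<N} (\<lambda>_. gauss_measure (2*n) (Cov0 n s)) \<Otimes>\<^sub>M uniform_measure lborel {0..1::real}"
  shows "S \<in> sets Q"
    and "emeasure (hetero_samples n N Sig) S \<le> ennreal (l / 2) * emeasure Q S +
      ennreal (exp ((frob Dl)\<^sup>2 / (1 - (frob Dl)\<^sup>2) / 2) ^ N / (2 * l))"
proof -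
  have U: "prob_space (uniform_measure lborel {0..1::real})" by (rule prob_space_uniform_measure) auto
  have sets: "sets (PiM {..<N} (\<lambda>_. gauss_measure (2*n) A) \<Otimes>\<^sub>M uniform_measure lborel {0..1::real}) =
     sets (PiM {..<N} (\<lambda>_. Rn (2*n)) \<Otimes>\<^sub>M uniform_measure lborel {0..1::real})" for A
    by (intro sets_pair_measure_cong sets_PiM_cong refl) (simp add: gauss_measure_def)
  have h: "hetero_samples n N Sig = PiM {..<N} (\<lambda>_. gauss_measure (2*n) Cov) \<Otimes>\<^sub>M uniform_measure lborel {0..1::real}"
    by (simp add: hetero_samples_def Cov_def)
  show "S \<in> sets Q" using S unfolding h Q_def sets .
  have S': "S \<in> sets (PiM {..<N} (\<lambda>_. Rn (2*n)) \<Otimes>\<^sub>M uniform_measure lborel {0..1::real})"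
    using S unfolding h sets .
  note pC = chi_square(1)[OF d] and pC0 = pd_Cov0[OF s, of n]
  show "emeasure (hetero_samples n N Sig) S \<le> ennreal (l / 2) * emeasure Q S +
      ennreal (exp ((frob Dl)\<^sup>2 / (1 - (frob Dl)\<^sup>2) / 2) ^ N / (2 * l))"
    unfolding h Q_def gauss_measure_def
    by (rule iid_chi_square[OF sigma_finite_Rn gauss_density_measurable[OF pC] gauss_density_measurable[OF pC0]
      less_imp_le[OF gauss_density_pos[OF pC]] gauss_density_pos[OF pC0]
      prob_space_gauss_measure[OF pC, unfolded gauss_measure_def] prob_space_gauss_measure[OF pC0, unfolded gauss_measure_def]
      U l chi_square(2)[OF d] _ S']) simp
qed

end

section \<open>Sign matrices\<close>

definition sign_cube :: "nat \<Rightarrow> (nat \<times> nat \<Rightarrow> real) set" where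
  "sign_cube m = PiE ({..<m} \<times> {..<m}) (\<lambda>_. {-1, 1})"

text \<open>Indices from \<open>2 * m\<close> on get zero rows and columns: for odd \<open>n\<close>
  one mode carries no sign.\<close>

definition signT :: "nat \<Rightarrow> nat \<Rightarrow> (nat \<times> nat \<Rightarrow> real) \<Rightarrow> real mat" where
  "signT n m B = Matrix.mat n n (\<lambda>(i,j). if i < m \<and> m \<le> j \<and> j < 2*m then B (i, j - m)
     else if j < m \<and> m \<le> i \<and> i < 2*m then B (j, i - m) else 0)"

lemma signT_carrier [simp]: "signT n m B \<in> carrier_mat n n"
  by (simp add: signT_def)

lemma signT_dim [simp]: "dim_row (signT n m B) = n" "dim_col (signT n m B) = n"
  by (simp_all add: signT_def)

lemma signT_symm: "symm n (signT n m B)"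
  by (rule symmI) (auto simp: signT_def)

lemma signT_odd: "i < n \<Longrightarrow> j < n \<Longrightarrow> same_block m i j \<Longrightarrow> signT n m B $$ (i,j) = 0"
  by (auto simp: signT_def same_block_def)

lemma signT_index:
  assumes "2 * m \<le> n"
  shows "i < m \<Longrightarrow> j < m \<Longrightarrow> signT n m B $$ (i,j) = 0"
    "i < m \<Longrightarrow> j < m \<Longrightarrow> signT n m B $$ (i,j+m) = B (i,j)"
    "i < m \<Longrightarrow> j < m \<Longrightarrow> signT n m B $$ (i+m,j) = B (j,i)"
    "i < m \<Longrightarrow> j < m \<Longrightarrow> signT n m B $$ (i+m,j+m) = 0"
    "2 * m \<le> i \<Longrightarrow> i < n \<Longrightarrow> j < n \<Longrightarrow> signT n m B $$ (i,j) = 0"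
    "2 * m \<le> j \<Longrightarrow> i < n \<Longrightarrow> j < n \<Longrightarrow> signT n m B $$ (i,j) = 0"
  using assms by (auto simp: signT_def)

lemma sum_two_blocks:
  fixes f :: "nat \<Rightarrow> real"
  assumes "2 * m \<le> n" "\<And>l. 2 * m \<le> l \<Longrightarrow> l < n \<Longrightarrow> f l = 0"
  shows "(\<Sum>l<n. f l) = (\<Sum>l<m. f l) + (\<Sum>l<m. f (l + m))"
proof -
  have "(\<Sum>l<n. f l) = (\<Sum>l<2*m. f l)"
    using assms by (intro sum.mono_neutral_right) auto
  then show ?thesis by (simp add: sum_double)
qed

lemma signT_combination:
  "a \<cdot>\<^sub>m signT n m B - b \<cdot>\<^sub>m signT n m B' = signT n m (\<lambda>p. a * B p - b * B' p)"
  by (intro eq_matI) (auto simp: signT_def)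

lemma mip_signT:
  assumes "2 * m \<le> n"
  shows "mip (signT n m B) (signT n m B) = 2 * (\<Sum>i<m. \<Sum>j<m. (B (i,j))\<^sup>2)"
proof -
  let ?T = "signT n m B"
  have row: "(\<Sum>j<n. ?T $$ (i,j) * ?T $$ (i,j)) = (\<Sum>j<m. ?T $$ (i,j) * ?T $$ (i,j)) + (\<Sum>j<m. ?T $$ (i,j+m) * ?T $$ (i,j+m))"
    if "i < n" for i
    using that assms by (intro sum_two_blocks) (auto simp: signT_index)
  have "mip ?T ?T = (\<Sum>i<m. \<Sum>j<n. ?T $$ (i,j) * ?T $$ (i,j)) + (\<Sum>i<m. \<Sum>j<n. ?T $$ (i+m,j) * ?T $$ (i+m,j))"
    unfolding mip_eq[OF signT_carrier] using assms by (intro sum_two_blocks) (auto simp: signT_index)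
  also have "(\<Sum>i<m. \<Sum>j<n. ?T $$ (i,j) * ?T $$ (i,j)) = (\<Sum>i<m. \<Sum>j<m. (B (i,j))\<^sup>2)"
    by (rule sum.cong[OF refl]) (use assms in \<open>simp add: row signT_index power2_eq_square\<close>)
  also have "(\<Sum>i<m. \<Sum>j<n. ?T $$ (i+m,j) * ?T $$ (i+m,j)) = (\<Sum>i<m. \<Sum>j<m. (B (j,i))\<^sup>2)"
    by (rule sum.cong[OF refl]) (use assms in \<open>simp add: row signT_index power2_eq_square\<close>)
  also have "\<dots> = (\<Sum>i<m. \<Sum>j<m. (B (i,j))\<^sup>2)" by (rule sum.swap)
  finally show ?thesis by simp
qed

text \<open>The square of an odd matrix is even; its diagonal blocks are B B^T and B^T B.\<close>

lemma signT_sq_index: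
  assumes "2 * m \<le> n"
  shows "i < m \<Longrightarrow> j < m \<Longrightarrow> (signT n m B * signT n m B) $$ (i,j) = (\<Sum>k<m. B (i,k) * B (j,k))"
    "i < m \<Longrightarrow> j < m \<Longrightarrow> (signT n m B * signT n m B) $$ (i+m,j+m) = (\<Sum>k<m. B (k,i) * B (k,j))"
    "i < n \<Longrightarrow> j < n \<Longrightarrow> \<not> same_block m i j \<Longrightarrow> (signT n m B * signT n m B) $$ (i,j) = 0"
    "2 * m \<le> i \<Longrightarrow> i < n \<Longrightarrow> j < n \<Longrightarrow> (signT n m B * signT n m B) $$ (i,j) = 0"
    "2 * m \<le> j \<Longrightarrow> i < n \<Longrightarrow> j < n \<Longrightarrow> (signT n m B * signT n m B) $$ (i,j) = 0"
proof -
  let ?T = "signT n m B"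
  note mi = mult_index[OF signT_carrier[of n m B] signT_carrier[of n m B]]
  have row: "(?T * ?T) $$ (i,j) = (\<Sum>l<m. ?T $$ (i,l) * ?T $$ (l,j)) + (\<Sum>l<m. ?T $$ (i,l+m) * ?T $$ (l+m,j))"
    if "i < n" "j < n" for i j
    unfolding mi[OF that] using that assms by (intro sum_two_blocks) (auto simp: signT_index)
  show "i < m \<Longrightarrow> j < m \<Longrightarrow> (?T * ?T) $$ (i,j) = (\<Sum>k<m. B (i,k) * B (j,k))"
    using assms by (simp add: row signT_index)
  show "i < m \<Longrightarrow> j < m \<Longrightarrow> (?T * ?T) $$ (i+m,j+m) = (\<Sum>k<m. B (k,i) * B (k,j))"
    using assms by (simp add: row signT_index)
  show "i < n \<Longrightarrow> j < n \<Longrightarrow> \<not> same_block m i j \<Longrightarrow> (?T * ?T) $$ (i,j) = 0"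
    unfolding mi using signT_odd[of i n _ m B] signT_odd[of _ n j m B]
    by (intro sum.neutral) (auto simp: same_block_def)
  show "2 * m \<le> i \<Longrightarrow> i < n \<Longrightarrow> j < n \<Longrightarrow> (?T * ?T) $$ (i,j) = 0"
    unfolding mi using assms by (intro sum.neutral) (auto simp: signT_index)
  show "2 * m \<le> j \<Longrightarrow> i < n \<Longrightarrow> j < n \<Longrightarrow> (?T * ?T) $$ (i,j) = 0"
    unfolding mi using assms by (intro sum.neutral) (auto simp: signT_index)
qed

lemma mip_signT_sq:
  assumes "2 * m \<le> n"
  shows "mip (signT n m B * signT n m B) (signT n m B * signT n m B) =
    (\<Sum>i<m. \<Sum>j<m. (\<Sum>k<m. B (i,k) * B (j,k))\<^sup>2) + (\<Sum>i<m. \<Sum>j<m. (\<Sum>k<m. B (k,i) * B (k,j))\<^sup>2)"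
proof -
  let ?W = "signT n m B * signT n m B"
  have W: "?W \<in> carrier_mat n n" by (rule mult_carrier_mat[OF signT_carrier signT_carrier])
  have row: "(\<Sum>j<n. ?W $$ (i,j) * ?W $$ (i,j)) = (\<Sum>j<m. ?W $$ (i,j) * ?W $$ (i,j)) + (\<Sum>j<m. ?W $$ (i,j+m) * ?W $$ (i,j+m))"
    if "i < n" for i
    using that assms by (intro sum_two_blocks) (auto simp: signT_sq_index)
  have "mip ?W ?W = (\<Sum>i<m. \<Sum>j<n. ?W $$ (i,j) * ?W $$ (i,j)) + (\<Sum>i<m. \<Sum>j<n. ?W $$ (i+m,j) * ?W $$ (i+m,j))"
    unfolding mip_eq[OF W] using assms by (intro sum_two_blocks) (auto simp: signT_sq_index)
  also have "(\<Sum>i<m. \<Sum>j<n. ?W $$ (i,j) * ?W $$ (i,j)) = (\<Sum>i<m. \<Sum>j<m. (\<Sum>k<m. B (i,k) * B (j,k))\<^sup>2)"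
    by (rule sum.cong[OF refl]) (use assms in \<open>simp add: row signT_sq_index power2_eq_square same_block_def\<close>)
  also have "(\<Sum>i<m. \<Sum>j<n. ?W $$ (i+m,j) * ?W $$ (i+m,j)) = (\<Sum>i<m. \<Sum>j<m. (\<Sum>k<m. B (k,i) * B (k,j))\<^sup>2)"
    by (rule sum.cong[OF refl]) (use assms in \<open>simp add: row signT_sq_index power2_eq_square same_block_def\<close>)
  finally show ?thesis .
qed

lemma finite_sign_cube: "finite (sign_cube m)"
  unfolding sign_cube_def by (intro finite_PiE) auto

lemma card_sign_cube: "card (sign_cube m) = 2 ^ (m * m)"
  unfolding sign_cube_def by (subst card_PiE) (auto simp: card_insert_if numeral_2_eq_2)

lemma sign_cube_sq: "B \<in> sign_cube m \<Longrightarrow> i < m \<Longrightarrow> j < m \<Longrightarrow> (B (i,j))\<^sup>2 = 1"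
  unfolding sign_cube_def PiE_def Pi_def by (auto simp: power2_eq_1_iff dest!: bspec[of _ _ "(i,j)"])

lemma mip_signT_cube:
  assumes "2 * m \<le> n" "B \<in> sign_cube m"
  shows "mip (signT n m B) (signT n m B) = 2 * (real m)\<^sup>2"
  unfolding mip_signT[OF assms(1)] using assms(2) by (simp add: sign_cube_sq) (simp add: power2_eq_square)

text \<open>When both index pairs are distinct, the entry \<open>(a,b)\<close> occurs exactly once
  in the product, and flipping its sign is an involution of the cube that negates the
  product.\<close>

lemma sign_cube_quad:
  assumes ab: "a < m" "a' < m" "b < m" "b' < m"
  shows "(\<Sum>B\<in>sign_cube m. B (a,b) * B (a',b) * (B (a,b') * B (a',b'))) =
    (if a = a' \<or> b = b' then 2 ^ (m * m) else (0 :: real))"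
proof (cases "a = a' \<or> b = b'")
  case True
  have "B (a,b) * B (a',b) * (B (a,b') * B (a',b')) = 1" if "B \<in> sign_cube m" for B
  proof -
    have "B (a,b) * B (a',b) * (B (a,b') * B (a',b')) = (if a = a' then (B (a,b))\<^sup>2 * (B (a,b'))\<^sup>2 else (B (a,b))\<^sup>2 * (B (a',b))\<^sup>2)"
      using True by (auto simp: power2_eq_square)
    then show ?thesis using that ab by (simp add: sign_cube_sq)
  qed
  then show ?thesis using True by (simp add: card_sign_cube)
next
  case False
  define flip where "flip B = B((a,b) := - B (a,b))" for B :: "nat \<times> nat \<Rightarrow> real"
  define f where "f B = B (a,b) * B (a',b) * (B (a,b') * B (a',b'))" for B :: "nat \<times> nat \<Rightarrow> real"
  have fl: "flip B \<in> sign_cube m" if "B \<in> sign_cube m" for B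
  proof -
    have "B (a,b) \<in> {-1, 1}" using that ab by (auto simp: sign_cube_def PiE_def Pi_def)
    then show ?thesis using that ab by (auto simp: sign_cube_def flip_def PiE_def Pi_def extensional_def)
  qed
  have "sum f (sign_cube m) = sum (\<lambda>B. f (flip B)) (sign_cube m)"
    by (rule sum.reindex_bij_witness[of _ flip flip]) (use fl in \<open>auto simp: flip_def\<close>)
  also have "\<dots> = - sum f (sign_cube m)"
    unfolding sum_negf[symmetric] using False by (intro sum.cong refl) (auto simp: f_def flip_def)
  finally show ?thesis using False by (simp add: f_def)
qed

text \<open>Inclusion-exclusion: two families of m^3 quadruples that overlap in m^2.\<close>

lemma sum_quad_count:
  "(\<Sum>i<m. \<Sum>j<m. \<Sum>k<m. \<Sum>l<m. (if i = j \<or> k = l then c else 0)) = c * (2 * real m ^ 3 - real m ^ 2)"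
proof -
  have "(\<Sum>i<m. \<Sum>j<m. \<Sum>k<m. \<Sum>l<m. (if i = j \<or> k = l then c else 0)) =
    (\<Sum>i<m. \<Sum>j<m. \<Sum>k<m. \<Sum>l<m. (if i = j then c else 0) + (if k = l then c else 0) - (if i = j then (if k = l then c else 0) else 0))"
    by (intro sum.cong refl) auto
  also have "\<dots> = (\<Sum>i<m. \<Sum>j<m. (if i = j then c * real m ^ 2 - c * real m else 0) + c * real m)"
    by (intro sum.cong refl) (simp add: sum.distrib sum_subtractf power2_eq_square algebra_simps)
  also have "\<dots> = c * (2 * real m ^ 3 - real m ^ 2)"
    by (simp add: sum.distrib power2_eq_square power3_eq_cube algebra_simps)
  finally show ?thesis .
qed

lemma sum_mip_signT_sq:
  assumes "2 * m \<le> n"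
  shows "(\<Sum>B\<in>sign_cube m. mip (signT n m B * signT n m B) (signT n m B * signT n m B)) =
    2 ^ (m * m) * (4 * real m ^ 3 - 2 * real m ^ 2)"
proof -
  have "(\<Sum>B\<in>sign_cube m. \<Sum>i<m. \<Sum>j<m. (\<Sum>k<m. B (i,k) * B (j,k))\<^sup>2) =
    (\<Sum>i<m. \<Sum>j<m. \<Sum>k<m. \<Sum>l<m. \<Sum>B\<in>sign_cube m. B (i,k) * B (j,k) * (B (i,l) * B (j,l)))"
    unfolding power2_eq_square sum_product
    by (subst sum.swap, intro sum.cong refl, subst sum.swap, intro sum.cong refl, subst sum.swap, intro sum.cong refl, rule sum.swap)
  also have "\<dots> = (\<Sum>i<m. \<Sum>j<m. \<Sum>k<m. \<Sum>l<m. (if i = j \<or> k = l then 2 ^ (m * m) else 0))"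
    by (intro sum.cong refl) (simp add: sign_cube_quad)
  also note sum_quad_count
  finally have 1: "(\<Sum>B\<in>sign_cube m. \<Sum>i<m. \<Sum>j<m. (\<Sum>k<m. B (i,k) * B (j,k))\<^sup>2) = 2 ^ (m * m) * (2 * real m ^ 3 - real m ^ 2)" .
  have "(\<Sum>B\<in>sign_cube m. \<Sum>i<m. \<Sum>j<m. (\<Sum>k<m. B (k,i) * B (k,j))\<^sup>2) =
    (\<Sum>i<m. \<Sum>j<m. \<Sum>k<m. \<Sum>l<m. \<Sum>B\<in>sign_cube m. B (k,i) * B (k,j) * (B (l,i) * B (l,j)))"
    unfolding power2_eq_square sum_product
    by (subst sum.swap, intro sum.cong refl, subst sum.swap, intro sum.cong refl, subst sum.swap, intro sum.cong refl, rule sum.swap)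
  also have "\<dots> = (\<Sum>i<m. \<Sum>j<m. \<Sum>k<m. \<Sum>l<m. (if i = j \<or> k = l then 2 ^ (m * m) else 0))"
  proof (intro sum.cong refl)
    fix i j k l assume "i \<in> {..<m}" "j \<in> {..<m}" "k \<in> {..<m}" "l \<in> {..<m}"
    then have "(\<Sum>B\<in>sign_cube m. B (k,i) * B (l,i) * (B (k,j) * B (l,j))) = (if k = l \<or> i = j then 2 ^ (m * m) else (0 :: real))"
      by (intro sign_cube_quad) auto
    then show "(\<Sum>B\<in>sign_cube m. B (k,i) * B (k,j) * (B (l,i) * B (l,j))) = (if i = j \<or> k = l then 2 ^ (m * m) else 0)"
      by (simp add: ac_simps disj_commute)
  qed
  also note sum_quad_count
  finally have 2: "(\<Sum>B\<in>sign_cube m. \<Sum>i<m. \<Sum>j<m. (\<Sum>k<m. B (k,i) * B (k,j))\<^sup>2) = 2 ^ (m * m) * (2 * real m ^ 3 - real m ^ 2)" .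
  show ?thesis unfolding mip_signT_sq[OF assms] sum.distrib 1 2 by (simp add: algebra_simps)
qed

text \<open>The bounded quantity is the trace of T^4. Its mean over the cube is 4 m^3 - 2 m^2, so
  the threshold lies only slightly above the mean.\<close>

definition flat_signs :: "nat \<Rightarrow> nat \<Rightarrow> (nat \<times> nat \<Rightarrow> real) set" where
  "flat_signs n m = {B \<in> sign_cube m. mip (signT n m B * signT n m B) (signT n m B * signT n m B) \<le> 4 * real m ^ 3}"

lemma flat_signs_subset: "flat_signs n m \<subseteq> sign_cube m"
  by (auto simp: flat_signs_def)

text \<open>Markov's inequality with the slack 2 m^2 out of 4 m^3. The resulting fraction 1 / (2 m)
  is merely polynomially small, harmless against Hamming balls that are exponentially small in
  m^2.\<close>

lemma card_flat_signs:
  assumes "2 * m \<le> n" "0 < m"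
  shows "2 ^ (m * m) \<le> 2 * real m * real (card (flat_signs n m))"
proof -
  define W where "W B = mip (signT n m B * signT n m B) (signT n m B * signT n m B)" for B
  define bad where "bad = sign_cube m - flat_signs n m"
  have fin: "finite bad" using finite_sign_cube by (simp add: bad_def)
  have c: "real (card bad) + real (card (flat_signs n m)) = 2 ^ (m * m)"
  proof -
    have "card bad + card (flat_signs n m) = card (sign_cube m)"
      unfolding bad_def using flat_signs_subset[of n m] finite_sign_cube[of m]
      by (simp add: card_Diff_subset finite_subset card_mono)
    then show ?thesis unfolding card_sign_cube by (metis of_nat_add of_nat_numeral of_nat_power)
  qed
  have "real (card bad) * (4 * real m ^ 3) = (\<Sum>B\<in>bad. 4 * real m ^ 3)" by simp
  also have "\<dots> \<le> (\<Sum>B\<in>bad. W B)" by (rule sum_mono) (auto simp: bad_def flat_signs_def W_def)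
  also have "\<dots> \<le> (\<Sum>B\<in>sign_cube m. W B)"
    by (rule sum_mono2[OF finite_sign_cube]) (auto simp: bad_def W_def mip_self_nonneg)
  also have "\<dots> = 2 ^ (m * m) * (4 * real m ^ 3 - 2 * real m ^ 2)"
    unfolding W_def by (rule sum_mip_signT_sq[OF assms(1)])
  finally have "real (card bad) * (2 * real m) * (2 * real m ^ 2) \<le> 2 ^ (m * m) * (2 * real m - 1) * (2 * real m ^ 2)"
    by (simp add: algebra_simps power2_eq_square power3_eq_cube)
  then have "real (card bad) * (2 * real m) \<le> 2 ^ (m * m) * (2 * real m - 1)"
    by (rule mult_right_le_imp_le) (use assms in auto)
  then have "2 ^ (m * m) \<le> 2 * real m * (2 ^ (m * m) - real (card bad))" by (simp add: algebra_simps)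
  moreover have "2 ^ (m * m) - real (card bad) = real (card (flat_signs n m))" using c by simp
  ultimately show ?thesis by simp
qed

definition hamming :: "nat \<Rightarrow> (nat \<times> nat \<Rightarrow> real) \<Rightarrow> (nat \<times> nat \<Rightarrow> real) \<Rightarrow> nat" where
  "hamming m B B' = card {p \<in> {..<m} \<times> {..<m}. B p \<noteq> B' p}"

text \<open>Generating function of the distances: the weight factorises over the entries, where
  agreement contributes 1 and disagreement \<open>x\<close>.\<close>

lemma sum_hamming_weight:
  fixes x :: real
  assumes "B \<in> sign_cube m"
  shows "(\<Sum>B'\<in>sign_cube m. x ^ hamming m B B') = (1 + x) ^ (m * m)"
proof -
  let ?I = "{..<m} \<times> {..<m}"
  have "x ^ hamming m B B' = (\<Prod>p\<in>?I. if B p \<noteq> B' p then x else 1)" for B'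
    by (subst prod.If_cases) (auto simp: hamming_def Int_def)
  then have "(\<Sum>B'\<in>sign_cube m. x ^ hamming m B B') = (\<Sum>B'\<in>sign_cube m. \<Prod>p\<in>?I. if B p \<noteq> B' p then x else 1)"
    by simp
  also have "\<dots> = (\<Prod>p\<in>?I. \<Sum>b\<in>{-1,1}. if B p \<noteq> b then x else 1)"
    unfolding sign_cube_def by (rule prod_sum_PiE[symmetric]) auto
  also have "\<dots> = (\<Prod>p\<in>?I. 1 + x)"
  proof (rule prod.cong[OF refl])
    fix p assume "p \<in> ?I"
    then have "B p \<in> {-1, 1}" using assms by (auto simp: sign_cube_def PiE_def Pi_def)
    then show "(\<Sum>b\<in>{-1,1}. if B p \<noteq> b then x else 1) = 1 + x" by auto
  qed
  also have "\<dots> = (1 + x) ^ (m * m)" by (simp add: card_cartesian_product)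
  finally show ?thesis .
qed

text \<open>Weighting each point by \<open>(1/3) ^ hamming\<close> is the optimal Chernoff weight for radius \<open>m\<^sup>2 / 4\<close>.\<close>

lemma card_hamming_ball:
  fixes r :: real
  assumes B: "B \<in> sign_cube m" and r: "r > 0" "r ^ 4 = 3"
    and A: "A \<subseteq> sign_cube m" "\<And>B'. B' \<in> A \<Longrightarrow> 4 * hamming m B B' \<le> m * m"
  shows "real (card A) \<le> (4 * r / 3) ^ (m * m)"
proof -
  have r1: "r \<ge> 1"
  proof (rule ccontr)
    assume "\<not> r \<ge> 1"
    then have "r ^ 4 \<le> 1" using r(1) by (intro power_le_one) auto
    then show False using r(2) by simp
  qed
  have fin: "finite A" using A(1) finite_sign_cube finite_subset by blast
  have "real (card A) * (1 / r ^ (m * m)) = (\<Sum>B'\<in>A. 1 / r ^ (m * m))" by simp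
  also have "\<dots> \<le> (\<Sum>B'\<in>A. (1/3) ^ hamming m B B')"
  proof (rule sum_mono)
    fix B' assume "B' \<in> A"
    \<comment> \<open>The fourth root \<open>r\<close> of three avoids rounding
      \<open>m * m / 4\<close>: exponents are compared through
      \<open>4 * hamming m B B'\<close>.\<close>
    have "(1/3 :: real) ^ hamming m B B' = 1 / r ^ (4 * hamming m B B')"
      by (simp add: power_mult r(2) power_divide)
    moreover have "r ^ (4 * hamming m B B') \<le> r ^ (m * m)" by (rule power_increasing[OF A(2)[OF \<open>B' \<in> A\<close>] r1])
    ultimately show "1 / r ^ (m * m) \<le> (1/3) ^ hamming m B B'" using r(1) by (simp add: frac_le)
  qed
  also have "\<dots> \<le> (\<Sum>B'\<in>sign_cube m. (1/3) ^ hamming m B B')"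
    by (rule sum_mono2[OF finite_sign_cube A(1)]) simp
  also have "\<dots> = (4/3) ^ (m * m)" unfolding sum_hamming_weight[OF B] by simp
  finally have "real (card A) \<le> (4/3) ^ (m * m) * r ^ (m * m)" using r(1) by (simp add: field_simps)
  then show ?thesis by (simp add: power_mult_distrib[symmetric])
qed

text \<open>Where the signs differ, the scaled difference is plus or minus \<open>a + b\<close>, so
  unequal weights cannot cancel. Each entry occurs twice in the symmetric matrix, whence the factor
  2.\<close>

lemma mip_signT_diff_ge:
  fixes a b :: real
  assumes "2 * m \<le> n" "B \<in> sign_cube m" "B' \<in> sign_cube m" "a \<ge> 0" "b \<ge> 0"
  shows "2 * (a + b)\<^sup>2 * hamming m B B' \<le>
    mip (a \<cdot>\<^sub>m signT n m B - b \<cdot>\<^sub>m signT n m B') (a \<cdot>\<^sub>m signT n m B - b \<cdot>\<^sub>m signT n m B')"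
proof -
  let ?I = "{..<m} \<times> {..<m}"
  have "(a + b)\<^sup>2 * hamming m B B' = (\<Sum>p\<in>{p \<in> ?I. B p \<noteq> B' p}. (a + b)\<^sup>2)"
    by (simp add: hamming_def)
  also have "\<dots> \<le> (\<Sum>p\<in>{p \<in> ?I. B p \<noteq> B' p}. (a * B p - b * B' p)\<^sup>2)"
  proof (rule sum_mono)
    fix p assume p: "p \<in> {p \<in> ?I. B p \<noteq> B' p}"
    then have "B p \<in> {-1, 1}" "B' p \<in> {-1, 1}" using assms(2,3) by (auto simp: sign_cube_def PiE_def Pi_def)
    then have "a * B p - b * B' p = (a + b) \<or> a * B p - b * B' p = - (a + b)" using p by auto
    then show "(a + b)\<^sup>2 \<le> (a * B p - b * B' p)\<^sup>2" by (metis order_refl power2_minus)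
  qed
  also have "\<dots> \<le> (\<Sum>p\<in>?I. (a * B p - b * B' p)\<^sup>2)"
    by (rule sum_mono2) auto
  also have "\<dots> = (\<Sum>i<m. \<Sum>j<m. (a * B (i,j) - b * B' (i,j))\<^sup>2)"
    by (simp add: sum.cartesian_product case_prod_unfold)
  finally show ?thesis unfolding signT_combination mip_signT[OF assms(1)] by simp
qed

text \<open>Cyclicity turns the squared norm into the trace of A^2 B^2, to which Cauchy-Schwarz
  applies.\<close>

lemma frob_mult_symm_le:
  assumes "symm n A" "symm n B"
  shows "(frob (A * B))\<^sup>2 \<le> frob (A * A) * frob (B * B)"
proof -
  note A = symm_carrier[OF assms(1)] and B = symm_carrier[OF assms(2)] and mr = mat_ring_simps[where n=n]
  have "(frob (A * B))\<^sup>2 = mip (A * B) (A * B)" by (rule frob_sq)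
  also have "\<dots> = mip A (A * B * B)" by (rule mip_mult_right[OF assms(2) A]) (use A B in \<open>auto simp: mr\<close>)
  also have "\<dots> = mip (A * 1\<^sub>m n) (A * (B * B))" using A B by (simp add: mr)
  also have "\<dots> = mip (A * (A * 1\<^sub>m n)) (B * B)"
    by (rule mip_mult_left[OF assms(1), symmetric]) (use A B in \<open>auto simp: mr\<close>)
  also have "\<dots> = mip (A * A) (B * B)" using A by simp
  also have "\<dots> \<le> frob (A * A) * frob (B * B)" using mip_le_frob[of "A * A" n "B * B"] A B by simp
  finally show ?thesis .
qed

text \<open>Minkowski's inequality for the fourth Schatten norm, whose square is
  \<open>frob (A * A)\<close>, in the case of equal bounds; there expanding the square is
  enough.\<close>

lemma frob_sq_diff_le:
  assumes A: "symm n A" "frob (A * A) \<le> q" and B: "symm n B" "frob (B * B) \<le> q" and ab: "a \<ge> 0" "b \<ge> 0"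
  defines "T \<equiv> a \<cdot>\<^sub>m A - b \<cdot>\<^sub>m B"
  shows "frob (T * T) \<le> (a + b)\<^sup>2 * q"
proof -
  note Ac = symm_carrier[OF A(1)] and Bc = symm_carrier[OF B(1)] and mr = mat_ring_simps[where n=n]
  have q: "q \<ge> 0" using A(2) frob_nonneg order_trans by blast
  have cross: "frob (X * Y) \<le> q" if "symm n X" "symm n Y" "frob (X * X) \<le> q" "frob (Y * Y) \<le> q" for X Y
  proof -
    have "(frob (X * Y))\<^sup>2 \<le> q * q" by (rule order_trans[OF frob_mult_symm_le[OF that(1,2)]]) (intro mult_mono that q frob_nonneg)
    then show ?thesis using q by (metis abs_le_square_iff abs_of_nonneg frob_nonneg power2_eq_square)
  qed
  have "T * T = (a * a) \<cdot>\<^sub>m (A * A) - (a * b) \<cdot>\<^sub>m (A * B) - ((a * b) \<cdot>\<^sub>m (B * A) - (b * b) \<cdot>\<^sub>m (B * B))"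
    unfolding T_def using Ac Bc by (simp add: mr) (intro eq_matI, auto simp: algebra_simps)
  then have "frob (T * T) \<le> (frob ((a * a) \<cdot>\<^sub>m (A * A)) + frob ((a * b) \<cdot>\<^sub>m (A * B))) + (frob ((a * b) \<cdot>\<^sub>m (B * A)) + frob ((b * b) \<cdot>\<^sub>m (B * B)))"
    using Ac Bc by (auto intro!: order_trans[OF frob_minus[of _ n]] add_mono simp: mr)
  also have "\<dots> = a * a * frob (A * A) + a * b * frob (A * B) + (a * b * frob (B * A) + b * b * frob (B * B))"
    using Ac Bc ab by (simp add: frob_smult[of _ n] mr abs_mult)
  also have "\<dots> \<le> a * a * q + a * b * q + (a * b * q + b * b * q)"
    using A(2) B(2) cross[OF A(1) B(1) A(2) B(2)] cross[OF B(1) A(1) B(2) A(2)] ab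
    by (intro add_mono mult_left_mono mult_nonneg_nonneg)
  also have "\<dots> = (a + b)\<^sup>2 * q" by (simp add: power2_eq_square algebra_simps)
  finally show ?thesis .
qed

section \<open>The family of hypotheses\<close>

definition hypZ :: "nat \<Rightarrow> nat \<Rightarrow> (nat \<times> nat \<Rightarrow> real) \<Rightarrow> real mat" where
  "hypZ n m B = 1\<^sub>m n + (1 / sqrt m) \<cdot>\<^sub>m signT n m B"

definition hypG :: "nat \<Rightarrow> nat \<Rightarrow> real \<Rightarrow> (nat \<times> nat \<Rightarrow> real) \<Rightarrow> real mat" where
  "hypG n m \<epsilon> B = (25 * \<epsilon> / m) \<cdot>\<^sub>m (hypZ n m B * hypZ n m B)"

locale hypothesis =
  fixes n m :: nat and \<epsilon> E :: real and B :: "nat \<times> nat \<Rightarrow> real"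
  assumes m: "5 \<le> m" "2 * m \<le> n" "n \<le> 2 * m + 1"
    and \<epsilon>: "0 \<le> \<epsilon>" "\<epsilon> < 1 / 200" and E: "1 < E" and B: "B \<in> flat_signs n m"
begin

abbreviation "T \<equiv> signT n m B"

lemma B_cube: "B \<in> sign_cube m" using B flat_signs_subset by blast

lemma sqrt_m: "sqrt m > 0" "sqrt m * sqrt m = m" using m by auto

lemma frob_T: "frob T \<le> 1.415 * m"
proof -
  have "(frob T)\<^sup>2 = 2 * (real m)\<^sup>2" unfolding frob_sq by (rule mip_signT_cube[OF m(2) B_cube])
  also have "\<dots> \<le> (1.415 * m)\<^sup>2" by (simp add: power2_eq_square)
  finally show ?thesis by (rule power2_le_imp_le) simp
qed

lemma frob_TT: "frob (T * T) \<le> 2 * m * sqrt m"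
proof -
  have "(frob (T * T))\<^sup>2 \<le> 4 * real m ^ 3" unfolding frob_sq using B by (simp add: flat_signs_def)
  also have "\<dots> = (2 * m * sqrt m)\<^sup>2" by (simp add: power_mult_distrib power3_eq_cube power2_eq_square)
  finally show ?thesis by (rule power2_le_imp_le) simp
qed

lemma ZZ: "hypZ n m B * hypZ n m B = 1\<^sub>m n + (2 / sqrt m) \<cdot>\<^sub>m T + (1 / m) \<cdot>\<^sub>m (T * T)"
proof -
  have c: "1 / sqrt m * (1 / sqrt m) = 1 / m" by (simp add: real_sqrt_mult[symmetric])
  have "hypZ n m B * hypZ n m B = 1\<^sub>m n + (1 / sqrt m) \<cdot>\<^sub>m T + ((1 / sqrt m) \<cdot>\<^sub>m T + (1 / sqrt m) \<cdot>\<^sub>m ((1 / sqrt m) \<cdot>\<^sub>m (T * T)))"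
    unfolding hypZ_def by (simp add: mat_ring_simps[where n=n]) (intro eq_matI, auto simp: algebra_simps)
  also have "\<dots> = 1\<^sub>m n + (2 / sqrt m) \<cdot>\<^sub>m T + (1 / m) \<cdot>\<^sub>m (T * T)"
    by (intro eq_matI) (auto simp: mult.assoc[symmetric] c)
  finally show ?thesis .
qed

lemma TT_carrier: "T * T \<in> carrier_mat n n"
  by (rule mult_carrier_mat[OF signT_carrier signT_carrier])

lemma frob_ZZ: "frob (hypZ n m B * hypZ n m B) \<le> 6.4 * sqrt m"
proof -
  have "frob (hypZ n m B * hypZ n m B) \<le> (frob (1\<^sub>m n) + frob ((2 / sqrt m) \<cdot>\<^sub>m T)) + frob ((1 / m) \<cdot>\<^sub>m (T * T))"
    unfolding ZZ using TT_carrier by (auto intro!: order_trans[OF frob_add[of _ n]] add_mono)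
  also have "\<dots> = sqrt n + 2 / sqrt m * frob T + 1 / m * frob (T * T)"
    using TT_carrier by (simp add: frob_one frob_smult[of _ n])
  \<comment> \<open>\<open>5 \<le> m\<close> gives n \<le> 2.25 m for the identity, 1.415 exceeds
    sqrt 2, and the last term is where the fourth-moment condition on \<open>B\<close> is
    spent.\<close>
  also have "\<dots> \<le> 1.5 * sqrt m + 2 / sqrt m * (1.415 * m) + 1 / m * (2 * m * sqrt m)"
  proof (intro add_mono mult_left_mono frob_T frob_TT)
    have "real n \<le> 1.5\<^sup>2 * m" using m by (simp add: power2_eq_square)
    then have "sqrt n \<le> sqrt (1.5\<^sup>2 * m)" by (rule real_sqrt_le_mono)
    then show "sqrt n \<le> 1.5 * sqrt m" by (simp add: real_sqrt_mult)
  qed auto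
  also have "2 / sqrt m * (1.415 * m) = 2.83 * sqrt m"
    using sqrt_m by (simp add: field_simps)
  also have "1 / m * (2 * m * sqrt m) = 2 * sqrt m" using m by simp
  also have "1.5 * sqrt m + 2.83 * sqrt m + 2 * sqrt m \<le> 6.4 * sqrt m" by (simp add: power2_eq_square)
  finally show ?thesis .
qed

lemma Z_symm: "symm n (hypZ n m B)"
  unfolding hypZ_def by (intro symm_add symm_smult symm_one signT_symm)

lemma frob_G: "frob (hypG n m \<epsilon> B) \<le> 160 * \<epsilon> / sqrt m"
proof -
  have "frob (hypG n m \<epsilon> B) = 25 * \<epsilon> / m * frob (hypZ n m B * hypZ n m B)"
    unfolding hypG_def using symm_carrier[OF Z_symm] \<epsilon> by (simp add: frob_smult[of _ n])
  also have "\<dots> \<le> 25 * \<epsilon> / m * (6.4 * sqrt m)" using \<epsilon> by (intro mult_left_mono frob_ZZ) auto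
  also have "\<dots> = 160 * \<epsilon> * (sqrt m / m)" by simp
  also have "sqrt m / m = 1 / sqrt m" using sqrt_m by (simp add: field_simps)
  finally show ?thesis by simp
qed

lemma frob_G': "frob (hypG n m \<epsilon> B) \<le> 0.36"
proof -
  \<comment> \<open>The numerical hypotheses meet here: 160 \<epsilon> < 0.8 from the bound on
    \<epsilon>, and \<open>5 \<le> m\<close> for the square root.\<close>
  have "2.23 \<le> sqrt m" using m by (intro real_le_rsqrt) (simp add: power2_eq_square)
  then have "160 * \<epsilon> / sqrt m \<le> 0.8 / 2.23" using \<epsilon> by (intro frac_le) auto
  then show ?thesis using frob_G by simp
qed

lemma mtr_G: "mtr (hypG n m \<epsilon> B) \<le> 0.525"
proof -
  have T0: "mtr T = 0" unfolding mtr_def by (intro sum.neutral) (auto simp: signT_def)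
  have "mtr (T * T) = mip T T"
    using mip_mult_left[OF signT_symm one_carrier_mat signT_carrier, of n m B m B] mip_one_left[OF TT_carrier]
    by (simp add: right_mult_one_mat[OF signT_carrier])
  then have TT: "mtr (T * T) = 2 * (real m)\<^sup>2" using mip_signT_cube[OF m(2) B_cube] by simp
  have "mtr (hypZ n m B * hypZ n m B) = n + 1 / m * (2 * (real m)\<^sup>2)"
    unfolding ZZ using TT_carrier by (simp add: mtr_add[of _ n] mtr_smult[of _ n] mtr_one T0 TT)
  also have "\<dots> = n + 2 * m" by (simp add: power2_eq_square)
  \<comment> \<open>2 m + 1 \<le> 2.2 m is sharp at m = 5.\<close>
  also have "\<dots> \<le> 4.2 * m" using m by simp
  finally have "25 * \<epsilon> / m * mtr (hypZ n m B * hypZ n m B) \<le> 25 * \<epsilon> / m * (4.2 * m)"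
    using \<epsilon> by (intro mult_left_mono) auto
  also have "\<dots> = 105 * \<epsilon>" using m by simp
  finally show ?thesis unfolding hypG_def using symm_carrier[OF Z_symm] \<epsilon> by (simp add: mtr_smult[of _ n])
qed

sublocale gs: gstate n "hypG n m \<epsilon> B" E "25 * \<epsilon> / m" "hypZ n m B"
proof unfold_locales
  show "symm n (hypG n m \<epsilon> B)"
    unfolding hypG_def by (intro symm_smult symm_mult Z_symm refl)
  show "frob (hypG n m \<epsilon> B) < 1" using frob_G' by simp
qed (use E \<epsilon> Z_symm in \<open>auto simp: hypG_def\<close>)

lemma frob_F: "frob gs.F \<le> 250 * \<epsilon> / sqrt m" "frob gs.F \<le> 0.5625"
proof -
  have "frob gs.F \<le> frob (hypG n m \<epsilon> B) / 0.64"
    by (rule order_trans[OF gs.frob_F], rule divide_left_mono) (use frob_G' in auto)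
  then show "frob gs.F \<le> 250 * \<epsilon> / sqrt m" "frob gs.F \<le> 0.5625" using frob_G frob_G' by auto
qed

text \<open>The vacuum weight scales the excitation block and must not degrade with
  \<open>n\<close>. The numbers: 0.525 + 0.36^2 / 0.64 < 0.728, and the square root of exp (- 0.728)
  is exp (- 0.364) \<ge> 1 - 0.364.\<close>

lemma vac_ge: "0.6 \<le> gs.vac"
proof -
  let ?f = "frob (hypG n m \<epsilon> B)"
  have "?f\<^sup>2 / (1 - ?f) \<le> 0.36\<^sup>2 / 0.64"
    using frob_G' by (intro frac_le power_mono) auto
  then have "mtr (hypG n m \<epsilon> B) + ?f\<^sup>2 / (1 - ?f) \<le> 0.728" using mtr_G by (simp add: power2_eq_square)
  then have "exp (- 0.728) \<le> exp (- (mtr (hypG n m \<epsilon> B) + ?f\<^sup>2 / (1 - ?f)))" by simp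
  also have "\<dots> \<le> Determinant.det (1\<^sub>m n - hypG n m \<epsilon> B)" by (rule gs.det_ge')
  finally have d: "exp (- 0.728) \<le> Determinant.det (1\<^sub>m n - hypG n m \<epsilon> B)" .
  have "(0.6 :: real)\<^sup>2 \<le> (exp (- 0.364))\<^sup>2"
    using exp_ge_add_one_self[of "- 0.364 :: real"] by (intro power_mono) auto
  also have "(exp (- 0.364))\<^sup>2 = exp (- 0.728 :: real)" by (simp add: power2_eq_square exp_add[symmetric])
  finally show ?thesis unfolding gs.vac_def using d by (intro real_le_rsqrt) (auto simp del: exp_ge_add_one_self)
qed

lemma cov_ok: "quantum_cov n gs.Sig" "op_norm_le n gs.Sig E"
  using gs.quantum_cov_Sig gs.op_norm_Sig frob_F(2) E by auto

text \<open>62500 is the square of 250 = 160 / 0.64, the constant for \<open>F\<close>. The final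
  division by 2 is compensated by the denominator, which is at least 1 / 2.\<close>

lemma chi_exponent:
  "frob gs.Dl < 1" "(frob gs.Dl)\<^sup>2 / (1 - (frob gs.Dl)\<^sup>2) / 2 \<le> 62500 * \<epsilon>\<^sup>2 / (m * E\<^sup>2)"
proof -
  have e: "frob gs.Dl = frob gs.F / (E + 1/2)" by (rule gs.frob_Dl)
  have "frob gs.F / (E + 1/2) \<le> 0.5625 / 1" using frob_F(2) E by (intro frac_le) auto
  then have d: "frob gs.Dl \<le> 0.5625" unfolding e by simp
  then show "frob gs.Dl < 1" by simp
  have "(frob gs.Dl)\<^sup>2 \<le> 0.5625\<^sup>2" using d by (intro power_mono) auto
  then have h: "1/2 \<le> 1 - (frob gs.Dl)\<^sup>2" by (simp add: power2_eq_square)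
  have "frob gs.F / (E + 1/2) \<le> (250 * \<epsilon> / sqrt m) / E" using frob_F(1) E \<epsilon> by (intro frac_le) auto
  then have "(frob gs.Dl)\<^sup>2 \<le> (250 * \<epsilon> / sqrt m / E)\<^sup>2" unfolding e using E by (intro power_mono) auto
  also have "\<dots> = 62500 * \<epsilon>\<^sup>2 / (m * E\<^sup>2)" by (simp add: power_divide power_mult_distrib)
  finally have s: "(frob gs.Dl)\<^sup>2 \<le> 62500 * \<epsilon>\<^sup>2 / (m * E\<^sup>2)" .
  have "(frob gs.Dl)\<^sup>2 / (1 - (frob gs.Dl)\<^sup>2) / 2 \<le> (frob gs.Dl)\<^sup>2 / (1/2) / 2"
    using h by (intro divide_right_mono divide_left_mono) auto
  then show "(frob gs.Dl)\<^sup>2 / (1 - (frob gs.Dl)\<^sup>2) / 2 \<le> 62500 * \<epsilon>\<^sup>2 / (m * E\<^sup>2)" using s by simp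
qed

text \<open>The identity and \<open>T * T\<close> are even, so off the diagonal blocks only the
  cross term 2 T / sqrt m of the square survives.\<close>

lemma G_off_block:
  assumes "i < n" "j < n" "\<not> same_block m i j"
  shows "hypG n m \<epsilon> B $$ (i,j) = 50 * \<epsilon> / (m * sqrt m) * T $$ (i,j)"
proof -
  have "i \<noteq> j" using assms(3) by (auto simp: same_block_def)
  then have "(hypZ n m B * hypZ n m B) $$ (i,j) = 2 / sqrt m * T $$ (i,j)"
    unfolding ZZ using assms TT_carrier carrier_matD[OF signT_carrier[of n m B]]
    by (simp add: signT_sq_index(3)[OF m(2) assms])
  then show ?thesis unfolding hypG_def using assms symm_carrier[OF Z_symm] by simp
qed

end

text \<open>The Cayley transform is applied to \<open>t\<close> times the off-diagonal difference, with \<open>t\<close> chosen to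
  (nearly) maximise \<open>t \<parallel>T\<parallel>\<^sub>2\<^sup>2 - t\<^sup>3 \<parallel>T\<parallel>\<^sub>4\<^sup>4\<close>.\<close>

lemma close_hypotheses_hamming:
  assumes h: "hypothesis n m \<epsilon> E B" "hypothesis n m \<epsilon> E B'" and \<epsilon>: "0 < \<epsilon>"
    and A: "density_kernel n A"
      "trace_dist n A (gauss_state_kernel n (gstate.Sig n (hypG n m \<epsilon> B) E)) \<le> ereal \<epsilon>"
      "trace_dist n A (gauss_state_kernel n (gstate.Sig n (hypG n m \<epsilon> B') E)) \<le> ereal \<epsilon>"
  shows "4 * hamming m B B' \<le> m * m"
proof (rule ccontr)
  interpret X: hypothesis n m \<epsilon> E B by (rule h(1))
  interpret Y: hypothesis n m \<epsilon> E B' by (rule h(2))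
  assume "\<not> 4 * hamming m B B' \<le> m * m"
  then have "real (m * m) \<le> real (4 * hamming m B B')" by (simp only: of_nat_le_iff)
  then have ham: "real m ^ 2 / 4 \<le> hamming m B B'" by (simp add: power2_eq_square)
  \<comment> \<open>The two excitation blocks carry the vacuum weights \<open>a\<close> and
    \<open>b\<close>, which may differ; the estimates are phrased in their sum
    \<open>w\<close>.\<close>
  define a b w where "a = X.gs.vac" and "b = Y.gs.vac" and "w = a + b"
  have ab: "a \<ge> 0.6" "b \<ge> 0.6" "w \<ge> 1.2" unfolding w_def a_def b_def using X.vac_ge Y.vac_ge by auto
  note sm = X.sqrt_m
  define D where "D = a \<cdot>\<^sub>m signT n m B - b \<cdot>\<^sub>m signT n m B'"
  have D: "D \<in> carrier_mat n n" "symm n D"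
    unfolding D_def by (auto intro!: symm_minus symm_smult signT_symm simp: minus_carrier_mat)
  have D2: "w\<^sup>2 * (real m ^ 2) / 2 \<le> mip D D"
  proof -
    have "w\<^sup>2 * (real m ^ 2) / 2 = 2 * w\<^sup>2 * (real m ^ 2 / 4)" by simp
    also have "\<dots> \<le> 2 * w\<^sup>2 * hamming m B B'" using ham by (intro mult_left_mono) auto
    also have "\<dots> \<le> mip D D"
      unfolding D_def w_def using ab by (intro mip_signT_diff_ge X.m X.B_cube Y.B_cube) auto
    finally show ?thesis .
  qed
  have D4: "mip (D * D) (D * D) \<le> 4 * w ^ 4 * real m ^ 3"
  proof -
    have "frob (D * D) \<le> w\<^sup>2 * (2 * m * sqrt m)"
      unfolding D_def w_def using ab
      by (intro frob_sq_diff_le[OF signT_symm X.frob_TT signT_symm Y.frob_TT]) auto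
    then have "(frob (D * D))\<^sup>2 \<le> (w\<^sup>2 * (2 * m * sqrt m))\<^sup>2" by (intro power_mono) auto
    also have "\<dots> = 4 * w ^ 4 * real m ^ 3"
      by (simp add: power_mult_distrib power3_eq_cube power2_eq_square power4_eq_xxxx)
    finally show ?thesis by (simp add: frob_sq)
  qed
  \<comment> \<open>For the bounds \<open>D2\<close> and \<open>D4\<close> stationarity gives t^2 =
    1 / (24 w^2 m); 25 replaces 24 to make \<open>t\<close> rational in
    \<open>w * sqrt m\<close>.\<close>
  define t where "t = 1 / (5 * w * sqrt m)"
  have t: "t > 0" using ab sm by (simp add: t_def)
  define C where "C = t \<cdot>\<^sub>m D"
  have C: "symm n C" unfolding C_def by (rule symm_smult[OF D(2)])
  have Codd: "C $$ (i,j) = 0" if "i < n" "j < n" "same_block m i j" for i j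
    using that by (simp add: C_def D_def signT_odd)
  obtain P S where PS: "symm n P" "symm n S" "P * P + S * S = 1\<^sub>m n" "P * S = S * P"
    and Sodd: "\<And>i j. i < n \<Longrightarrow> j < n \<Longrightarrow> same_block m i j \<Longrightarrow> S $$ (i,j) = 0"
    and al: "2 * (mip C C - mip (C * C) (C * C)) \<le> mip S C"
    using cayley_alignment[OF C Codd] by blast
  note Sc = symm_carrier[OF PS(2)]
  define K where "K = (a / 2) \<cdot>\<^sub>m hypG n m \<epsilon> B"
  define L where "L = (b / 2) \<cdot>\<^sub>m hypG n m \<epsilon> B'"
  have KL: "K \<in> carrier_mat n n" "L \<in> carrier_mat n n" using X.gs.G Y.gs.G by (auto simp: K_def L_def)
  define g where "g = 25 * \<epsilon> / (m * sqrt m)"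
  have up: "mip S (K - L) \<le> 4 * \<epsilon>"
    using close_states_alignment[OF X.gs.s X.gs.excitation_block_Sig Y.gs.excitation_block_Sig A PS]
    by (simp add: K_def L_def a_def b_def)
  \<comment> \<open>\<open>S\<close> is odd, so the diagonal blocks of the difference, which are not
    linear in the signs, drop out of the pairing.\<close>
  have "mip S (K - L) = mip S ((g / t) \<cdot>\<^sub>m C)"
    unfolding mip_eq[OF Sc]
  proof (intro sum.cong refl)
    fix i j assume ij: "i \<in> {..<n}" "j \<in> {..<n}"
    show "S $$ (i,j) * (K - L) $$ (i,j) = S $$ (i,j) * ((g / t) \<cdot>\<^sub>m C) $$ (i,j)"
    proof (cases "same_block m i j")
      case True then show ?thesis using Sodd ij by simp
    next
      case False
      have "(K - L) $$ (i,j) = a / 2 * (2 * g * signT n m B $$ (i,j)) - b / 2 * (2 * g * signT n m B' $$ (i,j))"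
        using ij False X.gs.G Y.gs.G
        by (simp add: K_def L_def X.G_off_block Y.G_off_block g_def)
      also have "\<dots> = ((g / t) \<cdot>\<^sub>m C) $$ (i,j)"
        using ij t by (simp add: C_def D_def algebra_simps)
      finally show ?thesis by simp
    qed
  qed
  also have "\<dots> = g / t * mip S C" using Sc symm_carrier[OF C] by (simp add: mip_smult_right[of _ n])
  finally have mS: "mip S (K - L) = g / t * mip S C" .
  have g0: "g > 0" using \<epsilon> sm X.m by (simp add: g_def)
  have "mip C C = t\<^sup>2 * mip D D"
    unfolding C_def using D(1) by (simp add: mip_smult_left[of _ n] mip_smult_right[of _ n] power2_eq_square)
  moreover have "mip (C * C) (C * C) = t ^ 4 * mip (D * D) (D * D)"
  proof -
    have "C * C = (t * t) \<cdot>\<^sub>m (D * D)"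
      unfolding C_def using D(1) by (simp add: mat_ring_simps[where n=n]) (intro eq_matI, auto)
    then show ?thesis
      using D(1) by (simp add: mip_smult_left[of _ n] mip_smult_right[of _ n] power4_eq_xxxx)
  qed
  ultimately have "2 * (t\<^sup>2 * (w\<^sup>2 * (real m ^ 2) / 2) - t ^ 4 * (4 * w ^ 4 * real m ^ 3)) \<le> mip S C"
    using al mult_left_mono[OF D2, of "t\<^sup>2"] mult_left_mono[OF D4, of "t ^ 4"] by simp
  moreover have "t\<^sup>2 * (w\<^sup>2 * (real m ^ 2) / 2) = m / 50"
    using ab X.m by (simp add: t_def power_divide power_mult_distrib power2_eq_square)
  moreover have "t ^ 4 * (4 * w ^ 4 * real m ^ 3) = 4 * m / 625"
  proof -
    have "sqrt m ^ 4 = real m ^ 2" by (simp add: power4_eq_xxxx power2_eq_square)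
    then show ?thesis
      using ab X.m by (simp add: t_def power_divide power_mult_distrib power2_eq_square power3_eq_cube)
  qed
  ultimately have "2 * (m / 50 - 4 * m / 625) \<le> mip S C" by simp
  then have "g / t * (0.0272 * m) \<le> g / t * mip S C"
    using g0 t by (intro mult_left_mono) auto
  also have "\<dots> \<le> 4 * \<epsilon>" using up mS by simp
  finally have "g / t * (0.0272 * m) \<le> 4 * \<epsilon>" .
  \<comment> \<open>The origin of the constant 25 in \<open>hypG\<close>: with this \<open>t\<close>
    and \<open>w \<ge> 1.2\<close> it yields 4.08 \<epsilon>, just above the 4 \<epsilon> possible
    for states with a common approximation.\<close>
  moreover have "g / t * (0.0272 * m) = 3.4 * \<epsilon> * w"
    using sm X.m by (simp add: g_def t_def field_simps)
  moreover have "3.4 * \<epsilon> * 1.2 \<le> 3.4 * \<epsilon> * w" using ab \<epsilon> by (intro mult_left_mono) auto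
  ultimately show False using \<epsilon> by simp
qed

section \<open>Numerical bounds, and averaging over the hypotheses\<close>

text \<open>The case m = 5 is nearly sharp and dictates 0.882. From there on the exponent grows by 2
  m + 1, which at least halves the power while the linear factor at most doubles.\<close>

lemma packing_numeric:
  fixes b :: real
  assumes b: "0 \<le> b" "b \<le> 0.882" and m: "5 \<le> m"
  shows "2 * real m * b ^ (m * m) \<le> 4 / 9"
proof -
  have "2 * real m * 0.882 ^ (m * m) \<le> (4 / 9 :: real)"
    using m
  proof (induction m rule: dec_induct)
    case base
    show ?case by (simp add: power_divide divide_simps)
  next
    case (step k)
    have p: "(k + 1) * (k + 1) = k * k + (2 * k + 1)" by simp
    have "(0.882 :: real) ^ (2 * k + 1) \<le> 0.882 ^ 6" using step by (intro power_decreasing) auto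
    also have "\<dots> \<le> 1 / 2" by (simp add: power_divide divide_simps)
    finally have q: "(0.882 :: real) ^ (2 * k + 1) \<le> 1 / 2" .
    have "2 * real (k + 1) * 0.882 ^ ((k + 1) * (k + 1)) = (2 * real (k + 1) * 0.882 ^ (k * k)) * 0.882 ^ (2 * k + 1)"
      unfolding p power_add by simp
    also have "\<dots> \<le> (2 * real (k + 1) * 0.882 ^ (k * k)) * (1 / 2)" using q by (intro mult_left_mono) auto
    also have "\<dots> = real (k + 1) * 0.882 ^ (k * k)" by simp
    also have "\<dots> \<le> (2 * real k) * 0.882 ^ (k * k)" using step by (intro mult_right_mono) auto
    finally show ?case using step.IH by simp
  qed
  moreover have "2 * real m * b ^ (m * m) \<le> 2 * real m * 0.882 ^ (m * m)"
    using b by (intro mult_left_mono power_mono) auto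
  ultimately show ?thesis by linarith
qed

text \<open>A ball of radius m^2 / 4 fills at most the fraction (2 r / 3)^(m^2) of the cube, with 2
  r / 3 about 0.877. The rate 1 / 200 is what fits between this and the 0.882 of
  \<open>packing_numeric\<close>.\<close>

lemma packing_exponent:
  fixes r :: real
  assumes r: "r > 0" "r ^ 4 = 3" and m: "5 \<le> m"
  shows "exp (real (m * m) / 200) * (9 * (2 * real m) * (4 * r / 3) ^ (m * m)) \<le> 4 * 2 ^ (m * m)"
proof -
  define b where "b = exp (1 / 200) * (2 * r / 3)"
  have "r ^ 4 \<le> 1.3161 ^ 4" unfolding r(2) by (simp add: power_divide divide_simps)
  then have r1: "r \<le> 1.3161" using r(1) by (simp add: power_mono_iff)
  have "1 - 1 / 200 \<le> exp (- (1 / 200) :: real)" using exp_ge_add_one_self[of "- (1/200) :: real"] by simp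
  then have "exp (1 / 200 :: real) \<le> 200 / 199" by (simp add: exp_minus field_simps)
  then have "b \<le> 200 / 199 * (2 * 1.3161 / 3)" unfolding b_def using r r1 by (intro mult_mono) auto
  then have b: "0 \<le> b" "b \<le> 0.882" using r(1) by (auto simp: b_def)
  have "exp (real (m * m) / 200) = exp (1 / 200) ^ (m * m)" by (simp add: exp_of_nat_mult[symmetric])
  moreover have "(4 * r / 3) ^ (m * m) = 2 ^ (m * m) * (2 * r / 3) ^ (m * m)"
    by (simp add: power_mult_distrib[symmetric])
  ultimately have "exp (real (m * m) / 200) * (9 * (2 * real m) * (4 * r / 3) ^ (m * m)) =
     9 * 2 ^ (m * m) * (2 * real m * b ^ (m * m))"
    unfolding b_def power_mult_distrib[of "exp (1 / 200)" "2 * r / 3"] by simp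
  also have "\<dots> \<le> 9 * 2 ^ (m * m) * (4 / 9)" by (intro mult_left_mono packing_numeric[OF b m]) auto
  finally show ?thesis by simp
qed

text \<open>A counting substitute for Fano's inequality: the chi-square comparison is summed over
  all typical sign matrices, and the reference probabilities of their success events are bounded
  together by the overlap \<open>V\<close>.\<close>

lemma heterodyne_lower_bound:
  assumes E: "1 < E" and \<epsilon>: "0 < \<epsilon>" "\<epsilon> < 1 / 200" and n: "10 \<le> n"
    and learn: "heterodyne_learns n N E \<epsilon> A"
  shows "E\<^sup>2 * real n ^ 3 / \<epsilon>\<^sup>2 \<le> 337500000 * N"
proof -
  define m where "m = n div 2"
  have m: "5 \<le> m" "2 * m \<le> n" "n \<le> 2 * m + 1" using n by (auto simp: m_def)
  have hyp: "hypothesis n m \<epsilon> E B" if "B \<in> flat_signs n m" for B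
    using m \<epsilon> E that by (simp add: hypothesis_def)
  define Sg where "Sg B = gstate.Sig n (hypG n m \<epsilon> B) E" for B
  have "\<exists>S \<in> sets (hetero_samples n N (Sg B)). measure (hetero_samples n N (Sg B)) S \<ge> 2/3 \<and>
      (\<forall>\<omega>\<in>S. density_kernel n (A \<omega>) \<and> trace_dist n (A \<omega>) (gauss_state_kernel n (Sg B)) \<le> ereal \<epsilon>)"
    if "B \<in> flat_signs n m" for B
    using learn hypothesis.cov_ok[OF hyp[OF that]] unfolding heterodyne_learns_def Sg_def by blast
  then obtain S where S: "\<And>B. B \<in> flat_signs n m \<Longrightarrow> S B \<in> sets (hetero_samples n N (Sg B))"
      "\<And>B. B \<in> flat_signs n m \<Longrightarrow> measure (hetero_samples n N (Sg B)) (S B) \<ge> 2/3"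
      "\<And>B \<omega>. B \<in> flat_signs n m \<Longrightarrow> \<omega> \<in> S B \<Longrightarrow> density_kernel n (A \<omega>)"
      "\<And>B \<omega>. B \<in> flat_signs n m \<Longrightarrow> \<omega> \<in> S B \<Longrightarrow> trace_dist n (A \<omega>) (gauss_state_kernel n (Sg B)) \<le> ereal \<epsilon>"
    by metis
  define Q where "Q = PiM {..<N} (\<lambda>_. gauss_measure (2*n) (Cov0 n E)) \<Otimes>\<^sub>M uniform_measure lborel {0..1::real}"
  have "prob_space Q"
    unfolding Q_def using E
    by (intro prob_space_pair prob_space_PiM prob_space_gauss_measure pd_Cov0 prob_space_uniform_measure) auto
  then interpret Q: prob_space Q .
  define r where "r = sqrt (sqrt 3)"
  have r: "r > 0" "r ^ 4 = 3" by (simp_all add: r_def power4_eq_xxxx mult.assoc)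
  define V where "V = (4 * r / 3) ^ (m * m)"
  define K where "K = real (card (flat_signs n m))"
  define Y where "Y = exp (62500 * \<epsilon>\<^sup>2 / (m * E\<^sup>2)) ^ N"
  have fin: "finite (flat_signs n m)" by (rule finite_subset[OF flat_signs_subset finite_sign_cube])
  have V: "V > 0" using r by (simp add: V_def)
  have K2: "2 ^ (m * m) \<le> 2 * real m * K" unfolding K_def using m by (intro card_flat_signs) auto
  have K: "K > 0"
  proof -
    have "0 < 2 * real m * K" by (rule less_le_trans[OF _ K2]) simp
    then show ?thesis by (simp add: zero_less_mult_iff)
  qed
  \<comment> \<open>This weight makes the reference term equal to K / 3, half of the left side 2 K /
    3.\<close>
  define l where "l = 2 * K / (3 * V)"
  have l: "l > 0" using K V by (simp add: l_def)
  have SQ: "S B \<in> sets Q" if "B \<in> flat_signs n m" for B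
  proof -
    interpret h: hypothesis n m \<epsilon> E B by (rule hyp[OF that])
    show ?thesis unfolding Q_def
      by (rule h.gs.hetero_samples_le(1)[OF h.chi_exponent(1) l]) (use S(1)[OF that] in \<open>simp add: Sg_def\<close>)
  qed
  have each: "ennreal (2/3) \<le> ennreal (l / 2) * emeasure Q (S B) + ennreal (Y / (2 * l))" if "B \<in> flat_signs n m" for B
  proof -
    interpret h: hypothesis n m \<epsilon> E B by (rule hyp[OF that])
    have SB: "S B \<in> sets (hetero_samples n N h.gs.Sig)" using S(1)[OF that] by (simp add: Sg_def)
    have "2/3 \<le> enn2real (emeasure (hetero_samples n N h.gs.Sig) (S B))"
      using S(2)[OF that] by (simp add: Sg_def measure_def)
    then have "ennreal (2/3) \<le> ennreal (enn2real (emeasure (hetero_samples n N h.gs.Sig) (S B)))"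
      by (rule ennreal_leI)
    also have "\<dots> \<le> emeasure (hetero_samples n N h.gs.Sig) (S B)"
      by (simp add: ennreal_enn2real_if)
    also have "\<dots> \<le> ennreal (l / 2) * emeasure Q (S B) +
        ennreal (exp ((frob h.gs.Dl)\<^sup>2 / (1 - (frob h.gs.Dl)\<^sup>2) / 2) ^ N / (2 * l))"
      unfolding Q_def by (rule h.gs.hetero_samples_le(2)[OF h.chi_exponent(1) l SB])
    also have "\<dots> \<le> ennreal (l / 2) * emeasure Q (S B) + ennreal (Y / (2 * l))"
      unfolding Y_def using h.chi_exponent(2) l
      by (intro add_left_mono ennreal_leI divide_right_mono power_mono) auto
    finally show ?thesis .
  qed
  have overlap: "real (card {B \<in> flat_signs n m. \<omega> \<in> S B}) \<le> V" for \<omega>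
  proof (cases "{B \<in> flat_signs n m. \<omega> \<in> S B} = {}")
    case True
    show ?thesis unfolding True using V by simp
  next
    case False
    \<comment> \<open>Any one hypothesis compatible with the output serves as centre; all the others
      lie in its Hamming ball.\<close>
    then obtain B where B: "B \<in> flat_signs n m" "\<omega> \<in> S B" by auto
    have "4 * hamming m B B' \<le> m * m" if "B' \<in> {B \<in> flat_signs n m. \<omega> \<in> S B}" for B'
      using that B S(3,4) \<epsilon>
      by (intro close_hypotheses_hamming[of n m \<epsilon> E B B' "A \<omega>"] hyp) (auto simp: Sg_def)
    then show ?thesis
      unfolding V_def using flat_signs_subset B(1) r by (intro card_hamming_ball[of B]) auto
  qed
  have sumQ: "(\<Sum>B\<in>flat_signs n m. emeasure Q (S B)) \<le> ennreal V"
  proof -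
    \<comment> \<open>Double counting: under \<open>Q\<close> the sum is the mean number of success
      events that contain the outcome.\<close>
    have "(\<Sum>B\<in>flat_signs n m. emeasure Q (S B)) = (\<Sum>B\<in>flat_signs n m. \<integral>\<^sup>+\<omega>. indicator (S B) \<omega> \<partial>Q)"
      using SQ by simp
    also have "\<dots> = (\<integral>\<^sup>+\<omega>. (\<Sum>B\<in>flat_signs n m. indicator (S B) \<omega>) \<partial>Q)"
      using SQ by (intro nn_integral_sum[symmetric]) auto
    also have "\<dots> \<le> (\<integral>\<^sup>+\<omega>. ennreal V \<partial>Q)"
    proof (rule nn_integral_mono)
      fix \<omega>
      have "(\<Sum>B\<in>flat_signs n m. indicator (S B) \<omega>) = (\<Sum>B\<in>{B \<in> flat_signs n m. \<omega> \<in> S B}. 1 :: ennreal)"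
        using fin by (intro sum.mono_neutral_cong_right) (auto simp: indicator_def)
      also have "\<dots> = ennreal (real (card {B \<in> flat_signs n m. \<omega> \<in> S B}))"
        by (simp add: ennreal_of_nat_eq_real_of_nat)
      also have "\<dots> \<le> ennreal V" by (rule ennreal_leI[OF overlap])
      finally show "(\<Sum>B\<in>flat_signs n m. indicator (S B) \<omega>) \<le> ennreal V" .
    qed
    also have "\<dots> = ennreal V" by (simp add: Q.emeasure_space_1)
    finally show ?thesis .
  qed
  have Y0: "Y > 0" by (simp add: Y_def)
  have "ennreal (K * (2/3)) = (\<Sum>B\<in>flat_signs n m. ennreal (2/3))"
    by (simp add: K_def ennreal_mult[symmetric] ennreal_of_nat_eq_real_of_nat)
  also have "\<dots> \<le> (\<Sum>B\<in>flat_signs n m. ennreal (l / 2) * emeasure Q (S B) + ennreal (Y / (2 * l)))"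
    by (rule sum_mono) (rule each)
  also have "\<dots> = ennreal (l / 2) * (\<Sum>B\<in>flat_signs n m. emeasure Q (S B)) + ennreal (K * (Y / (2 * l)))"
    using l Y0 by (simp add: sum.distrib sum_distrib_left K_def ennreal_mult[symmetric] ennreal_of_nat_eq_real_of_nat)
  also have "\<dots> \<le> ennreal (l / 2) * ennreal V + ennreal (K * (Y / (2 * l)))"
    by (intro add_right_mono mult_left_mono sumQ) auto
  also have "\<dots> = ennreal (l / 2 * V + K * (Y / (2 * l)))"
    using l V K Y0 by (simp add: ennreal_mult[symmetric] ennreal_plus)
  finally have "K * (2/3) \<le> l / 2 * V + K * (Y / (2 * l))"
    using l V K Y0 by (subst (asm) ennreal_le_iff) auto
  also have "l / 2 * V = K / 3" using V by (simp add: l_def)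
  also have "K * (Y / (2 * l)) = 3 * V * Y / 4" using K V by (simp add: l_def)
  finally have "4 * K \<le> 9 * V * Y" by simp
  have "exp (real (m * m) / 200) \<le> Y"
  proof -
    have "exp (real (m * m) / 200) * (9 * (2 * real m) * V) \<le> 4 * 2 ^ (m * m)"
      unfolding V_def by (rule packing_exponent[OF r m(1)])
    also have "\<dots> \<le> 4 * (2 * real m * K)" by (rule mult_left_mono[OF K2]) simp
    also have "\<dots> = 2 * real m * (4 * K)" by simp
    also have "\<dots> \<le> 2 * real m * (9 * V * Y)" using \<open>4 * K \<le> 9 * V * Y\<close> by (intro mult_left_mono) auto
    also have "\<dots> = Y * (9 * (2 * real m) * V)" by simp
    finally show ?thesis by (rule mult_right_le_imp_le) (use V m in auto)
  qed
  also have "Y = exp (real N * (62500 * \<epsilon>\<^sup>2 / (m * E\<^sup>2)))" unfolding Y_def by (rule exp_of_nat_mult[symmetric])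
  finally have "real (m * m) / 200 \<le> real N * (62500 * \<epsilon>\<^sup>2 / (m * E\<^sup>2))" by simp
  then have main: "real m ^ 3 * E\<^sup>2 \<le> 12500000 * N * \<epsilon>\<^sup>2"
    using m E by (simp add: field_simps power3_eq_cube)
  \<comment> \<open>The final constant is 27 * 200 * 62500: the cube of this 3, the rate 1 / 200 and
    the chi-square exponent.\<close>
  have "real n \<le> 3 * real m" using m by simp
  then have "real n ^ 3 \<le> (3 * real m) ^ 3" by (intro power_mono) auto
  then have "E\<^sup>2 * real n ^ 3 \<le> E\<^sup>2 * (27 * real m ^ 3)" by (intro mult_left_mono) (auto simp: power_mult_distrib)
  also have "\<dots> \<le> 27 * (12500000 * N * \<epsilon>\<^sup>2)" using main by (simp add: ac_simps)
  finally show ?thesis using \<epsilon> by (simp add: field_simps)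
qed

text \<open>A success event of probability at least 2 / 3 is nonempty, and at any of its points a
  nonnegative trace distance is at most \<epsilon>. What remains is to exhibit one admissible
  covariance.\<close>

lemma heterodyne_learns_nonneg:
  assumes E: "1 < E" and n: "10 \<le> n" and learn: "heterodyne_learns n N E \<epsilon> A"
  shows "0 \<le> \<epsilon>"
proof -
  have "\<exists>\<Sigma>. quantum_cov n \<Sigma> \<and> op_norm_le n \<Sigma> E"
  proof -
    define m where "m = n div 2"
    have m: "5 \<le> m" "2 * m \<le> n" "n \<le> 2 * m + 1" using n by (auto simp: m_def)
    have "0 < 2 * real m * real (card (flat_signs n m))"
      by (rule less_le_trans[OF _ card_flat_signs]) (use m in auto)
    then have "flat_signs n m \<noteq> {}" by auto
    then obtain B where "B \<in> flat_signs n m" by auto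
    \<comment> \<open>At \<epsilon> = 0 the matrix \<open>G\<close> vanishes and the state is the
      pure squeezed vacuum.\<close>
    then have "hypothesis n m 0 E B" using m E by (simp add: hypothesis_def)
    from hypothesis.cov_ok[OF this] show ?thesis by blast
  qed
  then obtain \<Sigma> S where "measure (hetero_samples n N \<Sigma>) S \<ge> 2/3"
      and S: "\<forall>\<omega>\<in>S. trace_dist n (A \<omega>) (gauss_state_kernel n \<Sigma>) \<le> ereal \<epsilon>"
    using learn unfolding heterodyne_learns_def by blast
  then have "S \<noteq> {}" by auto
  then obtain \<omega> where "\<omega> \<in> S" by auto
  then have "0 \<le> ereal \<epsilon>" using S trace_dist_nonneg order_trans by blast
  then show ?thesis by simp
qed

theorem theorem4:
  "\<exists>c > 0. \<forall>(E :: real) (\<epsilon> :: real) (n :: nat) (N :: nat) A.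
     E > 1 \<longrightarrow> \<epsilon> < 0.005 \<longrightarrow> n \<ge> 10 \<longrightarrow> heterodyne_learns n N E \<epsilon> A \<longrightarrow>
     real N \<ge> c * E\<^sup>2 * real n ^ 3 / \<epsilon>\<^sup>2"
proof (intro exI[of _ "1 / 337500000"] conjI allI impI)
  fix E \<epsilon> :: real and n N :: nat and A
  assume a: "1 < E" "\<epsilon> < 0.005" "10 \<le> n" "heterodyne_learns n N E \<epsilon> A"
  show "1 / 337500000 * E\<^sup>2 * real n ^ 3 / \<epsilon>\<^sup>2 \<le> real N"
  \<comment> \<open>For \<epsilon> = 0 division by zero makes the claimed bound 0; negative
    \<epsilon> admits no learner.\<close>
  proof (cases "\<epsilon> = 0")
    case False
    then have "0 < \<epsilon>" using heterodyne_learns_nonneg[OF a(1,3,4)] by simp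
    then show ?thesis using heterodyne_lower_bound[OF a(1) _ _ a(3,4)] a(2) by simp
  qed simp
qed simp

end
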